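(* Let $n\ge2$, let $\Omega\subset\mathbb{R}^n$ be a bounded domain, let $q\ge2$, $p=q/(q-1)$, $\alpha\in(0,1)$ and $f\in B^\alpha_{p,\infty,loc}(\Omega)$. Let $u\in W^{1,q}_{loc}(\Omega)$ be a local weak solution in $\Omega$ of $$-\mathrm{div}\left((|\nabla u|-1)_+^{q-1}\frac{\nabla u}{|\nabla u|}\right)=f.$$ Then, with $H_{\frac q2}(\nabla u)=(|\nabla u|-1)_+^{q/2}\frac{\nabla u}{|\nabla u|}$, $$H_{\frac q2}(\nabla u)\in L^r_{loc}(\Omega)\ \text{ for all } r\in\left[1,\frac{2n}{n-\alpha-1}\right)$$ and $$\nabla u\in L^s_{loc}(\Omega)\ \text{ for all } s\in\left[1,\frac{nq}{n-\alpha-1}\right).$$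
   Context: $(\cdot)_+$ is the positive part. For $a>0$, the vector field $(|\xi|-1)_+^{a}\xi/|\xi|$ is understood to be $0$ when $|\xi|\le1$ (in particular at $\xi=0$). Local weak solution: $u\in W^{1,q}_{loc}(\Omega)$ satisfies $\int_\Omega\langle(|\nabla u|-1)_+^{q-1}\frac{\nabla u}{|\nabla u|},\nabla\varphi\rangle\,dx=\int_\Omega f\varphi\,dx$ for every $\varphi\in W^{1,q}(\Omega)$ with compact support in $\Omega$. Besov spaces: for $0<\beta<1$, $1\le m<\infty$, $v\in B^\beta_{m,\infty}(\mathbb{R}^n)$ means $v\in L^m(\mathbb{R}^n)$ and $\sup_{h\in\mathbb{R}^n\setminus\{0\}}\left(\int_{\mathbb{R}^n}\frac{|v(x+h)-v(x)|^m}{|h|^{\beta m}}dx\right)^{1/m}<\infty$. $v\in B^\beta_{m,\infty,loc}(\Omega)$ means $\varphi v\in B^\beta_{m,\infty}(\mathbb{R}^n)$ for every $\varphi\in C_c^\infty(\Omega)$. *)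

theory Defs
  imports "HOL-Analysis.Analysis"
begin

section \<open>Lebesgue spaces\<close>

text \<open>Functions on a set are represented by total functions; only their values on the set matter.\<close>

definition Lp_on :: "real \<Rightarrow> 'a::euclidean_space set \<Rightarrow> ('a \<Rightarrow> 'b::euclidean_space) set" where
  "Lp_on m S = {v. v \<in> borel_measurable (lebesgue_on S) \<and>
                   integrable (lebesgue_on S) (\<lambda>x. norm (v x) powr m)}"

definition Lp_loc :: "real \<Rightarrow> 'a::euclidean_space set \<Rightarrow> ('a \<Rightarrow> 'b::euclidean_space) set" where
  "Lp_loc m \<Omega> = {v. \<forall>K. compact K \<and> K \<subseteq> \<Omega> \<longrightarrow> v \<in> Lp_on m K}"

section \<open>Test functions\<close>

fun Ck :: "nat \<Rightarrow> ('a::euclidean_space \<Rightarrow> real) \<Rightarrow> bool" where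
  "Ck 0 v \<longleftrightarrow> continuous_on UNIV v"
| "Ck (Suc k) v \<longleftrightarrow> (\<forall>x. v differentiable (at x)) \<and>
     (\<forall>i\<in>Basis. Ck k (\<lambda>x. frechet_derivative v (at x) i))"

text \<open>Elements of \<open>C\<^sub>c\<^sup>\<infinity>(\<Omega>)\<close>, extended by zero to the whole space.\<close>

definition test_functions :: "'a::euclidean_space set \<Rightarrow> ('a \<Rightarrow> real) set" where
  "test_functions \<Omega> = {\<phi>. (\<forall>k. Ck k \<phi>) \<and>
     compact (closure {x. \<phi> x \<noteq> 0}) \<and> closure {x. \<phi> x \<noteq> 0} \<subseteq> \<Omega>}"

section \<open>Sobolev spaces\<close>

text \<open>A weak gradient is unique only up to null sets, so it is treated as a relation:
  \<open>G\<close> is any representative of the weak gradient of \<open>u\<close> in \<open>\<Omega>\<close>.\<close>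

definition weak_gradient ::
    "'a::euclidean_space set \<Rightarrow> ('a \<Rightarrow> real) \<Rightarrow> ('a \<Rightarrow> 'a) \<Rightarrow> bool" where
  "weak_gradient \<Omega> u G \<longleftrightarrow> u \<in> Lp_loc 1 \<Omega> \<and> G \<in> Lp_loc 1 \<Omega> \<and>
     (\<forall>\<phi>\<in>test_functions \<Omega>. \<forall>i\<in>Basis.
        integral\<^sup>L (lebesgue_on \<Omega>) (\<lambda>x. u x * frechet_derivative \<phi> (at x) i) =
        - integral\<^sup>L (lebesgue_on \<Omega>) (\<lambda>x. (G x \<bullet> i) * \<phi> x))"

definition W1 :: "real \<Rightarrow> 'a::euclidean_space set \<Rightarrow> ('a \<Rightarrow> real) set" where
  "W1 q \<Omega> = {u. u \<in> Lp_on q \<Omega> \<and> (\<exists>G. weak_gradient \<Omega> u G \<and> G \<in> Lp_on q \<Omega>)}"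

definition W1_loc :: "real \<Rightarrow> 'a::euclidean_space set \<Rightarrow> ('a \<Rightarrow> real) set" where
  "W1_loc q \<Omega> = {u. u \<in> Lp_loc q \<Omega> \<and> (\<exists>G. weak_gradient \<Omega> u G \<and> G \<in> Lp_loc q \<Omega>)}"

text \<open>Compact support in \<open>\<Omega>\<close> of a function defined up to null sets.\<close>

definition compact_support_in :: "'a::euclidean_space set \<Rightarrow> ('a \<Rightarrow> real) \<Rightarrow> bool" where
  "compact_support_in \<Omega> v \<longleftrightarrow>
     (\<exists>K. compact K \<and> K \<subseteq> \<Omega> \<and> (AE x in lebesgue_on \<Omega>. x \<notin> K \<longrightarrow> v x = 0))"

section \<open>Besov spaces\<close>

text \<open>For \<open>v\<close> in \<open>L\<^sup>m\<close> with \<open>m \<ge> 1\<close> the difference quotients below have integrable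
  \<open>m\<close>-th powers, so no spurious value \<open>0\<close> of a divergent integral enters the supremum.\<close>

definition Besov :: "real \<Rightarrow> real \<Rightarrow> ('a::euclidean_space \<Rightarrow> real) set" where
  "Besov \<beta> m = {v. v \<in> Lp_on m UNIV \<and>
     bdd_above ((\<lambda>h. (integral\<^sup>L lebesgue
        (\<lambda>x. \<bar>v (x + h) - v x\<bar> powr m / norm h powr (\<beta> * m))) powr (1 / m)) ` (UNIV - {0}))}"

definition Besov_loc ::
    "real \<Rightarrow> real \<Rightarrow> 'a::euclidean_space set \<Rightarrow> ('a \<Rightarrow> real) set" where
  "Besov_loc \<beta> m \<Omega> = {v. \<forall>\<phi>\<in>test_functions \<Omega>. (\<lambda>x. \<phi> x * v x) \<in> Besov \<beta> m}"

section \<open>The degenerate equation\<close>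

text \<open>Since \<open>0 powr a = 0\<close>, this field vanishes on the closed unit ball, including the origin.\<close>

definition H_field :: "real \<Rightarrow> 'a::euclidean_space \<Rightarrow> 'a" where
  "H_field a \<xi> = (max 0 (norm \<xi> - 1) powr a) *\<^sub>R (\<xi> /\<^sub>R norm \<xi>)"

text \<open>The equation is required for all representatives of the weak gradients of \<open>u\<close> and \<open>\<phi>\<close>;
  they agree almost everywhere, so the integrals do not depend on the choice.\<close>

definition local_weak_solution ::
    "'a::euclidean_space set \<Rightarrow> real \<Rightarrow> ('a \<Rightarrow> real) \<Rightarrow> ('a \<Rightarrow> real) \<Rightarrow> bool" where
  "local_weak_solution \<Omega> q f u \<longleftrightarrow> u \<in> W1_loc q \<Omega> \<and>
     (\<forall>Du \<phi> D\<phi>. weak_gradient \<Omega> u Du \<and>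
        \<phi> \<in> W1 q \<Omega> \<and> compact_support_in \<Omega> \<phi> \<and> weak_gradient \<Omega> \<phi> D\<phi> \<longrightarrow>
        integral\<^sup>L (lebesgue_on \<Omega>) (\<lambda>x. H_field (q - 1) (Du x) \<bullet> D\<phi> x) =
        integral\<^sup>L (lebesgue_on \<Omega>) (\<lambda>x. f x * \<phi> x))"

end

theory Submission
  imports Defs
begin

text \<open>The flux \<open>A = H_field (q - 1) Du\<close> vanishes where \<open>norm Du \<le> 1\<close>, so the equation carries no
  information about the gradient there, and regularity can be expected only for the truncated
  quantity \<open>V = H_field (q / 2) Du\<close>. It comes from two steps.

  The first is a difference quotient argument, \<open>energy_estimate\<close>. For a smooth cutoff \<open>\<eta>\<close> the function
  \<open>\<eta>\<^sup>2 (u (x + h) - u x)\<close> and its translate by \<open>h\<close> are both admissible in the weak formulation, and the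
  difference of the two resulting identities involves the flux only through \<open>A (x + h) - A x\<close>. Differences of \<open>A\<close>
  tested with differences of \<open>Du\<close> dominate the squared differences of \<open>V\<close> (\<open>H_field_monotone\<close>), and
  differences of \<open>A\<close> are in turn controlled by those of \<open>V\<close> (\<open>H_field_diff_le\<close>), so that the term with
  the derivative of the cutoff can be absorbed. What is left on the right is of second order in
  \<open>h\<close>, or is the product of a difference of \<open>u\<close>, which is of order \<open>norm h\<close> in the \<open>q\<close>-th mean by
  \<open>difference_quotient_bound\<close>, and a difference of \<open>f\<close>, which is of order \<open>norm h powr \<alpha>\<close> in the
  conjugate mean by the Besov hypothesis. Hence the integral of \<open>(norm (V (x + h) - V x))\<^sup>2\<close> over a compact
  set is of order \<open>norm h powr (1 + \<alpha>)\<close>: the function \<open>V\<close> has \<open>(1 + \<alpha>) / 2\<close> derivatives in the mean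
  square.

  The second step, \<open>difference_bound_embedding\<close>, turns \<open>\<beta>\<close> derivatives into integrability by a
  bootstrap that avoids interpolation theory. If \<open>g \<ge> 0\<close> has locally integrable \<open>r\<close>-th power, then by
  Chebyshev's inequality, for large \<open>\<tau>\<close>, \<open>g \<le> \<tau>\<close> on half of every ball whose radius is of order
  \<open>\<tau> powr (- r / n)\<close>. At a centre where \<open>g > 2 * \<tau>\<close> the differences of \<open>g\<close> therefore exceed \<open>\<tau>\<close> on half of
  the ball, and the bound on the differences limits the measure of the set of such centres to
  the order \<open>\<tau> powr (- (2 + 2 * \<beta> * r / n))\<close>. So \<open>r\<close> improves to every exponent below
  \<open>2 + 2 * \<beta> * r / n\<close>. Iterating from \<open>r = 2\<close> reaches every exponent below the fixed point
  \<open>2 * n / (n - 2 * \<beta>)\<close>, which for \<open>2 * \<beta> = 1 + \<alpha>\<close> is the bound claimed for \<open>V\<close>; the bound for \<open>Du\<close>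
  follows since \<open>norm Du \<le> 1 + norm V powr (2 / q)\<close>.

  Weak gradients are known only through smooth test functions. All facts about them that are
  used, namely uniqueness, the product rule with a cutoff, and the representation of
  \<open>u (x + h) - u x\<close> as an integral of the gradient along a segment, follow by moving the
  operation to the test function; the first and the last also use \<open>fundamental_lemma\<close>, which rests
  on explicit smooth cutoffs (\<open>exists_cutoff\<close>). The arguments translate functions and integrate over products, and
  so are carried out for Borel functions; \<open>Lp_loc_representative\<close> and \<open>weak_gradient_iff\<close> connect them with the
  Lebesgue measurable functions of the theorem.\<close>

section \<open>Smooth functions and cutoffs\<close>

declare Ck.simps(2) [simp del]

text \<open>The recursive definition asks of \<open>Ck (Suc k)\<close> only differentiability and regularity of the partial
  derivatives; that the classes decrease in \<open>k\<close> is what lets the undifferentiated factors in the rules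
  for products and inverses be handled by the induction hypothesis.\<close>

lemma Ck_demote: "Ck (Suc k) f \<Longrightarrow> Ck k f"
proof (induction k arbitrary: f)
  case 0
  then show ?case
    by (simp add: Ck.simps(2) continuous_on_eq_continuous_at differentiable_imp_continuous_within)
next
  case (Suc k)
  then show ?case unfolding Ck.simps(2)[of "Suc k"] Ck.simps(2)[of k f] by blast
qed

lemma Ck_SucI:
  assumes "\<And>x. (f has_derivative f' x) (at x)" "\<And>i. i \<in> Basis \<Longrightarrow> Ck k (\<lambda>x. f' x i)"
  shows "Ck (Suc k) f"
proof -
  have "frechet_derivative f (at x) = f' x" for x
    using assms(1) frechet_derivative_at by metis
  then show ?thesis using assms by (auto simp: Ck.simps(2) differentiable_def)
qed

lemma Ck_SucD:
  assumes "Ck (Suc k) f"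
  shows "(f has_derivative frechet_derivative f (at x)) (at x)"
    "i \<in> Basis \<Longrightarrow> Ck k (\<lambda>x. frechet_derivative f (at x) i)"
  using assms by (auto simp: Ck.simps(2) frechet_derivative_works[symmetric])

lemma Ck_const: "Ck k (\<lambda>x. c)"
proof (induction k arbitrary: c)
  case (Suc k)
  then show ?case by (auto intro!: Ck_SucI[where f'="\<lambda>_ _. 0"])
qed simp

lemma Ck_add: "Ck k f \<Longrightarrow> Ck k g \<Longrightarrow> Ck k (\<lambda>x. f x + g x)"
proof (induction k arbitrary: f g)
  case (Suc k)
  show ?case
    by (rule Ck_SucI[where f'="\<lambda>x i. frechet_derivative f (at x) i + frechet_derivative g (at x) i"])
       (use Suc.prems in \<open>auto intro: has_derivative_add Ck_SucD(1) Suc.IH[OF Ck_SucD(2) Ck_SucD(2)]\<close>)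
qed (auto intro: continuous_on_add)

lemma Ck_mult: "Ck k f \<Longrightarrow> Ck k g \<Longrightarrow> Ck k (\<lambda>x. f x * g x)"
proof (induction k arbitrary: f g)
  case (Suc k)
  show ?case
    by (rule Ck_SucI[where f'="\<lambda>x i. f x * frechet_derivative g (at x) i + frechet_derivative f (at x) i * g x"])
       (use Suc.prems in \<open>auto intro: has_derivative_mult Ck_SucD(1)
          Ck_add[OF Suc.IH[OF Ck_demote Ck_SucD(2)] Suc.IH[OF Ck_SucD(2) Ck_demote]]\<close>)
qed (auto intro: continuous_on_mult)

lemma Ck_diff: "Ck k f \<Longrightarrow> Ck k g \<Longrightarrow> Ck k (\<lambda>x. f x - g x)"
  using Ck_add[OF _ Ck_mult[OF Ck_const[of k "-1"]], of f g] by simp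

lemma Ck_inverse:
  assumes "\<And>x. f x \<noteq> 0"
  shows "Ck k f \<Longrightarrow> Ck k (\<lambda>x. inverse (f x))"
proof (induction k)
  case (Suc k)
  then have "Ck k (\<lambda>x. inverse (f x))" by (metis Ck_demote)
  then have "Ck k (\<lambda>x. - 1 * (inverse (f x) * frechet_derivative f (at x) i * inverse (f x)))"
    if "i \<in> Basis" for i
    using Suc.prems that by (intro Ck_mult Ck_const Ck_SucD(2))
  moreover have "((\<lambda>x. inverse (f x)) has_derivative
      (\<lambda>i. - (inverse (f x) * frechet_derivative f (at x) i * inverse (f x)))) (at x)" for x
    by (rule Deriv.has_derivative_inverse[OF assms Ck_SucD(1)[OF Suc.prems]])
  ultimately show ?case
    by (intro Ck_SucI[where f'="\<lambda>x i. - (inverse (f x) * frechet_derivative f (at x) i * inverse (f x))"]) auto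
qed (use assms in \<open>auto intro: continuous_on_inverse\<close>)

lemma Ck_sum: "finite A \<Longrightarrow> (\<And>i. i \<in> A \<Longrightarrow> Ck k (f i)) \<Longrightarrow> Ck k (\<lambda>x. \<Sum>i\<in>A. f i x)"
  by (induction A rule: finite_induct) (auto intro: Ck_const Ck_add)

lemma Ck_prod: "finite A \<Longrightarrow> (\<And>i. i \<in> A \<Longrightarrow> Ck k (f i)) \<Longrightarrow> Ck k (\<lambda>x. \<Prod>i\<in>A. f i x)"
  by (induction A rule: finite_induct) (auto intro: Ck_const Ck_mult)

lemma Ck_inner: "Ck k (\<lambda>x. (x - c) \<bullet> d)"
proof (cases k)
  case 0
  then show ?thesis by (auto intro!: continuous_intros)
next
  case (Suc j)
  show ?thesis unfolding Suc
    by (rule Ck_SucI[where f'="\<lambda>x i. i \<bullet> d"]) (auto intro!: derivative_eq_intros Ck_const)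
qed

lemma Ck_dist_sq: "Ck k (\<lambda>x. (dist c x)\<^sup>2)"
proof -
  have "(dist c x)\<^sup>2 = (\<Sum>b\<in>Basis. ((x - c) \<bullet> b) * ((x - c) \<bullet> b))" for x
    by (metis dist_commute dist_norm power2_norm_eq_inner euclidean_inner)
  then show ?thesis
    by (simp only:) (intro Ck_sum Ck_mult Ck_inner finite_Basis)
qed

lemma frechet_derivative_translate:
  fixes f :: "'a::euclidean_space \<Rightarrow> real"
  assumes "\<And>x. f differentiable (at x)"
  shows "((\<lambda>x. f (x + c)) has_derivative frechet_derivative f (at (x + c))) (at x)"
proof -
  have "(f has_derivative frechet_derivative f (at (x + c))) (at (x + c))"
    using assms by (simp add: frechet_derivative_works[symmetric])
  then show ?thesis
    using has_derivative_compose[of "\<lambda>x. x + c" "\<lambda>h. h" x UNIV f "frechet_derivative f (at (x + c))"]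
      has_derivative_add_const[OF has_derivative_ident, of c "at x"] by blast
qed

lemma Ck_translate: "Ck k f \<Longrightarrow> Ck k (\<lambda>x. f (x + c))"
proof (induction k arbitrary: f)
  case (Suc k)
  show ?case
    by (rule Ck_SucI[where f'="\<lambda>x. frechet_derivative f (at (x + c))"])
       (use Suc in \<open>auto intro!: frechet_derivative_translate simp: Ck.simps(2)\<close>)
next
  case 0
  then show ?case
    using continuous_on_compose2[of UNIV f UNIV "\<lambda>x. x + c"] by (simp add: continuous_on_add)
qed

text \<open>The classical flat function and its companions. Dividing by powers of \<open>t\<close> makes the family
  closed under differentiation, so that smoothness needs one induction over all \<open>m\<close> at once.\<close>

definition flat :: "nat \<Rightarrow> real \<Rightarrow> real" where
  "flat m t = (if t \<le> 0 then 0 else exp (- 1 / t) / t ^ m)"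

lemma flat_tendsto_0: "(flat m \<longlongrightarrow> 0) (at 0)"
proof -
  have "((\<lambda>t. inverse t ^ m / exp (inverse t)) \<longlongrightarrow> 0) (at_right (0::real))"
    using filterlim_compose[OF tendsto_power_div_exp_0 filterlim_inverse_at_top_right] .
  moreover have "\<forall>\<^sub>F t in at_right 0. inverse t ^ m / exp (inverse t) = flat m t"
    unfolding eventually_at_right_field
    by (auto simp: flat_def exp_minus field_simps intro!: exI[of _ 1])
  ultimately have "(flat m \<longlongrightarrow> 0) (at_right 0)" by (rule Lim_transform_eventually)
  moreover have "(flat m \<longlongrightarrow> 0) (at_left 0)"
  proof (rule Lim_transform_eventually)
    show "\<forall>\<^sub>F t in at_left 0. 0 = flat m t"
      unfolding eventually_at_left_field by (auto simp: flat_def intro!: exI[of _ "-1"])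
  qed auto
  ultimately show ?thesis by (simp add: filterlim_at_split)
qed

text \<open>At \<open>0\<close> the difference quotient of the \<open>m\<close>-th function is the value of the next one, so
  differentiability there reduces to the limit at \<open>0\<close> already known.\<close>

lemma DERIV_flat:
  "(flat m has_real_derivative (flat (m + 2) t - real m * flat (m + 1) t)) (at t)"
proof -
  consider "t < 0" | "t = 0" | "t > 0" by linarith
  then show ?thesis
  proof cases
    case 1
    have "((\<lambda>_. 0) has_real_derivative 0) (at t)" by simp
    then have "(flat m has_real_derivative 0) (at t)"
      by (rule has_field_derivative_transform_within_open[of _ _ _ "{..<0}"])
         (use 1 in \<open>auto simp: flat_def\<close>)
    then show ?thesis using 1 by (simp add: flat_def)
  next
    case 2
    have "\<forall>\<^sub>F h in at 0. flat (m + 1) h = (flat m (0 + h) - flat m 0) / h"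
      unfolding eventually_at by (auto simp: flat_def intro!: exI[of _ 1])
    then have "(flat m has_real_derivative 0) (at 0)"
      unfolding DERIV_def by (rule Lim_transform_eventually[OF flat_tendsto_0])
    then show ?thesis using 2 by (simp add: flat_def)
  next
    case 3
    have "((\<lambda>t. exp (- 1 / t) / t ^ m) has_real_derivative
       (exp (- 1 / t) * (1 / t^2) * t ^ m - exp (- 1 / t) * (real m * t ^ (m - 1))) / (t ^ m * t ^ m)) (at t)"
      using 3 by (auto intro!: derivative_eq_intros simp: power2_eq_square)
    moreover have "(exp (- 1 / t) * (1 / t^2) * t ^ m - exp (- 1 / t) * (real m * t ^ (m - 1))) / (t ^ m * t ^ m)
       = flat (m + 2) t - real m * flat (m + 1) t"
      using 3 by (cases m) (auto simp: flat_def field_simps power2_eq_square)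
    ultimately have "((\<lambda>t. exp (- 1 / t) / t ^ m) has_real_derivative
       flat (m + 2) t - real m * flat (m + 1) t) (at t)" by simp
    then show ?thesis
      by (rule has_field_derivative_transform_within_open[of _ _ _ "{0<..}"])
         (use 3 in \<open>auto simp: flat_def\<close>)
  qed
qed

lemma Ck_flat: "(\<And>j. Ck j P) \<Longrightarrow> Ck k (\<lambda>x. flat m (P x))"
proof (induction k arbitrary: m)
  case 0
  have "continuous_on UNIV (flat m)"
    by (intro continuous_at_imp_continuous_on ballI DERIV_isCont[OF DERIV_flat])
  then show ?case using 0[of 0] continuous_on_compose2[of UNIV "flat m" UNIV P] by auto
next
  case (Suc k)
  have "Ck k (\<lambda>x. (flat (m + 2) (P x) - real m * flat (m + 1) (P x)) * frechet_derivative P (at x) i)"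
    if "i \<in> Basis" for i
  proof -
    have "Ck k (\<lambda>x. flat j (P x))" for j by (rule Suc.IH) (rule Suc.prems)
    then show ?thesis
      by (intro Ck_mult[of k "\<lambda>x. flat (m + 2) (P x) - real m * flat (m + 1) (P x)"]
          Ck_diff[of k "\<lambda>x. flat (m + 2) (P x)"] Ck_mult[of k "\<lambda>x. real m"] Ck_const Ck_SucD(2)[OF Suc.prems that])
  qed
  moreover have "((\<lambda>x. flat m (P x)) has_derivative
      (\<lambda>i. (flat (m + 2) (P x) - real m * flat (m + 1) (P x)) * frechet_derivative P (at x) i)) (at x)" for x
    using has_derivative_compose[OF Ck_SucD(1)[OF Suc.prems] DERIV_flat[unfolded has_field_derivative_def]]
    by simp
  ultimately show ?case
    by (intro Ck_SucI[where f'="\<lambda>x i. (flat (m + 2) (P x) - real m * flat (m + 1) (P x)) * frechet_derivative P (at x) i"])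
qed

lemma flat_pos_iff: "flat 0 t > 0 \<longleftrightarrow> t > 0" and flat_nonneg: "flat 0 t \<ge> 0"
  and flat_eq_0_iff: "flat 0 t = 0 \<longleftrightarrow> t \<le> 0"
  by (auto simp: flat_def)

definition thicken :: "'a::euclidean_space set \<Rightarrow> real \<Rightarrow> 'a set" where
  "thicken K d = (\<Union>x\<in>K. cball x d)"

lemma thicken_iff: "y \<in> thicken K d \<longleftrightarrow> (\<exists>x\<in>K. dist x y \<le> d)"
  by (auto simp: thicken_def)

lemma compact_thicken: "compact K \<Longrightarrow> compact (thicken K d)"
  unfolding thicken_def by (rule compact_minkowski_sum_cball)

text \<open>Cover \<open>K\<close> by balls of half the radius \<open>\<epsilon>\<close> that fits into \<open>U\<close>. The smooth function \<open>\<rho>\<close> is positive exactly on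
  the union of the full balls, and \<open>\<kappa>\<close>, a product of functions vanishing exactly on the half balls,
  is zero on \<open>K\<close> and positive off the full balls. Hence \<open>\<rho> / (\<rho> + \<kappa>)\<close> is a cutoff.\<close>

lemma exists_cutoff:
  fixes K U :: "'a::euclidean_space set"
  assumes "compact K" "open U" "K \<subseteq> U"
  obtains \<eta> where "\<eta> \<in> test_functions U" "\<And>x. 0 \<le> \<eta> x" "\<And>x. \<eta> x \<le> 1" "\<And>x. x \<in> K \<Longrightarrow> \<eta> x = 1"
proof -
  obtain \<epsilon> where e: "\<epsilon> > 0" "(\<Union>x\<in>K. cball x \<epsilon>) \<subseteq> U"
    using compact_subset_open_imp_cball_epsilon_subset[OF assms] by blast
  obtain C where C: "C \<subseteq> K" "finite C" "K \<subseteq> (\<Union>c\<in>C. ball c (\<epsilon>/2))"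
    using compactE_image[OF assms(1), of K "\<lambda>c. ball c (\<epsilon>/2)"] e(1) by force
  define \<rho> where "\<rho> x = (\<Sum>c\<in>C. flat 0 (\<epsilon>\<^sup>2 + - 1 * (dist c x)\<^sup>2))" for x
  define \<kappa> where "\<kappa> x = (\<Prod>c\<in>C. flat 0 ((dist c x)\<^sup>2 + - ((\<epsilon>/2)\<^sup>2)))" for x
  have rho: "Ck k \<rho>" and chi: "Ck k \<kappa>" for k
    unfolding \<rho>_def \<kappa>_def using C
    by (intro Ck_sum Ck_prod Ck_flat Ck_add Ck_mult Ck_const Ck_dist_sq; simp)+
  have r0: "\<rho> x \<ge> 0" "\<kappa> x \<ge> 0" for x
    unfolding \<rho>_def \<kappa>_def by (auto intro!: sum_nonneg prod_nonneg flat_nonneg)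
  have sq: "(dist c x)\<^sup>2 < d\<^sup>2 \<longleftrightarrow> dist c x < d" if "d \<ge> 0" for c x :: 'a and d
    using that by (metis power2_less_imp_less power_strict_mono zero_le_dist zero_less_numeral)
  have rpos: "\<rho> x > 0 \<longleftrightarrow> (\<exists>c\<in>C. dist c x < \<epsilon>)" for x
  proof -
    have "\<rho> x = 0 \<longleftrightarrow> (\<forall>c\<in>C. flat 0 (\<epsilon>\<^sup>2 + - 1 * (dist c x)\<^sup>2) = 0)"
      unfolding \<rho>_def by (rule sum_nonneg_eq_0_iff) (auto simp: C flat_nonneg)
    then have "\<rho> x = 0 \<longleftrightarrow> (\<forall>c\<in>C. \<not> dist c x < \<epsilon>)"
      using e(1) sq[of \<epsilon>] by (auto simp: flat_eq_0_iff not_less)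
    then show ?thesis using r0(1)[of x] by (auto simp: less_le)
  qed
  have cpos: "\<kappa> x > 0" if "\<not> (\<exists>c\<in>C. dist c x < \<epsilon>)" for x
  proof -
    have "flat 0 ((dist c x)\<^sup>2 + - ((\<epsilon>/2)\<^sup>2)) > 0" if "c \<in> C" for c
    proof -
      have "(\<epsilon>/2)\<^sup>2 < (dist c x)\<^sup>2"
        using that \<open>\<not> _\<close> e(1) by (intro power_strict_mono) (auto simp: not_less intro: less_le_trans)
      then show ?thesis by (simp add: flat_pos_iff)
    qed
    then show ?thesis unfolding \<kappa>_def by (intro prod_pos) auto
  qed
  have pos: "\<rho> x + \<kappa> x > 0" for x
    using rpos[of x] cpos[of x] r0[of x] by (cases "\<exists>c\<in>C. dist c x < \<epsilon>") (auto intro: add_pos_nonneg add_nonneg_pos)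
  define \<eta> where "\<eta> x = \<rho> x * inverse (\<rho> x + \<kappa> x)" for x
  have ck: "Ck k \<eta>" for k
    unfolding \<eta>_def using pos by (intro Ck_mult rho chi Ck_inverse Ck_add) (metis less_irrefl)
  have "{x. \<eta> x \<noteq> 0} \<subseteq> (\<Union>c\<in>C. cball c \<epsilon>)"
    using rpos r0(1) by (fastforce simp: \<eta>_def order.order_iff_strict)
  moreover have cmp: "compact (\<Union>c\<in>C. cball c \<epsilon>)" using C by auto
  ultimately have cl: "closure {x. \<eta> x \<noteq> 0} \<subseteq> (\<Union>c\<in>C. cball c \<epsilon>)"
    by (simp add: closure_minimal compact_imp_closed)
  have "compact (closure {x. \<eta> x \<noteq> 0})"
    using bounded_subset[OF compact_imp_bounded[OF cmp]] cl closure_subset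
    by (metis bounded_subset compact_closure)
  moreover have "(\<Union>c\<in>C. cball c \<epsilon>) \<subseteq> U" using C(1) e(2) by auto
  ultimately have "\<eta> \<in> test_functions U"
    using ck cl by (auto simp: test_functions_def)
  moreover have "0 \<le> \<eta> x" "\<eta> x \<le> 1" for x
    using r0[of x] pos[of x] by (auto simp: \<eta>_def field_simps)
  moreover have "\<eta> x = 1" if "x \<in> K" for x
  proof -
    obtain c where c: "c \<in> C" "dist c x < \<epsilon>/2" using C(3) \<open>x \<in> K\<close> by auto
    then have "(dist c x)\<^sup>2 \<le> (\<epsilon>/2)\<^sup>2" by (intro power_mono) auto
    then have "flat 0 ((dist c x)\<^sup>2 + - ((\<epsilon>/2)\<^sup>2)) = 0" by (simp add: flat_eq_0_iff)
    then have "\<kappa> x = 0" unfolding \<kappa>_def using c C by (intro prod_zero) auto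
    then show ?thesis using pos[of x] by (simp add: \<eta>_def)
  qed
  ultimately show thesis using that by blast
qed

section \<open>Algebra of the degenerate field\<close>

lemma powr_add_1: "(b::real) \<ge> 0 \<Longrightarrow> k \<ge> 0 \<Longrightarrow> b powr (k + 1) = b powr k * b"
  by (cases "b = 0") (auto simp: powr_add)

text \<open>The tangent line inequality for the convex power, read off from Young's inequality for
  \<open>a powr (m - 1) * b\<close>.\<close>

lemma powr_diff_le:
  fixes a b m :: real
  assumes "m \<ge> 1" "b \<ge> 0" "b \<le> a"
  shows "a powr m - b powr m \<le> m * (a powr (m - 1) * (a - b))"
proof (cases "m = 1")
  case False
  with assms have m: "m > 1" by simp
  have "a powr (m - 1) * b \<le> (a powr (m - 1)) powr (m / (m - 1)) / (m / (m - 1)) + b powr m / m"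
    using assms m by (intro Youngs_inequality) (auto simp: field_simps)
  also have "(a powr (m - 1)) powr (m / (m - 1)) = a powr m"
    using m by (simp add: powr_powr)
  finally have "m * (a powr (m - 1) * b) \<le> (m - 1) * a powr m + b powr m"
    using m by (simp add: field_simps)
  moreover have "a powr m = a powr (m - 1) * a"
    using powr_add_1[of a "m - 1"] assms by simp
  ultimately show ?thesis by (simp add: algebra_simps)
qed (use assms in auto)

text \<open>Bounding the left side by the tangent at the larger point \<open>a\<close> produces
  \<open>a powr (q - 2) * (a - b)\<^sup>2\<close>, which is at most the right side because \<open>b powr (q - 2) \<le> a powr (q - 2)\<close>.\<close>

lemma scalar_monotone_ordered:
  fixes a b q :: real
  assumes q: "q \<ge> 2" and b: "b \<ge> 0" "b \<le> a"
  shows "(4 / q\<^sup>2) * (a powr (q/2) - b powr (q/2))\<^sup>2 \<le> (a powr (q - 1) - b powr (q - 1)) * (a - b)"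
proof -
  have a: "a \<ge> 0" using b by simp
  have "a powr (q/2) - b powr (q/2) \<le> q/2 * (a powr (q/2 - 1) * (a - b))"
    using assms by (intro powr_diff_le) auto
  moreover have "0 \<le> a powr (q/2) - b powr (q/2)"
    using assms by (auto intro: powr_mono2)
  ultimately have "(a powr (q/2) - b powr (q/2))\<^sup>2 \<le> (q/2 * (a powr (q/2 - 1) * (a - b)))\<^sup>2"
    by (intro power_mono)
  also have "\<dots> = q\<^sup>2/4 * ((a powr (q/2 - 1))\<^sup>2 * (a - b)\<^sup>2)"
    by (simp add: power_mult_distrib power_divide)
  also have "(a powr (q/2 - 1))\<^sup>2 = a powr (q - 2)"
    by (simp add: power2_eq_square powr_add[symmetric])
  finally have "(4 / q\<^sup>2) * (a powr (q/2) - b powr (q/2))\<^sup>2 \<le> a powr (q - 2) * (a - b)\<^sup>2"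
    using q by (simp add: field_simps)
  also have "\<dots> = (a powr (q - 2) * a - a powr (q - 2) * b) * (a - b)"
    by (simp add: power2_eq_square algebra_simps)
  also have "\<dots> \<le> (a powr (q - 1) - b powr (q - 1)) * (a - b)"
  proof (intro mult_right_mono)
    have "b powr (q - 2) * b \<le> a powr (q - 2) * b"
      using assms by (intro mult_right_mono powr_mono2) auto
    then show "a powr (q - 2) * a - a powr (q - 2) * b \<le> a powr (q - 1) - b powr (q - 1)"
      using powr_add_1[of a "q - 2"] powr_add_1[of b "q - 2"] a b q by simp
  qed (use b in simp)
  finally show ?thesis .
qed

lemma scalar_monotone:
  fixes a b q :: real
  assumes "q \<ge> 2" "a \<ge> 0" "b \<ge> 0"
  shows "(4 / q\<^sup>2) * (a powr (q/2) - b powr (q/2))\<^sup>2 \<le> (a powr (q - 1) - b powr (q - 1)) * (a - b)"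
proof (cases "b \<le> a")
  case False
  then have "(4 / q\<^sup>2) * (b powr (q/2) - a powr (q/2))\<^sup>2 \<le> (b powr (q - 1) - a powr (q - 1)) * (b - a)"
    using assms by (intro scalar_monotone_ordered) auto
  then show ?thesis by (simp add: power2_commute algebra_simps)
qed (use assms scalar_monotone_ordered in auto)

text \<open>The inequality between vectors of lengths \<open>a\<close> and \<open>b\<close> whose directions have inner product \<open>t\<close>. Both
  sides are affine in \<open>t\<close>, and the slope comparison is the arithmetic-geometric mean inequality, so the
  worst case is \<open>t = 1\<close>, that is, parallel vectors, where it is the scalar inequality.\<close>

lemma radial_monotone:
  fixes a b q t :: real
  assumes q: "q \<ge> 2" and ab: "a \<ge> 0" "b \<ge> 0" and t: "t \<le> 1"
  shows "(4 / q\<^sup>2) * ((a powr (q/2))\<^sup>2 + (b powr (q/2))\<^sup>2 - 2 * t * (a powr (q/2) * b powr (q/2)))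
     \<le> a powr (q - 1) * a + b powr (q - 1) * b - t * (a powr (q - 1) * b + b powr (q - 1) * a)"
    (is "?c * (?A\<^sup>2 + ?B\<^sup>2 - _) \<le> ?a * a + ?b * b - _")
proof -
  have c: "0 < ?c" "?c \<le> 1" using q power_mono[of 2 q 2] by (auto simp: field_simps)
  have "2 * (?A * ?B) \<le> ?a * b + ?b * a"
  proof -
    have "(s powr (q/2))\<^sup>2 = s powr (q - 1) * s" if "s \<ge> 0" for s :: real
      using powr_add_1[OF that, of "q - 1"] q by (simp add: power2_eq_square powr_add[symmetric])
    then have "(?A * ?B)\<^sup>2 = (?a * b) * (?b * a)"
      unfolding power_mult_distrib using ab by (simp only: mult_ac)
    then have "(2 * (?A * ?B))\<^sup>2 = 4 * ((?a * b) * (?b * a))"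
      unfolding power_mult_distrib[of 2] by simp
    also have "\<dots> \<le> (?a * b + ?b * a)\<^sup>2"
      using zero_le_power2[of "?a * b - ?b * a"] unfolding power2_diff power2_sum by linarith
    finally show ?thesis by (rule power2_le_imp_le) (use ab in simp)
  qed
  moreover have "?c * (2 * (?A * ?B)) \<le> 1 * (2 * (?A * ?B))"
    using c ab by (intro mult_right_mono) auto
  ultimately have k: "0 \<le> ?a * b + ?b * a - ?c * (2 * (?A * ?B))" by linarith
  have "0 \<le> (1 - t) * (?a * b + ?b * a - ?c * (2 * (?A * ?B)))"
    using k t by (intro mult_nonneg_nonneg) auto
  moreover have "?c * (?A - ?B)\<^sup>2 \<le> (?a - ?b) * (a - b)"
    by (rule scalar_monotone[OF q ab])
  moreover have "y * (A\<^sup>2 + B\<^sup>2 - 2 * t * (A * B)) \<le> a' * a + b' * b - t * (a' * b + b' * a)"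
    if "0 \<le> (1 - t) * (a' * b + b' * a - y * (2 * (A * B)))" "y * (A - B)\<^sup>2 \<le> (a' - b') * (a - b)"
    for y A B a' b' :: real
    using that by (simp add: power2_eq_square algebra_simps)
  ultimately show ?thesis by blast
qed

text \<open>The distance of \<open>\<xi>\<close> from the unit ball.\<close>

definition excess :: "'a::euclidean_space \<Rightarrow> real" where "excess \<xi> = max 0 (norm \<xi> - 1)"

lemma excess_nonneg[simp]: "excess \<xi> \<ge> 0" by (simp add: excess_def)

lemma norm_H_field: "norm (H_field a \<xi>) = excess \<xi> powr a"
  by (cases "\<xi> = 0") (auto simp: H_field_def excess_def)

text \<open>Outside the unit ball \<open>\<xi> = (excess \<xi> + 1) e\<close> for a unit vector \<open>e\<close>. Replacing the lengths by the excesses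
  turns the claim into \<open>radial_monotone\<close>, and the error made by the two ones is
  nonnegative because \<open>e \<bullet> d \<le> 1\<close> for unit vectors. If one of the two points lies in the unit ball,
  its field vanishes and Cauchy-Schwarz suffices.\<close>

lemma H_field_monotone:
  fixes \<xi> \<zeta> :: "'a::euclidean_space"
  assumes q: "q \<ge> 2"
  shows "(4 / q\<^sup>2) * (norm (H_field (q/2) \<xi> - H_field (q/2) \<zeta>))\<^sup>2
     \<le> (H_field (q - 1) \<xi> - H_field (q - 1) \<zeta>) \<bullet> (\<xi> - \<zeta>)"
proof -
  have c: "0 < 4 / q\<^sup>2" "4 / q\<^sup>2 \<le> 1" using q power_mono[of 2 q 2] by (auto simp: field_simps)
  have sq: "(excess \<xi> powr (q/2))\<^sup>2 = excess \<xi> powr (q - 1) * excess \<xi>" for \<xi> :: 'a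
    using powr_add_1[of "excess \<xi>" "q - 1"] q by (simp add: power2_eq_square powr_add[symmetric])
  have 1: "(4 / q\<^sup>2) * (norm (H_field (q/2) \<xi> - H_field (q/2) \<zeta>))\<^sup>2
     \<le> (H_field (q - 1) \<xi> - H_field (q - 1) \<zeta>) \<bullet> (\<xi> - \<zeta>)"
    if z: "excess \<zeta> = 0" for \<xi> \<zeta> :: 'a
  proof -
    have H0: "H_field a \<zeta> = 0" for a using z norm_H_field[of a \<zeta>] by simp
    have nz: "norm \<zeta> \<le> 1" using z by (auto simp: excess_def split: if_splits)
    have "(4 / q\<^sup>2) * (norm (H_field (q/2) \<xi>))\<^sup>2 \<le> 1 * (norm (H_field (q/2) \<xi>))\<^sup>2"
      using c by (intro mult_right_mono) auto
    also have "\<dots> = excess \<xi> powr (q - 1) * excess \<xi>" using sq by (simp add: norm_H_field)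
    also have "\<dots> \<le> H_field (q - 1) \<xi> \<bullet> (\<xi> - \<zeta>)"
    proof (cases "excess \<xi> = 0")
      case True
      then show ?thesis using norm_H_field[of "q - 1" \<xi>] by simp
    next
      case False
      then have n: "norm \<xi> > 1" "excess \<xi> = norm \<xi> - 1" by (auto simp: excess_def split: if_splits)
      have "(\<xi> /\<^sub>R norm \<xi>) \<bullet> \<zeta> \<le> norm (\<xi> /\<^sub>R norm \<xi>) * norm \<zeta>" by (rule norm_cauchy_schwarz)
      also have "norm (\<xi> /\<^sub>R norm \<xi>) = 1" using n(1) by (subst norm_scaleR) (simp add: field_simps, force)
      also have "1 * norm \<zeta> \<le> 1" using nz by simp
      finally have "(\<xi> /\<^sub>R norm \<xi>) \<bullet> \<zeta> \<le> 1" .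
      then have "excess \<xi> \<le> (\<xi> /\<^sub>R norm \<xi>) \<bullet> (\<xi> - \<zeta>)"
      proof -
        have "inverse (norm \<xi>) * (norm \<xi>)\<^sup>2 = norm \<xi>"
          using n(1) by (subst power2_eq_square, subst mult.assoc[symmetric], subst left_inverse) auto
        then show ?thesis
          using \<open>(\<xi> /\<^sub>R norm \<xi>) \<bullet> \<zeta> \<le> 1\<close> n(2) by (simp add: inner_diff_right power2_norm_eq_inner)
      qed
      then have "excess \<xi> powr (q - 1) * excess \<xi> \<le> excess \<xi> powr (q - 1) * ((\<xi> /\<^sub>R norm \<xi>) \<bullet> (\<xi> - \<zeta>))"
        by (intro mult_left_mono) auto
      then show ?thesis by (simp add: H_field_def excess_def)
    qed
    finally show ?thesis by (simp add: H0)
  qed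
  consider "excess \<zeta> = 0" | "excess \<xi> = 0" | "excess \<xi> > 0" "excess \<zeta> > 0"
    using excess_nonneg[of \<xi>] excess_nonneg[of \<zeta>] by linarith
  then show ?thesis
  proof cases
    case 2
    have "(4 / q\<^sup>2) * (norm (H_field (q/2) \<zeta> - H_field (q/2) \<xi>))\<^sup>2
       \<le> (H_field (q - 1) \<zeta> - H_field (q - 1) \<xi>) \<bullet> (\<zeta> - \<xi>)" by (rule 1[OF 2])
    then show ?thesis by (simp add: norm_minus_commute inner_diff_left inner_diff_right)
  next
    case 3
    define a where "a = excess \<xi>"
    define b where "b = excess \<zeta>"
    define e where "e = \<xi> /\<^sub>R norm \<xi>"
    define d where "d = \<zeta> /\<^sub>R norm \<zeta>"
    define t where "t = e \<bullet> d"
    have ab: "a > 0" "b > 0" using 3 by (auto simp: a_def b_def)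
    have n: "norm \<xi> = a + 1" "norm \<zeta> = b + 1" using ab by (auto simp: a_def b_def excess_def)
    have e: "norm e = 1" "norm d = 1" using n ab by (auto simp: e_def d_def)
    have x: "\<xi> = (a + 1) *\<^sub>R e" "\<zeta> = (b + 1) *\<^sub>R d" using n ab by (auto simp: e_def d_def)
    have H: "H_field k \<xi> = a powr k *\<^sub>R e" "H_field k \<zeta> = b powr k *\<^sub>R d" for k
      by (auto simp: H_field_def a_def b_def e_def d_def excess_def)
    have ee: "e \<bullet> e = 1" "d \<bullet> d = 1" "d \<bullet> e = t"
      using e by (auto simp: power2_norm_eq_inner[symmetric] t_def inner_commute dot_square_norm)
    have t1: "t \<le> 1" using norm_cauchy_schwarz[of e d] e by (simp add: t_def)
    have "(norm (H_field (q/2) \<xi> - H_field (q/2) \<zeta>))\<^sup>2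
       = (a powr (q/2))\<^sup>2 + (b powr (q/2))\<^sup>2 - 2 * t * (a powr (q/2) * b powr (q/2))"
      unfolding H power2_norm_eq_inner
      by (simp add: inner_diff_left inner_diff_right ee t_def[symmetric] power2_eq_square algebra_simps)
    then have "(4 / q\<^sup>2) * (norm (H_field (q/2) \<xi> - H_field (q/2) \<zeta>))\<^sup>2
       \<le> a powr (q - 1) * a + b powr (q - 1) * b - t * (a powr (q - 1) * b + b powr (q - 1) * a)"
      using radial_monotone[OF q _ _ t1, of a b] ab by simp
    also have "\<dots> \<le> \<dots> + (a powr (q - 1) + b powr (q - 1)) * (1 - t)"
      using t1 by simp
    also have "\<dots> = (H_field (q - 1) \<xi> - H_field (q - 1) \<zeta>) \<bullet> ((a + 1) *\<^sub>R e - (b + 1) *\<^sub>R d)"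
      unfolding H by (simp add: inner_diff_left inner_diff_right ee t_def[symmetric] algebra_simps)
    finally show ?thesis unfolding x[symmetric] .
  qed (rule 1)
qed

text \<open>The flux is \<open>excess \<xi> powr (q/2 - 1)\<close> times \<open>H_field (q/2) \<xi>\<close>. In the discrete product rule with the larger
  factor in front, the remaining term \<open>(a powr k - b powr k) * b powr (k + 1)\<close> is at most \<open>b powr k\<close> times the
  difference of the lengths of the two vectors.\<close>

lemma H_field_diff_le:
  fixes \<xi> \<zeta> :: "'a::euclidean_space"
  assumes q: "q \<ge> 2"
  shows "norm (H_field (q - 1) \<xi> - H_field (q - 1) \<zeta>)
     \<le> (excess \<xi> powr (q/2 - 1) + excess \<zeta> powr (q/2 - 1)) * norm (H_field (q/2) \<xi> - H_field (q/2) \<zeta>)"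
proof -
  have split: "H_field (q - 1) \<xi> = excess \<xi> powr (q/2 - 1) *\<^sub>R H_field (q/2) \<xi>" for \<xi> :: 'a
    by (simp add: H_field_def excess_def powr_add[symmetric])
  have 1: "norm (H_field (q - 1) \<xi> - H_field (q - 1) \<zeta>)
     \<le> (excess \<xi> powr (q/2 - 1) + excess \<zeta> powr (q/2 - 1)) * norm (H_field (q/2) \<xi> - H_field (q/2) \<zeta>)"
    if le: "excess \<zeta> \<le> excess \<xi>" for \<xi> \<zeta> :: 'a
  proof -
    define a where "a = excess \<xi>"
    define b where "b = excess \<zeta>"
    define k where "k = q/2 - 1"
    have ab: "0 \<le> b" "b \<le> a" "k \<ge> 0" using le q by (auto simp: a_def b_def k_def)
    have "H_field (q - 1) \<xi> - H_field (q - 1) \<zeta> = a powr k *\<^sub>R (H_field (q/2) \<xi> - H_field (q/2) \<zeta>)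
        + (a powr k - b powr k) *\<^sub>R H_field (q/2) \<zeta>"
      unfolding split a_def b_def k_def by (simp add: algebra_simps)
    also have "norm \<dots> \<le> a powr k * norm (H_field (q/2) \<xi> - H_field (q/2) \<zeta>)
        + norm ((a powr k - b powr k) *\<^sub>R H_field (q/2) \<zeta>)"
      by (rule order.trans[OF norm_triangle_ineq]) simp
    also have "norm ((a powr k - b powr k) *\<^sub>R H_field (q/2) \<zeta>) = (a powr k - b powr k) * (b powr k * b)"
      using ab powr_mono2[of k b a] powr_add_1[of b k] by (simp add: norm_H_field b_def k_def)
    also have "\<dots> \<le> b powr k * (a powr k * a - b powr k * b)"
      using mult_left_mono[OF ab(2), of "b powr k * a powr k"] by (simp add: algebra_simps)
    also have "\<dots> = b powr k * (norm (H_field (q/2) \<xi>) - norm (H_field (q/2) \<zeta>))"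
      using ab powr_add_1[of a k] powr_add_1[of b k] by (simp add: norm_H_field a_def b_def k_def)
    also have "\<dots> \<le> b powr k * norm (H_field (q/2) \<xi> - H_field (q/2) \<zeta>)"
      by (intro mult_left_mono norm_triangle_ineq2) simp
    finally show ?thesis by (simp add: a_def b_def k_def algebra_simps)
  qed
  show ?thesis
  proof (cases "excess \<zeta> \<le> excess \<xi>")
    case False
    then show ?thesis using 1[of \<xi> \<zeta>] by (simp add: norm_minus_commute add.commute)
  qed (rule 1)
qed

section \<open>Embedding of functions with small differences\<close>

lemma ennreal_finite_ex: "x < \<infinity> \<Longrightarrow> \<exists>m\<ge>0. x = ennreal m"
  by (cases x) auto

lemma nn_integral_translate:
  fixes f :: "'a::euclidean_space \<Rightarrow> ennreal"
  assumes [measurable]: "f \<in> borel_measurable borel"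
  shows "(\<integral>\<^sup>+h. f (x + h) \<partial>lborel) = (\<integral>\<^sup>+y. f y \<partial>lborel)"
proof -
  have "(\<integral>\<^sup>+y. f y \<partial>lborel) = (\<integral>\<^sup>+y. f y \<partial>distr lborel borel ((+) x))"
    by (simp only: lborel_distr_plus)
  also have "\<dots> = (\<integral>\<^sup>+h. f (x + h) \<partial>lborel)"
    by (subst nn_integral_distr) simp_all
  finally show ?thesis by simp
qed

text \<open>Dyadic layer cake: between the levels \<open>2 * \<tau>\<close> and \<open>4 * \<tau>\<close> the power is at most \<open>(4 * \<tau>) powr s\<close>, and along
  \<open>\<tau> = \<tau>0 * 2 ^ k\<close> the measures decay faster by the factor \<open>2 powr (s - \<rho>) < 1\<close>.\<close>

lemma weak_type_imp_integrable:
  fixes g :: "'a::euclidean_space \<Rightarrow> real"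
  assumes [measurable]: "g \<in> borel_measurable borel" and g0: "\<And>x. g x \<ge> 0"
    and K: "compact K" and l0: "\<tau>0 > 0" and s: "0 \<le> s" "s < \<rho>" and C: "C \<ge> 0"
    and w: "\<And>\<tau>. \<tau> \<ge> \<tau>0 \<Longrightarrow> emeasure lborel {x\<in>K. g x > 2 * \<tau>} \<le> ennreal (C * \<tau> powr (- \<rho>))"
  shows "(\<integral>\<^sup>+x. ennreal (g x powr s) * indicator K x \<partial>lborel) < \<infinity>"
proof -
  have [measurable]: "K \<in> sets borel" using K by (simp add: borel_compact)
  define l where "l k = \<tau>0 * 2 ^ k" for k :: nat
  have l: "l k \<ge> \<tau>0" "l k > 0" for k
    using l0 by (auto simp: l_def)
  \<comment> \<open>The index picked for a point is the last level that it exceeds.\<close>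
  have pt: "ennreal (g x powr s) * indicator K x
      \<le> ennreal ((2 * \<tau>0) powr s) * indicator K x
        + (\<Sum>k. ennreal ((4 * l k) powr s) * indicator {x\<in>K. g x > 2 * l k} x)" for x
  proof (cases "x \<in> K \<and> g x > 2 * \<tau>0")
    case False
    then show ?thesis
      using powr_mono2[OF s(1) g0, of x "2 * \<tau>0"]
      by (cases "x \<in> K") (auto simp: intro!: add_increasing2 ennreal_leI)
  next
    case True
    have "\<exists>k. g x \<le> 2 * l k"
    proof -
      obtain k where "g x / (2 * \<tau>0) < 2 ^ k" using real_arch_pow[of 2 "g x / (2 * \<tau>0)"] by auto
      then show ?thesis using l0 by (intro exI[of _ k]) (auto simp: l_def field_simps)
    qed
    define k where "k = (LEAST k. g x \<le> 2 * l k)"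
    have k: "g x \<le> 2 * l k" unfolding k_def by (rule LeastI_ex) fact
    have "k \<noteq> 0"
    proof
      assume "k = 0"
      then show False using k True by (simp add: l_def)
    qed
    then obtain j where j: "k = Suc j" by (cases k) auto
    have "\<not> g x \<le> 2 * l j" using not_less_Least[of j "\<lambda>k. g x \<le> 2 * l k"] j by (simp add: k_def)
    have F: "F j \<le> (\<Sum>k. F k)" for F :: "nat \<Rightarrow> ennreal"
      using sum_le_suminf[of F "{j}"] by simp
    have "ennreal (g x powr s) * indicator K x \<le> ennreal ((4 * l j) powr s) * indicator {x\<in>K. g x > 2 * l j} x"
      using True k g0 s \<open>\<not> g x \<le> 2 * l j\<close> by (auto simp: j l_def intro!: ennreal_leI powr_mono2)
    also have "\<dots> \<le> (\<Sum>k. ennreal ((4 * l k) powr s) * indicator {x\<in>K. g x > 2 * l k} x)"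
      by (rule F)
    finally show ?thesis by (rule add_increasing[rotated]) simp
  qed
  have geo: "(\<Sum>k. ennreal ((4 * l k) powr s) * ennreal (C * l k powr (- \<rho>))) < \<infinity>"
  proof -
    define c where "c = C * 4 powr s * \<tau>0 powr (s - \<rho>)"
    have c0: "c \<ge> 0" using C by (simp add: c_def)
    have "(4 * l k) powr s * (C * l k powr (- \<rho>)) = c * (2 powr (s - \<rho>)) ^ k" for k
    proof -
      have "(4 * l k) powr s * (C * l k powr (- \<rho>)) = C * 4 powr s * (l k powr s * l k powr (- \<rho>))"
        by (simp add: powr_mult)
      also have "l k powr s * l k powr (- \<rho>) = l k powr (s - \<rho>)" by (simp add: powr_add[symmetric])
      also have "\<dots> = \<tau>0 powr (s - \<rho>) * (2 powr (s - \<rho>)) ^ k"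
        by (simp add: l_def powr_mult powr_realpow[symmetric] powr_powr mult.commute)
      finally show ?thesis by (simp add: c_def)
    qed
    moreover have "summable (\<lambda>k. c * (2 powr (s - \<rho>)) ^ k)"
      using s by (intro summable_mult summable_geometric) (simp add: powr_less_one)
    ultimately show ?thesis
      using C c0 by (subst ennreal_mult[symmetric]) (auto simp: suminf_ennreal2 less_top)
  qed
  have "(\<integral>\<^sup>+x. ennreal (g x powr s) * indicator K x \<partial>lborel)
      \<le> (\<integral>\<^sup>+x. ennreal ((2 * \<tau>0) powr s) * indicator K x
        + (\<Sum>k. ennreal ((4 * l k) powr s) * indicator {x\<in>K. g x > 2 * l k} x) \<partial>lborel)"
    by (intro nn_integral_mono pt)
  also have "\<dots> = ennreal ((2 * \<tau>0) powr s) * emeasure lborel K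
      + (\<Sum>k. ennreal ((4 * l k) powr s) * emeasure lborel {x\<in>K. g x > 2 * l k})"
    by (subst nn_integral_add) (auto simp: nn_integral_suminf nn_integral_cmult)
  also have "\<dots> \<le> ennreal ((2 * \<tau>0) powr s) * emeasure lborel K
      + (\<Sum>k. ennreal ((4 * l k) powr s) * ennreal (C * l k powr (- \<rho>)))"
    by (intro add_left_mono suminf_le mult_left_mono w l) auto
  also have "\<dots> < \<infinity>"
    using geo emeasure_compact_finite[OF K] by (simp add: ennreal_mult_less_top less_top)
  finally show ?thesis .
qed

text \<open>One step of the bootstrap. The radius \<open>t \<tau>\<close> is chosen so that the ball has volume
  \<open>2 * (m + 1) * \<tau> powr (- r)\<close>, where \<open>m\<close> is the integral of \<open>g powr r\<close>; Chebyshev's inequality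
  then leaves at least half of the ball for the points with \<open>g \<le> \<tau>\<close>.\<close>

lemma weak_type_step:
  fixes g :: "'a::euclidean_space \<Rightarrow> real"
  assumes [measurable]: "g \<in> borel_measurable borel" and g0: "\<And>x. g x \<ge> 0"
    and K: "compact K" and e: "\<epsilon> > 0" and b: "\<beta> > 0" and r: "r > 0"
    and C: "C \<ge> 0"
    and D: "\<And>h. norm h < \<epsilon> \<Longrightarrow> (\<integral>\<^sup>+x. ennreal ((g (x + h) - g x)\<^sup>2) * indicator K x \<partial>lborel)
              \<le> ennreal (C * norm h powr (2 * \<beta>))"
    and M: "(\<integral>\<^sup>+x. ennreal (g x powr r) * indicator (thicken K \<epsilon>) x \<partial>lborel) < \<infinity>"
  obtains C' \<tau>0 where "C' \<ge> 0" "\<tau>0 > 0"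
    "\<And>\<tau>. \<tau> \<ge> \<tau>0 \<Longrightarrow> emeasure lborel {x\<in>K. g x > 2 * \<tau>}
        \<le> ennreal (C' * \<tau> powr (- (2 + 2 * \<beta> * r / real DIM('a))))"
proof -
  have [measurable]: "K \<in> sets borel" "thicken K \<epsilon> \<in> sets borel"
    using K compact_thicken[OF K] by (auto intro: borel_compact)
  define n where "n = real DIM('a)"
  have n: "n > 0" by (simp add: n_def)
  obtain m where m: "m \<ge> 0" "(\<integral>\<^sup>+x. ennreal (g x powr r) * indicator (thicken K \<epsilon>) x \<partial>lborel) = ennreal m"
    using ennreal_finite_ex[OF M] by blast
  define w where "w = unit_ball_vol n"
  have w: "w > 0" using n by (simp add: w_def)
  define c where "c = (2 * (m + 1) / w) powr (1 / n)"
  have c: "c > 0" using w m by (simp add: c_def)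
  define t where "t \<tau> = c * \<tau> powr (- r / n)" for \<tau>
  have "\<forall>\<^sub>F \<tau> in at_top. t \<tau> < \<epsilon>"
  proof -
    have "((\<lambda>\<tau>. c * \<tau> powr (- r / n)) \<longlongrightarrow> c * 0) at_top"
      using r n by (intro tendsto_mult tendsto_const tendsto_neg_powr filterlim_ident) auto
    then show ?thesis unfolding t_def using e by (auto dest: order_tendstoD(2))
  qed
  then obtain l1 where l1: "\<And>\<tau>. \<tau> \<ge> l1 \<Longrightarrow> t \<tau> < \<epsilon>"
    by (auto simp: eventually_at_top_linorder)
  define C' where "C' = 2 * C * c powr (2 * \<beta>)"
  show thesis
  proof (rule that[of C' "max l1 1"])
    fix \<tau> assume la: "\<tau> \<ge> max l1 1"
    then have l0: "\<tau> > 0" and te: "t \<tau> < \<epsilon>" using l1 by auto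
    have t0: "t \<tau> > 0" using c l0 by (simp add: t_def)
    define E where "E = {x\<in>K. g x > 2 * \<tau>}"
    define B where "B = ball (0::'a) (t \<tau>)"
    have [measurable]: "E \<in> sets borel" "B \<in> sets borel" by (auto simp: E_def B_def)
    define b where "b = w * t \<tau> ^ DIM('a)"
    have b: "b > 0" using w t0 by (simp add: b_def)
    have eB: "emeasure lborel B = ennreal b"
      using t0 by (simp add: B_def b_def w_def n_def emeasure_ball)
    have bl: "b = 2 * (m + 1) * \<tau> powr (- r)"
    proof -
      have "t \<tau> ^ DIM('a) = t \<tau> powr n" using t0 by (simp add: n_def powr_realpow)
      also have "\<dots> = 2 * (m + 1) / w * \<tau> powr (- r)"
        using n m w by (simp add: t_def c_def powr_mult powr_powr)
      finally show ?thesis using w by (simp add: b_def)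
    qed
    \<comment> \<open>Over the good half of the ball the integrand is at least \<open>\<tau>\<^sup>2\<close>.\<close>
    have half: "ennreal (\<tau>\<^sup>2 * (b / 2)) \<le> (\<integral>\<^sup>+h. ennreal ((g (x + h) - g x)\<^sup>2) * indicator B h \<partial>lborel)"
      if x: "x \<in> E" for x
    proof -
      define bad where "bad = {h\<in>B. g (x + h) > \<tau>}"
      have [measurable]: "bad \<in> sets borel" by (auto simp: bad_def)
      have "ennreal (\<tau> powr r) * emeasure lborel bad = (\<integral>\<^sup>+h. ennreal (\<tau> powr r) * indicator bad h \<partial>lborel)"
        by (simp add: nn_integral_cmult)
      also have "\<dots> \<le> (\<integral>\<^sup>+h. ennreal (g (x + h) powr r) * indicator (thicken K \<epsilon>) (x + h) \<partial>lborel)"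
      proof (rule nn_integral_mono)
        fix h
        have "x + h \<in> thicken K \<epsilon>" if "h \<in> bad"
          using that x te by (auto simp: bad_def B_def E_def thicken_iff dist_norm intro!: bexI[of _ x])
        then show "ennreal (\<tau> powr r) * indicator bad h \<le> ennreal (g (x + h) powr r) * indicator (thicken K \<epsilon>) (x + h)"
          using l0 r by (cases "h \<in> bad") (auto simp: bad_def intro!: ennreal_leI powr_mono2)
      qed
      also have "\<dots> = ennreal m"
        using nn_integral_translate[of "\<lambda>y. ennreal (g y powr r) * indicator (thicken K \<epsilon>) y" x] m by simp
      finally have bm: "ennreal (\<tau> powr r) * emeasure lborel bad \<le> ennreal m" .
      have fin: "emeasure lborel bad \<le> ennreal b"
        unfolding eB[symmetric] by (intro emeasure_mono) (auto simp: bad_def)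
      then obtain z where z: "z \<ge> 0" "emeasure lborel bad = ennreal z"
        using ennreal_finite_ex[of "emeasure lborel bad"] ennreal_less_top[of b] by (auto simp: order_le_less_trans)
      have "\<tau> powr r * z \<le> m" using bm z m by (simp add: ennreal_mult[symmetric])
      then have "\<tau> powr (- r) * (\<tau> powr r * z) \<le> \<tau> powr (- r) * m"
        by (intro mult_left_mono) auto
      moreover have "\<tau> powr (- r) * (\<tau> powr r * z) = z"
        using l0 by (simp add: mult.assoc[symmetric] powr_add[symmetric])
      moreover have "\<tau> powr (- r) * m \<le> b / 2" using m l0 by (simp add: bl field_simps)
      ultimately have zb: "z \<le> b / 2" by linarith
      have "ennreal (b / 2) \<le> ennreal b - ennreal z"
        using zb z by (subst ennreal_minus) (auto intro!: ennreal_leI)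
      also have "\<dots> = emeasure lborel (B - bad)"
        using z eB by (subst emeasure_Diff) (auto simp: bad_def)
      finally have "ennreal (\<tau>\<^sup>2) * ennreal (b / 2) \<le> ennreal (\<tau>\<^sup>2) * emeasure lborel (B - bad)"
        by (intro mult_left_mono) auto
      moreover have "ennreal (\<tau>\<^sup>2) * ennreal (b / 2) = ennreal (\<tau>\<^sup>2 * (b / 2))"
        using b by (intro ennreal_mult[symmetric]) auto
      ultimately have "ennreal (\<tau>\<^sup>2 * (b / 2)) \<le> ennreal (\<tau>\<^sup>2) * emeasure lborel (B - bad)" by simp
      also have "\<dots> = (\<integral>\<^sup>+h. ennreal (\<tau>\<^sup>2) * indicator (B - bad) h \<partial>lborel)"
        by (simp add: nn_integral_cmult)
      also have "\<dots> \<le> (\<integral>\<^sup>+h. ennreal ((g (x + h) - g x)\<^sup>2) * indicator B h \<partial>lborel)"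
      proof (rule nn_integral_mono)
        fix h
        show "ennreal (\<tau>\<^sup>2) * indicator (B - bad) h \<le> ennreal ((g (x + h) - g x)\<^sup>2) * indicator B h"
        proof (cases "h \<in> B - bad")
          case True
          then have "\<tau> \<le> g x - g (x + h)" using x by (auto simp: bad_def E_def)
          then have "\<tau>\<^sup>2 \<le> (g x - g (x + h))\<^sup>2" using l0 by (intro power_mono) auto
          then show ?thesis using True by (auto simp: power2_commute intro!: ennreal_leI)
        qed auto
      qed
      finally show ?thesis .
    qed
    have "ennreal (\<tau>\<^sup>2 * (b / 2)) * emeasure lborel E = (\<integral>\<^sup>+x. ennreal (\<tau>\<^sup>2 * (b / 2)) * indicator E x \<partial>lborel)"
      by (simp add: nn_integral_cmult)
    also have "\<dots> \<le> (\<integral>\<^sup>+x. (\<integral>\<^sup>+h. ennreal ((g (x + h) - g x)\<^sup>2) * indicator B h * indicator K x \<partial>lborel) \<partial>lborel)"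
    proof (rule nn_integral_mono)
      fix x
      show "ennreal (\<tau>\<^sup>2 * (b / 2)) * indicator E x
        \<le> (\<integral>\<^sup>+h. ennreal ((g (x + h) - g x)\<^sup>2) * indicator B h * indicator K x \<partial>lborel)"
        using half[of x] by (cases "x \<in> E") (auto simp: E_def)
    qed
    also have "\<dots> = (\<integral>\<^sup>+h. (\<integral>\<^sup>+x. ennreal ((g (x + h) - g x)\<^sup>2) * indicator B h * indicator K x \<partial>lborel) \<partial>lborel)"
      by (rule lborel_pair.Fubini') measurable
    also have "\<dots> \<le> (\<integral>\<^sup>+h. ennreal (C * t \<tau> powr (2 * \<beta>)) * indicator B h \<partial>lborel)"
    proof (rule nn_integral_mono)
      fix h
      show "(\<integral>\<^sup>+x. ennreal ((g (x + h) - g x)\<^sup>2) * indicator B h * indicator K x \<partial>lborel)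
        \<le> ennreal (C * t \<tau> powr (2 * \<beta>)) * indicator B h"
      proof (cases "h \<in> B")
        case True
        then have h: "norm h < t \<tau>" by (simp add: B_def)
        then have "(\<integral>\<^sup>+x. ennreal ((g (x + h) - g x)\<^sup>2) * indicator K x \<partial>lborel) \<le> ennreal (C * norm h powr (2 * \<beta>))"
          using te by (intro D) auto
        also have "\<dots> \<le> ennreal (C * t \<tau> powr (2 * \<beta>))"
          using h C \<open>\<beta> > 0\<close> by (intro ennreal_leI mult_left_mono powr_mono2) auto
        finally show ?thesis using True by simp
      qed simp
    qed
    also have "\<dots> = ennreal (C * t \<tau> powr (2 * \<beta>) * b)"
      using C b by (simp add: nn_integral_cmult eB ennreal_mult)
    finally have main: "ennreal (\<tau>\<^sup>2 * (b / 2)) * emeasure lborel E \<le> ennreal (C * t \<tau> powr (2 * \<beta>) * b)" .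
    have "emeasure lborel E \<le> emeasure lborel K" by (intro emeasure_mono) (auto simp: E_def)
    then have "emeasure lborel E < \<infinity>" using emeasure_compact_finite[OF K] by (simp add: order_le_less_trans)
    then obtain z where z: "z \<ge> 0" "emeasure lborel E = ennreal z"
      using ennreal_finite_ex[of "emeasure lborel E"] by blast
    have "\<tau>\<^sup>2 * (b / 2) * z \<le> C * t \<tau> powr (2 * \<beta>) * b"
      using main z b C by (simp add: ennreal_mult[symmetric])
    then have "\<tau>\<^sup>2 * z \<le> 2 * C * t \<tau> powr (2 * \<beta>)" using b by (simp add: field_simps)
    then have "z \<le> 2 * C * t \<tau> powr (2 * \<beta>) * \<tau> powr (- 2)"
      using l0 by (simp add: powr_minus field_simps)
    also have "t \<tau> powr (2 * \<beta>) = c powr (2 * \<beta>) * \<tau> powr (- (2 * \<beta> * r / n))"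
      by (simp add: t_def powr_mult powr_powr mult_ac)
    also have "2 * C * (c powr (2 * \<beta>) * \<tau> powr (- (2 * \<beta> * r / n))) * \<tau> powr (- 2)
       = C' * \<tau> powr (- (2 + 2 * \<beta> * r / n))"
    proof -
      have "\<tau> powr (- (2 + 2 * \<beta> * r / n)) = \<tau> powr (- (2 * \<beta> * r / n)) * \<tau> powr (- 2)"
        unfolding powr_add[symmetric] by (simp add: algebra_simps)
      then show ?thesis by (simp only: C'_def mult_ac)
    qed
    finally show "emeasure lborel {x\<in>K. g x > 2 * \<tau>} \<le> ennreal (C' * \<tau> powr (- (2 + 2 * \<beta> * r / real DIM('a))))"
      using z unfolding E_def[symmetric] n_def[symmetric] by (simp add: ennreal_leI)
  qed (use C in \<open>auto simp: C'_def\<close>)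
qed

definition difference_bound :: "real \<Rightarrow> 'a::euclidean_space set \<Rightarrow> ('a \<Rightarrow> 'a \<Rightarrow> real) \<Rightarrow> bool" where
  "difference_bound \<gamma> K F \<longleftrightarrow> (\<exists>C\<ge>0. \<exists>\<delta>>0. \<forall>h. norm h < \<delta> \<longrightarrow>
     (\<integral>\<^sup>+x\<in>K. ennreal (F h x) \<partial>lborel) \<le> ennreal (C * norm h powr \<gamma>))"

text \<open>With \<open>\<theta> = 2 * \<beta> / n < 1\<close> a step improves \<open>r\<close> to anything below \<open>2 + \<theta> * r\<close>. Replacing \<open>2\<close> by a slightly
  smaller \<open>\<sigma>\<close> makes the recursion \<open>r \<mapsto> \<sigma> + \<theta> * r\<close> admissible; it converges geometrically to \<open>\<sigma> / (1 - \<theta>)\<close>,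
  and \<open>\<sigma>\<close> can be taken so close to \<open>2\<close> that this limit still exceeds the given \<open>s\<close>.\<close>

theorem difference_bound_embedding:
  fixes g :: "'a::euclidean_space \<Rightarrow> real"
  assumes g: "g \<in> borel_measurable borel" and g0: "\<And>x. g x \<ge> 0"
    and op: "open \<Omega>" and b: "\<beta> > 0" "2 * \<beta> < real DIM('a)"
    and D: "\<And>K. compact K \<Longrightarrow> K \<subseteq> \<Omega> \<Longrightarrow> difference_bound (2 * \<beta>) K (\<lambda>h x. (g (x + h) - g x)\<^sup>2)"
    and L2: "\<And>K. compact K \<Longrightarrow> K \<subseteq> \<Omega> \<Longrightarrow> (\<integral>\<^sup>+x. ennreal (g x powr 2) * indicator K x \<partial>lborel) < \<infinity>"
    and s: "0 \<le> s" "s < 2 * real DIM('a) / (real DIM('a) - 2 * \<beta>)"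
    and K: "compact K" "K \<subseteq> \<Omega>"
  shows "(\<integral>\<^sup>+x. ennreal (g x powr s) * indicator K x \<partial>lborel) < \<infinity>"
proof -
  define n where "n = real DIM('a)"
  define \<theta> where "\<theta> = 2 * \<beta> / n"
  have n: "n > 0" by (simp add: n_def)
  have th: "0 < \<theta>" "\<theta> < 1" using b n by (auto simp: \<theta>_def n_def)
  define P where "P r \<longleftrightarrow> (\<forall>K. compact K \<and> K \<subseteq> \<Omega> \<longrightarrow>
     (\<integral>\<^sup>+x. ennreal (g x powr r) * indicator K x \<partial>lborel) < \<infinity>)" for r
  have step: "P s" if r: "P r" "r > 0" and s: "0 \<le> s" "s < 2 + \<theta> * r" for r s
    unfolding P_def
  proof safe
    fix K assume K: "compact K" "K \<subseteq> \<Omega>"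
    obtain \<epsilon> where e: "\<epsilon> > 0" "thicken K \<epsilon> \<subseteq> \<Omega>"
      using compact_subset_open_imp_cball_epsilon_subset[OF K(1) op K(2)] unfolding thicken_def by blast
    obtain C \<delta> where C: "C \<ge> 0" "\<delta> > 0" "\<And>h. norm h < \<delta> \<Longrightarrow>
        (\<integral>\<^sup>+x. ennreal ((g (x + h) - g x)\<^sup>2) * indicator K x \<partial>lborel) \<le> ennreal (C * norm h powr (2 * \<beta>))"
      using D[OF K] unfolding difference_bound_def by blast
    define d where "d = min \<epsilon> \<delta>"
    have d: "d > 0" "d \<le> \<epsilon>" "d \<le> \<delta>" using e C by (auto simp: d_def)
    have "thicken K d \<subseteq> \<Omega>" using e(2) d by (force simp: thicken_iff)
    then have M: "(\<integral>\<^sup>+x. ennreal (g x powr r) * indicator (thicken K d) x \<partial>lborel) < \<infinity>"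
      using r compact_thicken[OF K(1)] by (auto simp: P_def)
    have D': "(\<integral>\<^sup>+x. ennreal ((g (x + h) - g x)\<^sup>2) * indicator K x \<partial>lborel) \<le> ennreal (C * norm h powr (2 * \<beta>))"
      if "norm h < d" for h using C(3) d that by simp
    obtain C' \<tau>0 where "C' \<ge> 0" "\<tau>0 > 0"
      "\<And>\<tau>. \<tau> \<ge> \<tau>0 \<Longrightarrow> emeasure lborel {x\<in>K. g x > 2 * \<tau>}
        \<le> ennreal (C' * \<tau> powr (- (2 + 2 * \<beta> * r / real DIM('a))))"
      by (rule weak_type_step[OF g g0 K(1) d(1) b(1) r(2) C(1) D' M]) auto
    then show "(\<integral>\<^sup>+x. ennreal (g x powr s) * indicator K x \<partial>lborel) < \<infinity>"
      using s by (intro weak_type_imp_integrable[OF g g0 K(1)]) (auto simp: \<theta>_def n_def)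
  qed
  have P2: "P 2" using L2 by (simp add: P_def)
  have sR: "s * (1 - \<theta>) < 2"
    using s b n by (simp add: \<theta>_def n_def field_simps)
  have "P s"
  proof (cases "s < 2 + \<theta> * 2")
    case True
    then show ?thesis using step[OF P2] s by simp
  next
    case False
    then have s2: "s > 2" using th by (smt (verit) mult_pos_pos)
    define \<sigma> where "\<sigma> = (s * (1 - \<theta>) + 2) / 2"
    define R where "R = \<sigma> / (1 - \<theta>)"
    have sg: "s * (1 - \<theta>) < \<sigma>" "\<sigma> < 2" using sR by (auto simp: \<sigma>_def)
    have R: "s < R" "\<sigma> + \<theta> * R = R" using sg th by (auto simp: R_def field_simps)
    define r where "r j = R - \<theta> ^ j * (R - 2)" for j :: nat
    have r2: "r j \<ge> 2" for j
    proof -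
      have "\<theta> ^ j * (R - 2) \<le> 1 * (R - 2)" using th R s2 by (intro mult_right_mono power_le_one) auto
      then show ?thesis by (simp add: r_def)
    qed
    have rs: "r (Suc j) = \<sigma> + \<theta> * r j" for j
      using R(2) by (simp add: r_def algebra_simps)
    have Pr: "P (r j)" for j
    proof (induction j)
      case 0
      then show ?case using P2 by (simp add: r_def)
    next
      case (Suc j)
      show ?case using step[OF Suc, of "r (Suc j)"] r2[of j] r2[of "Suc j"] rs[of j] sg by simp
    qed
    have "r \<longlonglongrightarrow> R - 0 * (R - 2)" unfolding r_def
      using th by (intro tendsto_intros LIMSEQ_power_zero) auto
    then have "\<forall>\<^sub>F j in sequentially. s < r j" using R(1) by (intro order_tendstoD(1)) auto
    then obtain j where "s < r (Suc j)" unfolding eventually_sequentially by (meson le_SucI order_refl)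
    then show ?thesis using step[OF Pr, of j s] r2[of j] rs[of j] sg s by simp
  qed
  then show ?thesis using K by (simp add: P_def)
qed

section \<open>Test functions and their gradients\<close>

definition grad :: "('a::euclidean_space \<Rightarrow> real) \<Rightarrow> 'a \<Rightarrow> 'a" where
  "grad \<psi> x = (\<Sum>i\<in>Basis. frechet_derivative \<psi> (at x) i *\<^sub>R i)"

lemma grad_inner_Basis: "i \<in> Basis \<Longrightarrow> grad \<psi> x \<bullet> i = frechet_derivative \<psi> (at x) i"
  by (simp add: grad_def inner_sum_left inner_Basis if_distrib sum.delta cong: if_cong)

lemma has_derivative_grad:
  assumes "\<psi> differentiable (at x)"
  shows "(\<psi> has_derivative (\<lambda>h. grad \<psi> x \<bullet> h)) (at x)"
proof -
  have d: "(\<psi> has_derivative frechet_derivative \<psi> (at x)) (at x)"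
    using assms by (simp add: frechet_derivative_works[symmetric])
  then interpret linear "frechet_derivative \<psi> (at x)"
    by (simp add: has_derivative_def bounded_linear.linear)
  have "frechet_derivative \<psi> (at x) h = grad \<psi> x \<bullet> h" for h
  proof -
    have "frechet_derivative \<psi> (at x) h = frechet_derivative \<psi> (at x) (\<Sum>i\<in>Basis. (h \<bullet> i) *\<^sub>R i)"
      by (simp add: euclidean_representation)
    also have "\<dots> = (\<Sum>i\<in>Basis. (h \<bullet> i) * frechet_derivative \<psi> (at x) i)"
      by (simp add: sum scaleR)
    also have "\<dots> = grad \<psi> x \<bullet> h"
      by (simp add: grad_def inner_sum_left inner_commute[of h] mult.commute)
    finally show ?thesis .
  qed
  then have "frechet_derivative \<psi> (at x) = (\<lambda>h. grad \<psi> x \<bullet> h)" by auto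
  then show ?thesis using d by simp
qed

lemma grad_unique:
  assumes "(\<psi> has_derivative (\<lambda>h. g \<bullet> h)) (at x)"
  shows "grad \<psi> x = g"
proof -
  have "frechet_derivative \<psi> (at x) = (\<lambda>h. g \<bullet> h)"
    using frechet_derivative_at[OF assms] by simp
  then show ?thesis by (simp add: grad_def euclidean_representation)
qed

lemma test_functionsI:
  assumes "\<And>k. Ck k \<psi>" "compact S" "S \<subseteq> \<Omega>" "\<And>x. x \<notin> S \<Longrightarrow> \<psi> x = 0"
  shows "\<psi> \<in> test_functions \<Omega>"
proof -
  have cl: "closure {x. \<psi> x \<noteq> 0} \<subseteq> S"
    using assms by (intro closure_minimal compact_imp_closed) auto
  moreover have "compact (closure {x. \<psi> x \<noteq> 0})"
    using bounded_subset[OF compact_imp_bounded[OF assms(2)]] cl closure_subset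
    by (metis bounded_subset compact_closure)
  ultimately show ?thesis using assms by (auto simp: test_functions_def)
qed

text \<open>One compact set and one bound that serve the function and its gradient together.\<close>

lemma test_functionsE:
  fixes \<psi> :: "'a::euclidean_space \<Rightarrow> real"
  assumes "\<psi> \<in> test_functions \<Omega>"
  obtains S M where "compact S" "S \<subseteq> \<Omega>" "\<And>x. x \<notin> S \<Longrightarrow> \<psi> x = 0" "\<And>x. x \<notin> S \<Longrightarrow> grad \<psi> x = 0"
    "M \<ge> 0" "\<And>x. \<bar>\<psi> x\<bar> \<le> M" "\<And>x. norm (grad \<psi> x) \<le> M"
proof -
  define S where "S = closure {x. \<psi> x \<noteq> 0}"
  have S: "compact S" "S \<subseteq> \<Omega>" and ck: "\<And>k. Ck k \<psi>"
    using assms by (auto simp: test_functions_def S_def)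
  have 0: "\<psi> x = 0" if "x \<notin> S" for x
    using that closure_subset[of "{x. \<psi> x \<noteq> 0}"] by (auto simp: S_def)
  have g0: "grad \<psi> x = 0" if "x \<notin> S" for x
  proof (rule grad_unique)
    have "((\<lambda>_. 0) has_derivative (\<lambda>_. 0)) (at x)" by simp
    then show "(\<psi> has_derivative (\<lambda>h. 0 \<bullet> h)) (at x)"
      unfolding inner_zero_left
      by (rule has_derivative_transform_within_open[of _ _ _ _ "- S"])
         (use S that 0 in \<open>auto simp: compact_imp_closed open_Compl\<close>)
  qed
  have c: "continuous_on UNIV \<psi>" using ck[of 0] by simp
  have cg: "continuous_on UNIV (grad \<psi>)"
    unfolding grad_def using Ck_SucD(2)[OF ck[of "Suc 0"]] by (auto intro!: continuous_intros)
  have bd: "\<exists>M. \<forall>x\<in>S. norm (f x) \<le> M" if "continuous_on UNIV f" for f :: "'a \<Rightarrow> 'b::real_normed_vector"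
    using compact_imp_bounded[OF compact_continuous_image[OF continuous_on_subset[OF that] S(1)]]
    by (auto simp: bounded_iff)
  obtain M1 where M1: "\<And>x. x \<in> S \<Longrightarrow> \<bar>\<psi> x\<bar> \<le> M1" using bd[OF c] by auto
  obtain M2 where M2: "\<And>x. x \<in> S \<Longrightarrow> norm (grad \<psi> x) \<le> M2" using bd[OF cg] by auto
  show thesis
  proof (rule that[OF S 0 g0, of "max 0 (max M1 M2)"])
    fix x
    show "\<bar>\<psi> x\<bar> \<le> max 0 (max M1 M2)" using M1[of x] 0[of x] by (cases "x \<in> S") auto
    show "norm (grad \<psi> x) \<le> max 0 (max M1 M2)" using M2[of x] g0[of x] by (cases "x \<in> S") auto
  qed auto
qed

lemma test_function_props:
  fixes \<psi> :: "'a::euclidean_space \<Rightarrow> real"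
  assumes "\<psi> \<in> test_functions \<Omega>"
  shows "Ck k \<psi>" "continuous_on UNIV \<psi>" "continuous_on UNIV (grad \<psi>)"
    "\<psi> \<in> borel_measurable borel" "grad \<psi> \<in> borel_measurable borel"
    "(\<psi> has_derivative (\<lambda>h. grad \<psi> x \<bullet> h)) (at x)"
proof -
  have ck: "\<And>k. Ck k \<psi>" using assms by (auto simp: test_functions_def)
  then show "Ck k \<psi>" .
  show c: "continuous_on UNIV \<psi>" using ck[of 0] by simp
  show cg: "continuous_on UNIV (grad \<psi>)"
    unfolding grad_def using Ck_SucD(2)[OF ck[of "Suc 0"]] by (auto intro!: continuous_intros)
  show "\<psi> \<in> borel_measurable borel" "grad \<psi> \<in> borel_measurable borel"
    using c cg by (auto intro: borel_measurable_continuous_onI)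
  show "(\<psi> has_derivative (\<lambda>h. grad \<psi> x \<bullet> h)) (at x)"
    using ck[of "Suc 0"] by (intro has_derivative_grad) (auto simp: Ck.simps(2))
qed

lemma test_functions_mono: "\<psi> \<in> test_functions U \<Longrightarrow> U \<subseteq> V \<Longrightarrow> \<psi> \<in> test_functions V"
  by (auto simp: test_functions_def)

lemma test_functions_translate:
  fixes \<psi> :: "'a::euclidean_space \<Rightarrow> real"
  assumes "\<psi> \<in> test_functions \<Omega>" and "\<And>x. \<psi> x \<noteq> 0 \<Longrightarrow> x \<in> S" "compact S" "\<And>x. x \<in> S \<Longrightarrow> x - c \<in> \<Omega>'"
  shows "(\<lambda>x. \<psi> (x + c)) \<in> test_functions \<Omega>'"
proof (rule test_functionsI)
  show "Ck k (\<lambda>x. \<psi> (x + c))" for k using assms by (intro Ck_translate test_function_props)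
  show "compact ((\<lambda>x. x - c) ` S)"
    using assms by (intro compact_continuous_image continuous_intros)
  show "(\<lambda>x. x - c) ` S \<subseteq> \<Omega>'" using assms by auto
  show "\<psi> (x + c) = 0" if "x \<notin> (\<lambda>x. x - c) ` S" for x
    using that assms(2)[of "x + c"] by (metis add_diff_cancel_right' image_eqI)
qed

lemma grad_translate:
  assumes "\<And>x. \<psi> differentiable (at x)"
  shows "grad (\<lambda>x. \<psi> (x + c)) x = grad \<psi> (x + c)"
proof -
  have "frechet_derivative (\<lambda>x. \<psi> (x + c)) (at x) = frechet_derivative \<psi> (at (x + c))"
    using frechet_derivative_at[OF frechet_derivative_translate[OF assms]] by simp
  then show ?thesis by (simp add: grad_def)
qed

lemma test_functions_mult:
  fixes \<psi> \<zeta> :: "'a::euclidean_space \<Rightarrow> real"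
  assumes "\<psi> \<in> test_functions \<Omega>" "\<zeta> \<in> test_functions \<Omega>'"
  shows "(\<lambda>x. \<zeta> x * \<psi> x) \<in> test_functions \<Omega>"
    "grad (\<lambda>x. \<zeta> x * \<psi> x) x = \<zeta> x *\<^sub>R grad \<psi> x + \<psi> x *\<^sub>R grad \<zeta> x"
proof -
  obtain S where S: "compact S" "S \<subseteq> \<Omega>" "\<And>x. x \<notin> S \<Longrightarrow> \<psi> x = 0"
    by (rule test_functionsE[OF assms(1)]) blast
  show "(\<lambda>x. \<zeta> x * \<psi> x) \<in> test_functions \<Omega>"
    by (rule test_functionsI[OF Ck_mult[OF test_function_props(1)[OF assms(2)] test_function_props(1)[OF assms(1)]] S(1,2)])
       (use S(3) in simp)
  show "grad (\<lambda>x. \<zeta> x * \<psi> x) x = \<zeta> x *\<^sub>R grad \<psi> x + \<psi> x *\<^sub>R grad \<zeta> x"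
    using has_derivative_mult[OF test_function_props(6)[OF assms(2)] test_function_props(6)[OF assms(1)], of x]
    by (intro grad_unique) (simp add: inner_add_left algebra_simps)
qed

section \<open>Local integrability of Borel functions\<close>

lemma lborel_integral_translate:
  fixes f :: "'a::euclidean_space \<Rightarrow> 'b::euclidean_space"
  assumes [measurable]: "f \<in> borel_measurable borel"
  shows "(\<integral>x. f (x + c) \<partial>lborel) = (\<integral>x. f x \<partial>lborel)"
proof -
  have "(\<integral>x. f x \<partial>lborel) = (\<integral>x. f x \<partial>distr lborel borel ((+) c))"
    by (simp only: lborel_distr_plus)
  also have "\<dots> = (\<integral>x. f (c + x) \<partial>lborel)"
    by (subst integral_distr) simp_all
  finally show ?thesis by (simp add: add.commute)
qed

lemma nn_integral_translate_set:
  fixes f :: "'a::euclidean_space \<Rightarrow> real"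
  assumes [measurable]: "f \<in> borel_measurable borel" "T \<in> sets borel"
    and "\<And>x. x \<in> S \<Longrightarrow> x + c \<in> T"
  shows "(\<integral>\<^sup>+x\<in>S. ennreal (f (x + c)) \<partial>lborel) \<le> (\<integral>\<^sup>+x\<in>T. ennreal (f x) \<partial>lborel)"
proof -
  have "(\<integral>\<^sup>+x\<in>S. ennreal (f (x + c)) \<partial>lborel) \<le> (\<integral>\<^sup>+x. ennreal (f (c + x)) * indicator T (c + x) \<partial>lborel)"
    using assms(3) by (intro nn_integral_mono) (auto simp: add.commute split: split_indicator)
  also have "\<dots> = (\<integral>\<^sup>+x\<in>T. ennreal (f x) \<partial>lborel)"
    by (rule nn_integral_translate) simp
  finally show ?thesis .
qed

text \<open>Local \<open>m\<close>-th power integrability for Borel functions. For a merely Lebesgue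
  measurable \<open>v\<close> the function \<open>\<lambda>(x, s). v (x + s *\<^sub>R h)\<close> need not be measurable for the product of the
  Borel measures, to which Fubini's theorem is applied.\<close>

definition loc_pow :: "real \<Rightarrow> 'a::euclidean_space set \<Rightarrow> ('a \<Rightarrow> 'b::euclidean_space) \<Rightarrow> bool" where
  "loc_pow m \<Omega> v \<longleftrightarrow> v \<in> borel_measurable borel \<and>
     (\<forall>K. compact K \<and> K \<subseteq> \<Omega> \<longrightarrow> (\<integral>\<^sup>+x\<in>K. ennreal (norm (v x) powr m) \<partial>lborel) < \<infinity>)"

lemma loc_powD:
  assumes "loc_pow m \<Omega> v"
  shows "v \<in> borel_measurable borel"
    "compact K \<Longrightarrow> K \<subseteq> \<Omega> \<Longrightarrow> (\<integral>\<^sup>+x\<in>K. ennreal (norm (v x) powr m) \<partial>lborel) < \<infinity>"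
  using assms by (auto simp: loc_pow_def)

lemma powr_le_1_add: "0 \<le> t \<Longrightarrow> 0 \<le> a \<Longrightarrow> a \<le> b \<Longrightarrow> t powr a \<le> 1 + t powr b" for t :: real
proof (cases "t \<le> 1")
  case True
  assume "0 \<le> t" "0 \<le> a"
  then have "t powr a \<le> 1" using True by (simp add: powr_le1)
  then show ?thesis by (rule add_increasing2[rotated]) simp
next
  case False
  assume "a \<le> b"
  then have "t powr a \<le> t powr b" using False by (intro powr_mono) auto
  then show ?thesis by simp
qed

lemma loc_pow_mono:
  assumes v: "loc_pow b \<Omega> v" and ab: "0 \<le> a" "a \<le> b"
  shows "loc_pow a \<Omega> v"
  unfolding loc_pow_def
proof safe
  show [measurable]: "v \<in> borel_measurable borel" using v by (rule loc_powD)
  fix K assume K: "compact K" "K \<subseteq> \<Omega>"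
  then have [measurable]: "K \<in> sets borel" by (simp add: borel_compact)
  have "(\<integral>\<^sup>+x\<in>K. ennreal (norm (v x) powr a) \<partial>lborel)
     \<le> (\<integral>\<^sup>+x. indicator K x + ennreal (norm (v x) powr b) * indicator K x \<partial>lborel)"
  proof (rule nn_integral_mono)
    fix x
    have "ennreal (norm (v x) powr a) \<le> ennreal (1 + norm (v x) powr b)"
      using ab by (intro ennreal_leI powr_le_1_add) auto
    also have "\<dots> = 1 + ennreal (norm (v x) powr b)" by (subst ennreal_plus) auto
    finally show "ennreal (norm (v x) powr a) * indicator K x \<le> indicator K x + ennreal (norm (v x) powr b) * indicator K x"
      by (cases "x \<in> K") simp_all
  qed
  also have "\<dots> = emeasure lborel K + (\<integral>\<^sup>+x\<in>K. ennreal (norm (v x) powr b) \<partial>lborel)"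
    by (subst nn_integral_add) auto
  also have "\<dots> < \<infinity>"
    using emeasure_compact_finite[OF K(1)] loc_powD(2)[OF v K] by (simp add: less_top)
  finally show "(\<integral>\<^sup>+x\<in>K. ennreal (norm (v x) powr a) \<partial>lborel) < \<infinity>" .
qed

lemma nn_integral_dominated:
  fixes F :: "'a::euclidean_space \<Rightarrow> 'c::euclidean_space" and v :: "'a \<Rightarrow> 'b::euclidean_space"
  assumes v: "loc_pow m \<Omega> v" and m: "m \<ge> 0"
    and S: "compact S" "\<And>x. x \<notin> S \<Longrightarrow> F x = 0" and M: "\<And>x. x \<in> S \<Longrightarrow> norm (F x) \<le> M * norm (v (x + c))"
    and T: "\<And>x. x \<in> S \<Longrightarrow> x + c \<in> \<Omega>"
  shows "(\<integral>\<^sup>+x. ennreal (norm (F x) powr m) \<partial>lborel) < \<infinity>"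
proof -
  define T where "T = (\<lambda>x. x + c) ` S"
  have T': "compact T" "T \<subseteq> \<Omega>"
    using S T by (auto simp: T_def intro!: compact_continuous_image continuous_intros)
  have [measurable]: "v \<in> borel_measurable borel" using v by (rule loc_powD)
  have [measurable]: "T \<in> sets borel" "S \<in> sets borel" using T' S by (auto intro: borel_compact)
  define M' where "M' = max 0 M powr m"
  have "(\<integral>\<^sup>+x. ennreal (norm (F x) powr m) \<partial>lborel)
      \<le> (\<integral>\<^sup>+x. ennreal M' * (ennreal (norm (v (x + c)) powr m) * indicator S x) \<partial>lborel)"
  proof (rule nn_integral_mono)
    fix x
    show "ennreal (norm (F x) powr m) \<le> ennreal M' * (ennreal (norm (v (x + c)) powr m) * indicator S x)"
    proof (cases "x \<in> S")
      case True
      have "norm (F x) \<le> max 0 M * norm (v (x + c))"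
        by (rule order.trans[OF M[OF True]]) (intro mult_right_mono; simp)
      then have "norm (F x) powr m \<le> (max 0 M * norm (v (x + c))) powr m" using m by (intro powr_mono2) auto
      then show ?thesis using True by (simp add: ennreal_mult[symmetric] ennreal_leI powr_mult M'_def)
    qed (use S in auto)
  qed
  also have "\<dots> = ennreal M' * (\<integral>\<^sup>+x\<in>S. ennreal (norm (v (x + c)) powr m) \<partial>lborel)"
    by (rule nn_integral_cmult) measurable
  also have "\<dots> \<le> ennreal M' * (\<integral>\<^sup>+x\<in>T. ennreal (norm (v x) powr m) \<partial>lborel)"
    by (intro mult_left_mono nn_integral_translate_set) (use \<open>T \<in> sets borel\<close> in \<open>auto simp: T_def\<close>)
  also have "\<dots> < \<infinity>"
    using loc_powD(2)[OF v T'] by (simp add: ennreal_mult_less_top less_top)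
  finally show ?thesis .
qed

lemma loc_pow_dominated:
  fixes F :: "'a::euclidean_space \<Rightarrow> 'c::euclidean_space" and v :: "'a \<Rightarrow> 'b::euclidean_space"
  assumes F: "F \<in> borel_measurable borel" and v: "loc_pow m \<Omega> v" and m: "m \<ge> 0"
    and S: "compact S" "\<And>x. x \<notin> S \<Longrightarrow> F x = 0" and M: "\<And>x. x \<in> S \<Longrightarrow> norm (F x) \<le> M * norm (v (x + c))"
    and T: "\<And>x. x \<in> S \<Longrightarrow> x + c \<in> \<Omega>"
  shows "loc_pow m U F"
  unfolding loc_pow_def
proof (intro conjI allI impI F)
  fix K
  have "(\<integral>\<^sup>+x\<in>K. ennreal (norm (F x) powr m) \<partial>lborel) \<le> (\<integral>\<^sup>+x. ennreal (norm (F x) powr m) \<partial>lborel)"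
    by (intro nn_integral_mono) (auto split: split_indicator)
  also have "\<dots> < \<infinity>" by (rule nn_integral_dominated[OF v m S M T])
  finally show "(\<integral>\<^sup>+x\<in>K. ennreal (norm (F x) powr m) \<partial>lborel) < \<infinity>" .
qed

lemma integrable_dominated:
  fixes F :: "'a::euclidean_space \<Rightarrow> 'c::euclidean_space" and v :: "'a \<Rightarrow> 'b::euclidean_space"
  assumes F: "F \<in> borel_measurable borel" and v: "loc_pow 1 \<Omega> v"
    and S: "compact S" "\<And>x. x \<notin> S \<Longrightarrow> F x = 0" and M: "\<And>x. x \<in> S \<Longrightarrow> norm (F x) \<le> M * norm (v (x + c))"
    and T: "\<And>x. x \<in> S \<Longrightarrow> x + c \<in> \<Omega>"
  shows "integrable lborel F"
  using F nn_integral_dominated[OF v _ S M T] by (intro integrableI_bounded) auto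

lemma powr_norm_add_le:
  fixes a b :: "'b::real_normed_vector"
  assumes m: "m \<ge> 0"
  shows "norm (a + b) powr m \<le> 2 powr m * norm a powr m + 2 powr m * norm b powr m"
proof -
  have "norm (a + b) \<le> 2 * max (norm a) (norm b)" using norm_triangle_ineq[of a b] by linarith
  then have "norm (a + b) powr m \<le> (2 * max (norm a) (norm b)) powr m" using m by (intro powr_mono2) auto
  also have "\<dots> = 2 powr m * max (norm a) (norm b) powr m" by (simp add: powr_mult)
  also have "\<dots> \<le> 2 powr m * norm a powr m + 2 powr m * norm b powr m" by (auto simp: max_def)
  finally show ?thesis .
qed

lemma loc_pow_add:
  fixes f g :: "'a::euclidean_space \<Rightarrow> 'b::euclidean_space"
  assumes f: "loc_pow m U f" and g: "loc_pow m U g" and m: "m \<ge> 0"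
  shows "loc_pow m U (\<lambda>x. f x + g x)"
  unfolding loc_pow_def
proof safe
  have [measurable]: "f \<in> borel_measurable borel" "g \<in> borel_measurable borel" using f g by (auto intro: loc_powD)
  show "(\<lambda>x. f x + g x) \<in> borel_measurable borel" by measurable
  fix K assume K: "compact K" "K \<subseteq> U"
  then have [measurable]: "K \<in> sets borel" by (simp add: borel_compact)
  have "(\<integral>\<^sup>+x\<in>K. ennreal (norm (f x + g x) powr m) \<partial>lborel)
     \<le> (\<integral>\<^sup>+x. ennreal (2 powr m) * (ennreal (norm (f x) powr m) * indicator K x)
          + ennreal (2 powr m) * (ennreal (norm (g x) powr m) * indicator K x) \<partial>lborel)"
  proof (rule nn_integral_mono)
    fix x
    have "ennreal (norm (f x + g x) powr m) \<le> ennreal (2 powr m) * ennreal (norm (f x) powr m) + ennreal (2 powr m) * ennreal (norm (g x) powr m)"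
      using ennreal_leI[OF powr_norm_add_le[OF m]] by (simp add: ennreal_plus ennreal_mult)
    then show "ennreal (norm (f x + g x) powr m) * indicator K x \<le> ennreal (2 powr m) * (ennreal (norm (f x) powr m) * indicator K x)
          + ennreal (2 powr m) * (ennreal (norm (g x) powr m) * indicator K x)"
      by (cases "x \<in> K") auto
  qed
  also have "\<dots> = ennreal (2 powr m) * (\<integral>\<^sup>+x\<in>K. ennreal (norm (f x) powr m) \<partial>lborel)
        + ennreal (2 powr m) * (\<integral>\<^sup>+x\<in>K. ennreal (norm (g x) powr m) \<partial>lborel)"
    by (subst nn_integral_add) (auto simp: nn_integral_cmult)
  also have "\<dots> < \<infinity>" using loc_powD(2)[OF f K] loc_powD(2)[OF g K] by (simp add: ennreal_mult_less_top less_top)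
  finally show "(\<integral>\<^sup>+x\<in>K. ennreal (norm (f x + g x) powr m) \<partial>lborel) < \<infinity>" .
qed

lemma loc_pow_diff:
  fixes f g :: "'a::euclidean_space \<Rightarrow> 'b::euclidean_space"
  assumes f: "loc_pow m U f" and g: "loc_pow m U g" and m: "m \<ge> 0"
  shows "loc_pow m U (\<lambda>x. f x - g x)"
proof -
  have "loc_pow m U (\<lambda>x. - g x)" using g by (simp add: loc_pow_def)
  from loc_pow_add[OF f this m] show ?thesis by simp
qed

lemma loc_pow_translate:
  fixes v :: "'a::euclidean_space \<Rightarrow> 'b::euclidean_space"
  assumes v: "loc_pow m \<Omega> v" and c: "\<And>x. x \<in> U \<Longrightarrow> x + c \<in> \<Omega>"
  shows "loc_pow m U (\<lambda>x. v (x + c))"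
  unfolding loc_pow_def
proof safe
  have [measurable]: "v \<in> borel_measurable borel" using v by (rule loc_powD)
  show "(\<lambda>x. v (x + c)) \<in> borel_measurable borel" by measurable
  fix K assume K: "compact K" "K \<subseteq> U"
  have T: "compact ((\<lambda>x. x + c) ` K)"
    using K by (intro compact_continuous_image continuous_intros)
  have "(\<integral>\<^sup>+x\<in>K. ennreal (norm (v (x + c)) powr m) \<partial>lborel) \<le> (\<integral>\<^sup>+x\<in>((\<lambda>x. x + c) ` K). ennreal (norm (v x) powr m) \<partial>lborel)"
    using T by (intro nn_integral_translate_set) (auto intro: borel_compact)
  also have "\<dots> < \<infinity>" using c K by (intro loc_powD(2)[OF v T]) auto
  finally show "(\<integral>\<^sup>+x\<in>K. ennreal (norm (v (x + c)) powr m) \<partial>lborel) < \<infinity>" .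
qed

lemma integrable_bounded_mult:
  fixes b :: "'a::euclidean_space \<Rightarrow> real" and v :: "'a \<Rightarrow> 'b::euclidean_space"
  assumes [measurable]: "b \<in> borel_measurable borel" and v: "loc_pow 1 \<Omega> v"
    and S: "compact S" "\<And>x. x \<notin> S \<Longrightarrow> b x = 0" and M: "\<And>x. \<bar>b x\<bar> \<le> M"
    and T: "\<And>x. x \<in> S \<Longrightarrow> x + c \<in> \<Omega>"
  shows "integrable lborel (\<lambda>x. b x *\<^sub>R v (x + c))"
proof (rule integrable_dominated[OF _ v S(1), where M=M and c=c])
  have [measurable]: "v \<in> borel_measurable borel" using v by (rule loc_powD)
  show "(\<lambda>x. b x *\<^sub>R v (x + c)) \<in> borel_measurable borel" by measurable
qed (use S T M in \<open>auto intro!: mult_right_mono\<close>)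

section \<open>The fundamental lemma of the calculus of variations\<close>

text \<open>Cutoffs equal to one on \<open>K\<close> and supported in shrinking neighbourhoods of \<open>K\<close> converge pointwise
  to the indicator of \<open>K\<close>.\<close>

lemma integral_compact_eq_0:
  fixes g :: "'a::euclidean_space \<Rightarrow> real"
  assumes g: "loc_pow 1 U g" and U: "open U"
    and 0: "\<And>\<psi>. \<psi> \<in> test_functions U \<Longrightarrow> (\<integral>x. g x * \<psi> x \<partial>lborel) = 0"
    and K: "compact K" "K \<subseteq> U"
  shows "(\<integral>x. g x * indicator K x \<partial>lborel) = 0"
proof -
  have [measurable]: "g \<in> borel_measurable borel" using g by (rule loc_powD)
  obtain \<epsilon> where e: "\<epsilon> > 0" "thicken K \<epsilon> \<subseteq> U"
    using compact_subset_open_imp_cball_epsilon_subset[OF K(1) U K(2)] unfolding thicken_def by blast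
  define W where "W k = (\<Union>x\<in>K. ball x (\<epsilon> / real (Suc k)))" for k
  have W: "open (W k)" "K \<subseteq> W k" for k using e by (auto simp: W_def)
  have "W k \<subseteq> thicken K \<epsilon>" for k
  proof -
    have "\<epsilon> / real (Suc k) \<le> \<epsilon>" using e by (simp add: field_simps)
    then show ?thesis by (force simp: W_def thicken_iff)
  qed
  then have WU: "W k \<subseteq> thicken K \<epsilon>" for k .
  have "\<exists>\<eta>. \<eta> \<in> test_functions (W k) \<and> (\<forall>x. 0 \<le> \<eta> x \<and> \<eta> x \<le> 1) \<and> (\<forall>x\<in>K. \<eta> x = 1)" for k
    using exists_cutoff[OF K(1) W] by metis
  then obtain \<eta> where eta: "\<And>k. \<eta> k \<in> test_functions (W k)" "\<And>k x. 0 \<le> \<eta> k x" "\<And>k x. \<eta> k x \<le> 1"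
      "\<And>k x. x \<in> K \<Longrightarrow> \<eta> k x = 1"
    by metis
  have off: "\<eta> k x = 0" if "x \<notin> W k" for k x
    using test_functionsE[OF eta(1)[of k]] that by (metis subsetD)
  have [measurable]: "K \<in> sets borel" "thicken K \<epsilon> \<in> sets borel" "\<eta> k \<in> borel_measurable borel" for k
    using K compact_thicken[OF K(1)] test_function_props(4)[OF eta(1)] by (auto intro: borel_compact)
  have "(\<lambda>k. \<integral>x. g x * \<eta> k x \<partial>lborel) \<longlonglongrightarrow> (\<integral>x. g x * indicator K x \<partial>lborel)"
  proof (rule integral_dominated_convergence)
    have "integrable lborel (\<lambda>x. indicator (thicken K \<epsilon>) x *\<^sub>R g (x + 0))"
      using e by (intro integrable_bounded_mult[OF _ g compact_thicken[OF K(1)], where M=1]) auto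
    then show "integrable lborel (\<lambda>x. \<bar>indicator (thicken K \<epsilon>) x * g x\<bar>)" by simp
    show "AE x in lborel. norm (g x * \<eta> k x) \<le> \<bar>indicator (thicken K \<epsilon>) x * g x\<bar>" for k
    proof (rule AE_I2)
      fix x
      show "norm (g x * \<eta> k x) \<le> \<bar>indicator (thicken K \<epsilon>) x * g x\<bar>"
        using eta(2,3)[of k x] off[of x k] WU[of k]
        by (cases "x \<in> thicken K \<epsilon>"; cases "x \<in> W k") (auto simp: abs_mult mult_left_le)
    qed
    show "AE x in lborel. (\<lambda>k. g x * \<eta> k x) \<longlonglongrightarrow> g x * indicator K x"
    proof (rule AE_I2, intro tendsto_mult tendsto_const)
      fix x
      show "(\<lambda>k. \<eta> k x) \<longlonglongrightarrow> indicator K x"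
      proof (cases "x \<in> K")
        case False
        have "open (- K)" using K compact_imp_closed by auto
        then obtain d where d: "d > 0" "ball x d \<subseteq> - K" using False open_contains_ball by blast
        obtain N where N: "\<epsilon> / d < real N" using reals_Archimedean2 by blast
        have "\<eta> k x = 0" if "k \<ge> N" for k
        proof (rule off)
          have "\<epsilon> / d < real (Suc k)" using N that by linarith
          then have "\<epsilon> / real (Suc k) < d" using d(1) by (simp add: field_simps)
          then show "x \<notin> W k" using d(2) by (force simp: W_def dist_commute)
        qed
        then show ?thesis using False
          by (intro tendsto_eventually) (auto simp: eventually_sequentially)
      qed (simp add: eta)
    qed
  qed measurable
  moreover have "(\<integral>x. g x * \<eta> k x \<partial>lborel) = 0" for k
    using e WU[of k] by (intro 0 test_functions_mono[OF eta(1)]) auto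
  ultimately show ?thesis by (simp add: LIMSEQ_const_iff)
qed

text \<open>By inner regularity the set where \<open>g > 0\<close> is exhausted, up to small measure, by compact sets; on each
  of these a positive function has integral zero, so they are null.\<close>

lemma null_positive_part:
  fixes g :: "'a::euclidean_space \<Rightarrow> real"
  assumes g: "loc_pow 1 U g"
    and 0: "\<And>K. compact K \<Longrightarrow> K \<subseteq> U \<Longrightarrow> (\<integral>x. g x * indicator K x \<partial>lborel) = 0"
    and C: "compact C" "C \<subseteq> U"
  shows "emeasure lborel {x\<in>C. g x > 0} = 0"
proof -
  have [measurable]: "g \<in> borel_measurable borel" "C \<in> sets borel"
    using g C by (auto intro: loc_powD borel_compact)
  define A where "A = {x\<in>C. g x > 0}"
  have [measurable]: "A \<in> sets borel" by (simp add: A_def)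
  have "emeasure lborel A \<le> ennreal e" if e: "e > 0" for e
  proof -
    have A: "A \<in> sets lebesgue" using \<open>A \<in> sets borel\<close> by simp
    obtain T where T: "closed T" "T \<subseteq> A" "emeasure lebesgue (A - T) < ennreal e"
      by (rule sets_lebesgue_inner_closed[OF A e]) blast
    have "T \<subseteq> C" using T(2) by (auto simp: A_def)
    then have Tc: "compact T" "T \<subseteq> U"
      using T(1) C compact_Int_closed[OF C(1) T(1)] by (auto simp: inf.absorb2)
    have [measurable]: "T \<in> sets borel" using T by auto
    have "integrable lborel (\<lambda>x. indicator T x *\<^sub>R g (x + 0))"
      using Tc by (intro integrable_bounded_mult[OF _ g Tc(1), where M=1]) auto
    then have int: "integrable lborel (\<lambda>x. g x * indicator T x)" by (simp add: mult.commute)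
    have "0 \<le> g x * indicator T x" for x using T(2) by (auto simp: A_def split: split_indicator)
    then have "AE x in lborel. g x * indicator T x = 0"
      using integral_nonneg_eq_0_iff_AE[OF int] 0[OF Tc] by auto
    then have "AE x in lborel. x \<notin> T"
      by eventually_elim (use T(2) in \<open>auto simp: A_def split: split_indicator_asm\<close>)
    then have "emeasure lborel T = 0"
      by (subst (asm) AE_iff_measurable[of T]) auto
    then have "emeasure lborel A = emeasure lborel (A - T)"
      by (subst emeasure_Diff) (use T in auto)
    also have "\<dots> = emeasure lebesgue (A - T)" by simp
    finally show ?thesis using T(3) by simp
  qed
  then have "emeasure lborel A \<le> 0 + ennreal e" if "e > 0" for e using that by simp
  then have "emeasure lborel A \<le> 0" by (rule ennreal_le_epsilon)
  then show ?thesis by (simp add: A_def)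
qed

theorem fundamental_lemma:
  fixes g :: "'a::euclidean_space \<Rightarrow> real"
  assumes g: "loc_pow 1 U g" and U: "open U"
    and 0: "\<And>\<psi>. \<psi> \<in> test_functions U \<Longrightarrow> (\<integral>x. g x * \<psi> x \<partial>lborel) = 0"
  shows "AE x in lborel. x \<in> U \<longrightarrow> g x = 0"
proof -
  have [measurable]: "g \<in> borel_measurable borel" using g by (rule loc_powD)
  obtain C where C: "\<And>n. compact (C n)" "\<And>n. C n \<subseteq> U" "(\<Union>n::nat. C n) = U"
    using open_Union_compact_subsets[OF U] by metis
  have [measurable]: "C n \<in> sets borel" for n using C by (auto intro: borel_compact)
  have i0: "(\<integral>x. g x * indicator K x \<partial>lborel) = 0" if "compact K" "K \<subseteq> U" for K
    by (rule integral_compact_eq_0[OF g U 0 that])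
  have "loc_pow 1 U (\<lambda>x. - g x)" using g by (simp add: loc_pow_def)
  then have "emeasure lborel {x\<in>C n. - g x > 0} = 0" for n
    by (rule null_positive_part) (use C i0 in auto)
  moreover have "emeasure lborel {x\<in>C n. g x > 0} = 0" for n
    by (rule null_positive_part[OF g]) (use C i0 in auto)
  ultimately have "AE x in lborel. \<not> (x \<in> C n \<and> - g x > 0)" "AE x in lborel. \<not> (x \<in> C n \<and> g x > 0)" for n
    by (auto simp: AE_iff_measurable[of "{x\<in>C n. - g x > 0}"] AE_iff_measurable[of "{x\<in>C n. g x > 0}"])
  then have "AE x in lborel. \<forall>n. \<not> (x \<in> C n \<and> - g x > 0) \<and> \<not> (x \<in> C n \<and> g x > 0)"
    unfolding AE_all_countable by (auto intro: AE_conjI)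
  then show ?thesis
    by eventually_elim (use C(3) in fastforce)
qed

section \<open>Difference quotients of weakly differentiable functions\<close>

text \<open>The vector form of the defining identity of a weak gradient, for Borel functions and Borel measure.\<close>

definition wgrad :: "'a::euclidean_space set \<Rightarrow> ('a \<Rightarrow> real) \<Rightarrow> ('a \<Rightarrow> 'a) \<Rightarrow> bool" where
  "wgrad \<Omega> u G \<longleftrightarrow> (\<forall>\<psi>\<in>test_functions \<Omega>.
     (\<integral>x. u x *\<^sub>R grad \<psi> x \<partial>lborel) = - (\<integral>x. \<psi> x *\<^sub>R G x \<partial>lborel))"

lemma integrable_test:
  fixes v :: "'a::euclidean_space \<Rightarrow> 'b::euclidean_space" and u :: "'a \<Rightarrow> real"
  assumes psi: "\<psi> \<in> test_functions U" and c: "\<And>x. x \<in> U \<Longrightarrow> x + c \<in> \<Omega>"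
  shows "loc_pow 1 \<Omega> v \<Longrightarrow> integrable lborel (\<lambda>x. \<psi> x *\<^sub>R v (x + c))"
    and "loc_pow 1 \<Omega> u \<Longrightarrow> integrable lborel (\<lambda>x. u (x + c) *\<^sub>R grad \<psi> x)"
proof -
  obtain S M where S: "compact S" "S \<subseteq> U" "\<And>x. x \<notin> S \<Longrightarrow> \<psi> x = 0" "\<And>x. x \<notin> S \<Longrightarrow> grad \<psi> x = 0"
    "M \<ge> 0" "\<And>x. \<bar>\<psi> x\<bar> \<le> M" "\<And>x. norm (grad \<psi> x) \<le> M"
    by (rule test_functionsE[OF psi]) blast
  note [measurable] = test_function_props(4,5)[OF psi]
  show "integrable lborel (\<lambda>x. \<psi> x *\<^sub>R v (x + c))" if v: "loc_pow 1 \<Omega> v"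
    by (rule integrable_bounded_mult[OF _ v S(1) S(3) S(6)]) (use S c in auto)
  show "integrable lborel (\<lambda>x. u (x + c) *\<^sub>R grad \<psi> x)" if u: "loc_pow 1 \<Omega> u"
  proof (rule integrable_dominated[OF _ u S(1), where M=M and c=c])
    have [measurable]: "u \<in> borel_measurable borel" using u by (rule loc_powD)
    show "(\<lambda>x. u (x + c) *\<^sub>R grad \<psi> x) \<in> borel_measurable borel" by measurable
    show "norm (u (x + c) *\<^sub>R grad \<psi> x) \<le> M * norm (u (x + c))" for x
      using mult_left_mono[OF S(7)[of x], of "\<bar>u (x + c)\<bar>"] by (simp add: mult.commute)
  qed (use S c in auto)
qed

lemma wgrad_inner:
  assumes W: "wgrad \<Omega> u G" and u: "loc_pow 1 \<Omega> u" and G: "loc_pow 1 \<Omega> G" and psi: "\<psi> \<in> test_functions \<Omega>"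
  shows "(\<integral>x. u x * (grad \<psi> x \<bullet> h) \<partial>lborel) = - (\<integral>x. \<psi> x * (G x \<bullet> h) \<partial>lborel)"
proof -
  have i: "integrable lborel (\<lambda>x. u x *\<^sub>R grad \<psi> x)" "integrable lborel (\<lambda>x. \<psi> x *\<^sub>R G x)"
    using integrable_test(2)[OF psi, of 0 \<Omega> u] integrable_test(1)[OF psi, of 0 \<Omega> G] u G by auto
  have "(\<integral>x. u x * (grad \<psi> x \<bullet> h) \<partial>lborel) = (\<integral>x. (u x *\<^sub>R grad \<psi> x) \<bullet> h \<partial>lborel)" by simp
  also have "\<dots> = (\<integral>x. u x *\<^sub>R grad \<psi> x \<partial>lborel) \<bullet> h" using i by (intro integral_inner_left) auto
  also have "\<dots> = - ((\<integral>x. \<psi> x *\<^sub>R G x \<partial>lborel) \<bullet> h)" using W psi by (simp add: wgrad_def)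
  also have "(\<integral>x. \<psi> x *\<^sub>R G x \<partial>lborel) \<bullet> h = (\<integral>x. (\<psi> x *\<^sub>R G x) \<bullet> h \<partial>lborel)"
    using i by (intro integral_inner_left[symmetric]) auto
  finally show ?thesis by simp
qed

text \<open>For \<open>m = \<bar>\<integral> a\<bar>\<close> Young's inequality gives
  \<open>m powr (q - 1) * \<bar>a s\<bar> \<le> \<bar>a s\<bar> powr q / q + (1 - 1 / q) * m powr q\<close>; integrating over \<open>s\<close> and cancelling
  yields the claim. The statement in extended reals makes it hold also when \<open>a\<close> is not integrable,
  since the integral on the left is then zero.\<close>

lemma jensen_unit_interval:
  fixes a :: "real \<Rightarrow> real"
  assumes [measurable]: "a \<in> borel_measurable borel" and q: "q > 1"
  shows "ennreal (\<bar>\<integral>s. indicator {0..1} s * a s \<partial>lborel\<bar> powr q) \<le> (\<integral>\<^sup>+s\<in>{0..1}. ennreal (\<bar>a s\<bar> powr q) \<partial>lborel)"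
proof -
  define m where "m = \<bar>\<integral>s. indicator {0..1} s * a s \<partial>lborel\<bar>"
  show ?thesis
  proof (cases "m = 0 \<or> (\<integral>\<^sup>+s\<in>{0..1}. ennreal (\<bar>a s\<bar> powr q) \<partial>lborel) = \<infinity>")
    case True
    then show ?thesis unfolding m_def[symmetric] by auto
  next
    case False
    then have m: "m > 0" by (simp add: m_def)
    have int: "integrable lborel (\<lambda>s. indicator {0..1} s * a s)"
      using False not_integrable_integral_eq[of lborel "\<lambda>s. indicator {0..1} s * a s"] by (auto simp: m_def)
    have nn: "(\<integral>\<^sup>+s\<in>{0..1}. ennreal (\<bar>a s\<bar> powr q) \<partial>lborel) = (\<integral>\<^sup>+s. ennreal (indicator {0..1} s * \<bar>a s\<bar> powr q) \<partial>lborel)"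
      by (intro nn_integral_cong) (auto split: split_indicator)
    have intq: "integrable lborel (\<lambda>s. indicator {0..1} s * \<bar>a s\<bar> powr q)"
      using False nn by (intro integrableI_nonneg) (auto simp: less_top)
    define I where "I = (\<integral>s. indicator {0..1} s * \<bar>a s\<bar> powr q \<partial>lborel)"
    have young: "m powr (q - 1) * t \<le> t powr q / q + m powr q * (1 - 1 / q)" if "t \<ge> 0" for t
    proof -
      have "t * m powr (q - 1) \<le> t powr q / q + (m powr (q - 1)) powr (q / (q - 1)) / (q / (q - 1))"
        using q that m by (intro Youngs_inequality) (auto simp: field_simps)
      moreover have "(m powr (q - 1)) powr (q / (q - 1)) = m powr q" using q by (simp add: powr_powr)
      moreover have "m powr q / (q / (q - 1)) = m powr q * (1 - 1 / q)" using q by (simp add: field_simps)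
      ultimately show ?thesis by (simp add: mult.commute)
    qed
    have i1: "integrable lborel (\<lambda>s::real. indicator {0..1} s :: real)" by simp
    have "m \<le> (\<integral>s. \<bar>indicator {0..1} s * a s\<bar> \<partial>lborel)"
      unfolding m_def by (rule integral_abs_bound)
    then have "m powr (q - 1) * m \<le> m powr (q - 1) * (\<integral>s. \<bar>indicator {0..1} s * a s\<bar> \<partial>lborel)"
      by (intro mult_left_mono) auto
    also have "\<dots> = (\<integral>s. m powr (q - 1) * \<bar>indicator {0..1} s * a s\<bar> \<partial>lborel)" by simp
    also have "\<dots> \<le> (\<integral>s. (indicator {0..1} s * \<bar>a s\<bar> powr q) / q + indicator {0..1} s * (m powr q * (1 - 1 / q)) \<partial>lborel)"
    proof (rule integral_mono)
      show "integrable lborel (\<lambda>s. m powr (q - 1) * \<bar>indicator {0..1} s * a s\<bar>)"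
        using int by (intro integrable_mult_right integrable_abs)
      show "integrable lborel (\<lambda>s. (indicator {0..1} s * \<bar>a s\<bar> powr q) / q + indicator {0..1} s * (m powr q * (1 - 1 / q)))"
        using intq i1 by (intro Bochner_Integration.integrable_add integrable_divide integrable_mult_left)
    qed (use young in \<open>auto split: split_indicator\<close>)
    also have "\<dots> = I / q + m powr q * (1 - 1 / q)"
      using intq i1 unfolding I_def
      by (subst Bochner_Integration.integral_add) (auto intro: integrable_divide integrable_mult_left)
    finally have "m powr (q - 1) * m \<le> I / q + m powr q * (1 - 1 / q)" .
    moreover have "m powr (q - 1) * m = m powr q" using powr_add_1[of m "q - 1"] m q by simp
    ultimately have "m powr q / q \<le> I / q" by (simp add: algebra_simps)
    then have "m powr q \<le> I" using q by (simp add: divide_le_cancel)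
    then have "ennreal (m powr q) \<le> ennreal I" by (rule ennreal_leI)
    also have "\<dots> = (\<integral>\<^sup>+s\<in>{0..1}. ennreal (\<bar>a s\<bar> powr q) \<partial>lborel)"
      unfolding nn I_def using intq by (intro nn_integral_eq_integral[symmetric]) auto
    finally show ?thesis by (simp add: m_def)
  qed
qed

lemma nn_integral_segment:
  fixes f :: "'a::euclidean_space \<Rightarrow> real"
  assumes [measurable]: "f \<in> borel_measurable borel" "T \<in> sets borel"
    and seg: "\<And>x s. x \<in> K \<Longrightarrow> 0 \<le> s \<Longrightarrow> s \<le> 1 \<Longrightarrow> x + s *\<^sub>R h \<in> T"
  shows "(\<integral>\<^sup>+s\<in>{0..1}. (\<integral>\<^sup>+x\<in>K. ennreal (f (x + s *\<^sub>R h)) \<partial>lborel) \<partial>lborel) \<le> (\<integral>\<^sup>+x\<in>T. ennreal (f x) \<partial>lborel)"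
proof -
  have "(\<integral>\<^sup>+s\<in>{0..1}. (\<integral>\<^sup>+x\<in>K. ennreal (f (x + s *\<^sub>R h)) \<partial>lborel) \<partial>lborel)
    \<le> (\<integral>\<^sup>+s. (\<integral>\<^sup>+x\<in>T. ennreal (f x) \<partial>lborel) * indicator {0..1::real} s \<partial>lborel)"
  proof (rule nn_integral_mono)
    fix s :: real
    show "(\<integral>\<^sup>+x\<in>K. ennreal (f (x + s *\<^sub>R h)) \<partial>lborel) * indicator {0..1} s
       \<le> (\<integral>\<^sup>+x\<in>T. ennreal (f x) \<partial>lborel) * indicator {0..1} s"
    proof (cases "s \<in> {0..1}")
      case True
      then have "(\<integral>\<^sup>+x\<in>K. ennreal (f (x + s *\<^sub>R h)) \<partial>lborel) \<le> (\<integral>\<^sup>+x\<in>T. ennreal (f x) \<partial>lborel)"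
        using seg by (intro nn_integral_translate_set) auto
      then show ?thesis by (rule mult_right_mono) simp
    qed simp
  qed
  also have "\<dots> = (\<integral>\<^sup>+x\<in>T. ennreal (f x) \<partial>lborel)"
    by (subst nn_integral_cmult_indicator) auto
  finally show ?thesis .
qed

lemma compact_segments: "compact K \<Longrightarrow> compact ((\<lambda>(x, s). x + s *\<^sub>R h) ` (K \<times> {0..1}))"
  for K :: "'a::euclidean_space set"
  by (intro compact_continuous_image compact_Times compact_Icc)
     (auto intro!: continuous_intros simp: case_prod_unfold)

text \<open>Provides the hypothesis of Fubini's theorem for both double integrals in the difference formula:
  the first has \<open>k = h\<close>, the second \<open>k = 0\<close>.\<close>

lemma integrable_segment_dominated:
  fixes F :: "'a::euclidean_space \<Rightarrow> real \<Rightarrow> real" and v :: "'a \<Rightarrow> 'b::euclidean_space"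
  assumes F: "case_prod F \<in> borel_measurable (lborel \<Otimes>\<^sub>M lborel)"
    and v: "loc_pow 1 \<Omega> v" and S: "compact S" and M: "M \<ge> 0"
    and seg: "\<And>x s. x \<in> S \<Longrightarrow> 0 \<le> s \<Longrightarrow> s \<le> 1 \<Longrightarrow> x + s *\<^sub>R k \<in> \<Omega>"
    and le: "\<And>x s. \<bar>F x s\<bar> \<le> M * norm (v (x + s *\<^sub>R k)) * (indicator S x * indicator {0..1} s)"
  shows "integrable (lborel \<Otimes>\<^sub>M lborel) (case_prod F)"
proof (rule integrableI_bounded[OF F])
  note [measurable] = F
  define T where "T = (\<lambda>(x, s). x + s *\<^sub>R k) ` (S \<times> {0..1})"
  have T: "compact T" unfolding T_def by (rule compact_segments[OF S])
  have T': "T \<subseteq> \<Omega>" using seg by (auto simp: T_def)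
  have [measurable]: "v \<in> borel_measurable borel" "S \<in> sets borel" "T \<in> sets borel"
    using v S T by (auto intro: loc_powD borel_compact)
  have "(\<lambda>z. ennreal (norm (case_prod F z))) \<in> borel_measurable (lborel \<Otimes>\<^sub>M lborel)" by measurable
  from lborel_pair.nn_integral_snd[OF this]
  have "(\<integral>\<^sup>+z. ennreal (norm (case_prod F z)) \<partial>(lborel \<Otimes>\<^sub>M lborel))
     = (\<integral>\<^sup>+s. (\<integral>\<^sup>+x. ennreal (norm (F x s)) \<partial>lborel) \<partial>lborel)" by simp
  also have "\<dots> \<le> (\<integral>\<^sup>+s. (\<integral>\<^sup>+x. ennreal M * (ennreal (norm (v (x + s *\<^sub>R k))) * indicator S x * indicator {0..1} s) \<partial>lborel) \<partial>lborel)"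
  proof (intro nn_integral_mono)
    fix s x
    show "ennreal (norm (F x s)) \<le> ennreal M * (ennreal (norm (v (x + s *\<^sub>R k))) * indicator S x * indicator {0..1} s)"
      using le[of x s] M
      by (cases "x \<in> S"; cases "s \<in> {0..1}") (auto simp: ennreal_mult[symmetric] ennreal_leI)
  qed
  also have "\<dots> = ennreal M * (\<integral>\<^sup>+s\<in>{0..1}. (\<integral>\<^sup>+x\<in>S. ennreal (norm (v (x + s *\<^sub>R k))) \<partial>lborel) \<partial>lborel)"
    by (simp add: nn_integral_cmult nn_integral_multc)
  also have "\<dots> \<le> ennreal M * (\<integral>\<^sup>+x\<in>T. ennreal (norm (v x)) \<partial>lborel)"
    by (intro mult_left_mono nn_integral_segment) (use \<open>T \<in> sets borel\<close> in \<open>auto simp: T_def\<close>)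
  also have "\<dots> < \<infinity>" using loc_powD(2)[OF v T T'] by (simp add: ennreal_mult_less_top less_top)
  finally show "(\<integral>\<^sup>+z. ennreal (norm (case_prod F z)) \<partial>(lborel \<Otimes>\<^sub>M lborel)) < \<infinity>" .
qed

text \<open>For a continuously differentiable \<open>u\<close> with gradient \<open>G\<close> this would be \<open>u (x + h) - u x\<close>.\<close>

definition segment_mean :: "('a::euclidean_space \<Rightarrow> 'a) \<Rightarrow> 'a \<Rightarrow> 'a \<Rightarrow> real" where
  "segment_mean G h x = (\<integral>s. indicator {0..1} s * (G (x + s *\<^sub>R h) \<bullet> h) \<partial>lborel)"

lemma borel_measurable_segment_mean [measurable]:
  assumes [measurable]: "G \<in> borel_measurable borel"
  shows "segment_mean G h \<in> borel_measurable borel"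
  unfolding segment_mean_def by measurable

lemma segment_mean_pow:
  fixes G :: "'a::euclidean_space \<Rightarrow> 'a"
  assumes [measurable]: "G \<in> borel_measurable borel" "T \<in> sets borel" "K \<in> sets borel" and q: "q > 1"
    and seg: "\<And>x s. x \<in> K \<Longrightarrow> 0 \<le> s \<Longrightarrow> s \<le> 1 \<Longrightarrow> x + s *\<^sub>R h \<in> T"
  shows "(\<integral>\<^sup>+x\<in>K. ennreal (\<bar>segment_mean G h x\<bar> powr q) \<partial>lborel)
     \<le> ennreal (norm h powr q) * (\<integral>\<^sup>+x\<in>T. ennreal (norm (G x) powr q) \<partial>lborel)"
proof -
  have "(\<integral>\<^sup>+x\<in>K. ennreal (\<bar>segment_mean G h x\<bar> powr q) \<partial>lborel)
     \<le> (\<integral>\<^sup>+x. (\<integral>\<^sup>+s. ennreal (norm h powr q) * (ennreal (norm (G (x + s *\<^sub>R h)) powr q) * indicator K x * indicator {0..1} s) \<partial>lborel) \<partial>lborel)"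
  proof (rule nn_integral_mono)
    fix x
    have "ennreal (\<bar>segment_mean G h x\<bar> powr q) \<le> (\<integral>\<^sup>+s\<in>{0..1}. ennreal (\<bar>G (x + s *\<^sub>R h) \<bullet> h\<bar> powr q) \<partial>lborel)"
      unfolding segment_mean_def by (rule jensen_unit_interval[OF _ q]) measurable
    also have "\<dots> \<le> (\<integral>\<^sup>+s. ennreal (norm h powr q) * (ennreal (norm (G (x + s *\<^sub>R h)) powr q) * indicator {0..1} s) \<partial>lborel)"
    proof (rule nn_integral_mono)
      fix s :: real
      have "\<bar>G (x + s *\<^sub>R h) \<bullet> h\<bar> powr q \<le> (norm h * norm (G (x + s *\<^sub>R h))) powr q"
        using Cauchy_Schwarz_ineq2[of "G (x + s *\<^sub>R h)" h] q by (intro powr_mono2) (auto simp: mult.commute)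
      then have "ennreal (\<bar>G (x + s *\<^sub>R h) \<bullet> h\<bar> powr q) \<le> ennreal (norm h powr q) * ennreal (norm (G (x + s *\<^sub>R h)) powr q)"
        by (simp add: powr_mult ennreal_mult[symmetric] ennreal_leI)
      then show "ennreal (\<bar>G (x + s *\<^sub>R h) \<bullet> h\<bar> powr q) * indicator {0..1} s
        \<le> ennreal (norm h powr q) * (ennreal (norm (G (x + s *\<^sub>R h)) powr q) * indicator {0..1} s)"
        by (simp add: mult.assoc[symmetric] mult_right_mono)
    qed
    finally show "ennreal (\<bar>segment_mean G h x\<bar> powr q) * indicator K x \<le>
        (\<integral>\<^sup>+s. ennreal (norm h powr q) * (ennreal (norm (G (x + s *\<^sub>R h)) powr q) * indicator K x * indicator {0..1} s) \<partial>lborel)"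
      by (cases "x \<in> K") auto
  qed
  also have "\<dots> = (\<integral>\<^sup>+s. (\<integral>\<^sup>+x. ennreal (norm h powr q) * (ennreal (norm (G (x + s *\<^sub>R h)) powr q) * indicator K x * indicator {0..1} s) \<partial>lborel) \<partial>lborel)"
    by (rule lborel_pair.Fubini') measurable
  also have "\<dots> = (\<integral>\<^sup>+s. ennreal (norm h powr q) * ((\<integral>\<^sup>+x\<in>K. ennreal (norm (G (x + s *\<^sub>R h)) powr q) \<partial>lborel) * indicator {0..1} s) \<partial>lborel)"
    by (intro nn_integral_cong) (simp add: nn_integral_cmult nn_integral_multc)
  also have "\<dots> = ennreal (norm h powr q) * (\<integral>\<^sup>+s\<in>{0..1}. (\<integral>\<^sup>+x\<in>K. ennreal (norm (G (x + s *\<^sub>R h)) powr q) \<partial>lborel) \<partial>lborel)"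
    by (rule nn_integral_cmult) measurable
  also have "\<dots> \<le> ennreal (norm h powr q) * (\<integral>\<^sup>+x\<in>T. ennreal (norm (G x) powr q) \<partial>lborel)"
    using seg by (intro mult_left_mono nn_integral_segment) auto
  finally show ?thesis .
qed

lemma line_integral_test_function:
  fixes \<psi> :: "'a::euclidean_space \<Rightarrow> real"
  assumes psi: "\<psi> \<in> test_functions U"
  shows "(\<integral>s. indicator {0..1} s * (grad \<psi> (x - s *\<^sub>R h) \<bullet> h) \<partial>lborel) = \<psi> x - \<psi> (x - h)"
proof -
  have "(\<integral>s. indicator {0..1} s *\<^sub>R (grad \<psi> (x - s *\<^sub>R h) \<bullet> h) \<partial>lborel)
      = (- \<psi> (x - 1 *\<^sub>R h)) - (- \<psi> (x - 0 *\<^sub>R h))"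
  proof (rule integral_FTC_atLeastAtMost)
    show "continuous_on {0..1} (\<lambda>s. grad \<psi> (x - s *\<^sub>R h) \<bullet> h)"
      by (intro continuous_intros continuous_on_compose2[OF test_function_props(3)[OF psi]]) auto
    fix s :: real
    have "((\<lambda>s. x - s *\<^sub>R h) has_derivative (\<lambda>r. - (r *\<^sub>R h))) (at s within {0..1})"
      by (auto intro!: derivative_eq_intros)
    from has_derivative_minus[OF has_derivative_compose[OF this test_function_props(6)[OF psi]]]
    show "((\<lambda>s. - \<psi> (x - s *\<^sub>R h)) has_vector_derivative grad \<psi> (x - s *\<^sub>R h) \<bullet> h) (at s within {0..1})"
      unfolding has_vector_derivative_def by simp
  qed simp
  then show ?thesis by simp
qed

text \<open>Tested with \<open>\<psi>\<close>, the integral along the segment becomes by Fubini an average over \<open>s\<close> of integrals of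
  \<open>G \<bullet> h\<close> against \<open>\<psi>\<close> translated by \<open>s h\<close>. The definition of the weak gradient and a second use of Fubini
  turn these into the integral of \<open>u\<close> against the line integral of the gradient of \<open>\<psi>\<close>, which the
  fundamental theorem of calculus evaluates to \<open>\<psi> x - \<psi> (x - h)\<close>.\<close>

lemma difference_formula:
  fixes G :: "'a::euclidean_space \<Rightarrow> 'a"
  assumes u: "loc_pow q \<Omega> u" and G: "loc_pow q \<Omega> G" and q: "q > 1" and W: "wgrad \<Omega> u G" and U: "open U"
    and seg: "\<And>x s. x \<in> U \<Longrightarrow> 0 \<le> s \<Longrightarrow> s \<le> 1 \<Longrightarrow> x + s *\<^sub>R h \<in> \<Omega>"
  shows "AE x in lborel. x \<in> U \<longrightarrow> u (x + h) - u x = segment_mean G h x"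
proof -
  have u1: "loc_pow 1 \<Omega> u" and G1: "loc_pow 1 \<Omega> G"
    using q by (auto intro: loc_pow_mono[OF u] loc_pow_mono[OF G])
  have [measurable]: "u \<in> borel_measurable borel" "G \<in> borel_measurable borel"
    using u G by (auto intro: loc_powD)
  have J: "loc_pow q U (segment_mean G h)"
    unfolding loc_pow_def
  proof safe
    fix K assume K: "compact K" "K \<subseteq> U"
    define T where "T = (\<lambda>(x, s). x + s *\<^sub>R h) ` (K \<times> {0..1})"
    have T: "compact T" unfolding T_def by (rule compact_segments[OF K(1)])
    have T': "T \<subseteq> \<Omega>" using seg K by (auto simp: T_def)
    have "(\<integral>\<^sup>+x\<in>K. ennreal (\<bar>segment_mean G h x\<bar> powr q) \<partial>lborel)
     \<le> ennreal (norm h powr q) * (\<integral>\<^sup>+x\<in>T. ennreal (norm (G x) powr q) \<partial>lborel)"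
      using q T K by (intro segment_mean_pow) (auto intro: borel_compact simp: T_def)
    also have "\<dots> < \<infinity>" using loc_powD(2)[OF G T T'] by (simp add: ennreal_mult_less_top less_top)
    finally show "(\<integral>\<^sup>+x\<in>K. ennreal (norm (segment_mean G h x) powr q) \<partial>lborel) < \<infinity>" by simp
  qed measurable
  have J1: "loc_pow 1 U (segment_mean G h)" using q by (auto intro: loc_pow_mono[OF J])
  have U0: "U \<subseteq> \<Omega>" using seg[of _ 0] by auto
  have U1: "x + h \<in> \<Omega>" if "x \<in> U" for x using seg[OF that, of 1] by simp
  have "AE x in lborel. x \<in> U \<longrightarrow> u (x + h) - u x - segment_mean G h x = 0"
  proof (rule fundamental_lemma[OF _ U])
    show "loc_pow 1 U (\<lambda>x. u (x + h) - u x - segment_mean G h x)"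
      using loc_pow_translate[OF u1, of U h] loc_pow_translate[OF u1, of U 0] U0 U1
      by (intro loc_pow_diff J1) auto
    fix \<psi> assume psi: "\<psi> \<in> test_functions U"
    obtain S M where S: "compact S" "S \<subseteq> U" "\<And>x. x \<notin> S \<Longrightarrow> \<psi> x = 0" "\<And>x. x \<notin> S \<Longrightarrow> grad \<psi> x = 0"
      "M \<ge> 0" "\<And>x. \<bar>\<psi> x\<bar> \<le> M" "\<And>x. norm (grad \<psi> x) \<le> M"
      by (rule test_functionsE[OF psi]) blast
    note [measurable] = test_function_props(4,5)[OF psi]
    define T where "T = (\<lambda>(x, s). x + s *\<^sub>R h) ` (S \<times> {0..1})"
    have T: "compact T" unfolding T_def by (rule compact_segments[OF S(1)])
    have T': "T \<subseteq> \<Omega>" using seg S by (auto simp: T_def)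
    \<comment> \<open>The integrands of the two double integrals, before and after integrating by parts in \<open>x\<close>.\<close>
    define F1 where "F1 x s = \<psi> x * (indicator {0..1} s * (G (x + s *\<^sub>R h) \<bullet> h))" for x s
    define F2 where "F2 x s = u x * (indicator {0..1} s * (grad \<psi> (x - s *\<^sub>R h) \<bullet> h))" for x s
    have F1: "integrable (lborel \<Otimes>\<^sub>M lborel) (case_prod F1)"
    proof (rule integrable_segment_dominated[OF _ G1 S(1), where k=h and M="M * norm h"])
      show "case_prod F1 \<in> borel_measurable (lborel \<Otimes>\<^sub>M lborel)" unfolding F1_def by measurable
      fix x s
      have "\<bar>\<psi> x\<bar> * \<bar>G (x + s *\<^sub>R h) \<bullet> h\<bar> \<le> M * (norm (G (x + s *\<^sub>R h)) * norm h)"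
        using S by (intro mult_mono Cauchy_Schwarz_ineq2) auto
      then show "\<bar>F1 x s\<bar> \<le> M * norm h * norm (G (x + s *\<^sub>R h)) * (indicator S x * indicator {0..1} s)"
        using S(3)[of x] by (cases "x \<in> S"; cases "s \<in> {0..1}") (auto simp: F1_def abs_mult mult_ac)
    qed (use S seg in auto)
    have supp: "grad \<psi> (x - s *\<^sub>R h) = 0" if "x \<notin> T" "0 \<le> s" "s \<le> 1" for x s
      using that by (intro S(4)) (force simp: T_def)
    have F2: "integrable (lborel \<Otimes>\<^sub>M lborel) (case_prod F2)"
    proof (rule integrable_segment_dominated[OF _ u1 T, where k=0 and M="M * norm h"])
      show "case_prod F2 \<in> borel_measurable (lborel \<Otimes>\<^sub>M lborel)" unfolding F2_def by measurable
      fix x s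
      have "\<bar>grad \<psi> (x - s *\<^sub>R h) \<bullet> h\<bar> \<le> norm (grad \<psi> (x - s *\<^sub>R h)) * norm h" by (rule Cauchy_Schwarz_ineq2)
      also have "\<dots> \<le> M * norm h" using S by (intro mult_right_mono) auto
      finally have "\<bar>u x\<bar> * \<bar>grad \<psi> (x - s *\<^sub>R h) \<bullet> h\<bar> \<le> \<bar>u x\<bar> * (M * norm h)" by (rule mult_left_mono) simp
      then show "\<bar>F2 x s\<bar> \<le> M * norm h * norm (u (x + s *\<^sub>R 0)) * (indicator T x * indicator {0..1} s)"
        using supp[of x s] by (cases "x \<in> T"; cases "s \<in> {0..1}") (auto simp: F2_def abs_mult mult_ac)
    qed (use S T' in auto)
    have "(\<integral>x. \<psi> x * segment_mean G h x \<partial>lborel) = (\<integral>x. (\<integral>s. F1 x s \<partial>lborel) \<partial>lborel)"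
      by (simp add: F1_def segment_mean_def)
    also have "\<dots> = (\<integral>s. (\<integral>x. F1 x s \<partial>lborel) \<partial>lborel)"
      by (rule lborel_pair.Fubini_integral[OF F1, symmetric])
    also have "\<dots> = (\<integral>s. - (\<integral>x. F2 x s \<partial>lborel) \<partial>lborel)"
    proof (rule Bochner_Integration.integral_cong[OF refl])
      fix s :: real
      show "(\<integral>x. F1 x s \<partial>lborel) = - (\<integral>x. F2 x s \<partial>lborel)"
      proof (cases "s \<in> {0..1}")
        case True
        define c where "c = - (s *\<^sub>R h)"
        have psi': "(\<lambda>x. \<psi> (x + c)) \<in> test_functions \<Omega>"
          by (rule test_functions_translate[OF psi _ S(1)]) (use S seg True in \<open>auto simp: c_def\<close>)
        have gr: "grad (\<lambda>x. \<psi> (x + c)) x = grad \<psi> (x + c)" for x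
          using test_function_props(6)[OF psi] by (intro grad_translate) (auto simp: differentiable_def)
        have "(\<integral>x. F1 x s \<partial>lborel) = (\<integral>x. (\<lambda>y. \<psi> (y + c) * (G y \<bullet> h)) (x + s *\<^sub>R h) \<partial>lborel)"
          using True by (simp add: F1_def c_def)
        also have "\<dots> = (\<integral>x. \<psi> (x + c) * (G x \<bullet> h) \<partial>lborel)"
          by (rule lborel_integral_translate) measurable
        also have "\<dots> = - (\<integral>x. u x * (grad \<psi> (x + c) \<bullet> h) \<partial>lborel)"
          using wgrad_inner[OF W u1 G1 psi', of h] by (simp add: gr)
        finally show ?thesis using True by (simp add: F2_def c_def)
      qed (simp add: F1_def F2_def)
    qed
    also have "\<dots> = - (\<integral>s. (\<integral>x. F2 x s \<partial>lborel) \<partial>lborel)" by simp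
    also have "(\<integral>s. (\<integral>x. F2 x s \<partial>lborel) \<partial>lborel) = (\<integral>x. (\<integral>s. F2 x s \<partial>lborel) \<partial>lborel)"
      by (rule lborel_pair.Fubini_integral[OF F2])
    also have "\<dots> = (\<integral>x. u x * (\<psi> x - \<psi> (x - h)) \<partial>lborel)"
      by (simp add: F2_def line_integral_test_function[OF psi])
    finally have A: "(\<integral>x. \<psi> x * segment_mean G h x \<partial>lborel) = - (\<integral>x. u x * (\<psi> x - \<psi> (x - h)) \<partial>lborel)" .
    have psi0: "\<psi> \<in> test_functions \<Omega>" using psi U0 by (rule test_functions_mono)
    have psih: "(\<lambda>x. \<psi> (x + (- h))) \<in> test_functions \<Omega>"
      by (rule test_functions_translate[OF psi _ S(1)]) (use S U1 in auto)
    have i: "integrable lborel (\<lambda>x. \<psi> x * u x)" "integrable lborel (\<lambda>x. \<psi> (x - h) * u x)"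
       "integrable lborel (\<lambda>x. \<psi> x * u (x + h))" "integrable lborel (\<lambda>x. \<psi> x * segment_mean G h x)"
      using integrable_test(1)[OF psi0 _ u1, of 0] integrable_test(1)[OF psih _ u1, of 0]
        integrable_test(1)[OF psi _ u1, of h] integrable_test(1)[OF psi _ J1, of 0] U1 by auto
    have "(\<integral>x. u x * (\<psi> x - \<psi> (x - h)) \<partial>lborel) = (\<integral>x. \<psi> x * u x - \<psi> (x - h) * u x \<partial>lborel)"
      by (simp add: algebra_simps)
    also have "\<dots> = (\<integral>x. \<psi> x * u x \<partial>lborel) - (\<integral>x. \<psi> (x - h) * u x \<partial>lborel)"
      using i by (intro Bochner_Integration.integral_diff)
    also have "(\<integral>x. \<psi> (x - h) * u x \<partial>lborel) = (\<integral>x. \<psi> x * u (x + h) \<partial>lborel)"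
      using lborel_integral_translate[of "\<lambda>x. \<psi> (x - h) * u x" h] by simp
    finally have B: "(\<integral>x. \<psi> x * segment_mean G h x \<partial>lborel) = (\<integral>x. \<psi> x * u (x + h) \<partial>lborel) - (\<integral>x. \<psi> x * u x \<partial>lborel)"
      using A by simp
    have "(\<integral>x. (u (x + h) - u x - segment_mean G h x) * \<psi> x \<partial>lborel)
        = (\<integral>x. \<psi> x * u (x + h) - \<psi> x * u x - \<psi> x * segment_mean G h x \<partial>lborel)"
      by (simp add: algebra_simps)
    also have "\<dots> = 0" using i B by simp
    finally show "(\<integral>x. (u (x + h) - u x - segment_mean G h x) * \<psi> x \<partial>lborel) = 0" .
  qed
  then show ?thesis by eventually_elim auto
qed

theorem difference_quotient_bound:
  fixes G :: "'a::euclidean_space \<Rightarrow> 'a"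
  assumes u: "loc_pow q \<Omega> u" and G: "loc_pow q \<Omega> G" and q: "q > 1" and W: "wgrad \<Omega> u G"
    and K: "compact K" and T: "thicken K \<epsilon> \<subseteq> \<Omega>" and h: "norm h < \<epsilon>"
  shows "(\<integral>\<^sup>+x\<in>K. ennreal (\<bar>u (x + h) - u x\<bar> powr q) \<partial>lborel)
     \<le> ennreal (norm h powr q) * (\<integral>\<^sup>+x\<in>thicken K \<epsilon>. ennreal (norm (G x) powr q) \<partial>lborel)"
proof -
  have [measurable]: "G \<in> borel_measurable borel" "K \<in> sets borel" "thicken K \<epsilon> \<in> sets borel"
    using G K compact_thicken[OF K] by (auto intro: loc_powD borel_compact)
  \<comment> \<open>An open neighbourhood of \<open>K\<close> from which segments of direction \<open>h\<close> do not leave \<open>thicken K \<epsilon>\<close>.\<close>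
  define U where "U = (\<Union>x\<in>K. ball x (\<epsilon> - norm h))"
  have KU: "K \<subseteq> U" using h by (auto simp: U_def)
  have seg: "x + s *\<^sub>R h \<in> thicken K \<epsilon>" if x: "x \<in> U" and s: "0 \<le> s" "s \<le> 1" for x s
  proof -
    obtain y where y: "y \<in> K" "dist y x < \<epsilon> - norm h" using x by (auto simp: U_def)
    have "dist y (x + s *\<^sub>R h) \<le> dist y x + norm (s *\<^sub>R h)"
      by (metis add.commute add_diff_cancel_left' dist_norm dist_triangle dist_commute)
    also have "norm (s *\<^sub>R h) \<le> 1 * norm h" using s by (simp add: mult_left_le_one_le)
    finally show ?thesis using y unfolding thicken_iff by (intro bexI[of _ y]) auto
  qed
  have "AE x in lborel. x \<in> U \<longrightarrow> u (x + h) - u x = segment_mean G h x"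
    using seg T by (intro difference_formula[OF u G q W]) (auto simp: U_def)
  then have "AE x in lborel. ennreal (\<bar>u (x + h) - u x\<bar> powr q) * indicator K x
      = ennreal (\<bar>segment_mean G h x\<bar> powr q) * indicator K x"
    by eventually_elim (use KU in \<open>auto split: split_indicator\<close>)
  then have "(\<integral>\<^sup>+x\<in>K. ennreal (\<bar>u (x + h) - u x\<bar> powr q) \<partial>lborel) = (\<integral>\<^sup>+x\<in>K. ennreal (\<bar>segment_mean G h x\<bar> powr q) \<partial>lborel)"
    by (rule nn_integral_cong_AE)
  also have "\<dots> \<le> ennreal (norm h powr q) * (\<integral>\<^sup>+x\<in>thicken K \<epsilon>. ennreal (norm (G x) powr q) \<partial>lborel)"
    using q seg KU by (intro segment_mean_pow) auto
  finally show ?thesis .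
qed

section \<open>Weak gradients of truncated differences\<close>

lemma wgrad_mono: "wgrad V u G \<Longrightarrow> U \<subseteq> V \<Longrightarrow> wgrad U u G"
  unfolding wgrad_def using test_functions_mono by blast

lemma wgrad_translate:
  fixes u :: "'a::euclidean_space \<Rightarrow> real"
  assumes W: "wgrad UNIV u G" and u: "loc_pow 1 UNIV u" and G: "loc_pow 1 UNIV G"
  shows "wgrad UNIV (\<lambda>x. u (x + c)) (\<lambda>x. G (x + c))"
  unfolding wgrad_def
proof
  fix \<psi> :: "'a \<Rightarrow> real" assume psi: "\<psi> \<in> test_functions UNIV"
  have [measurable]: "u \<in> borel_measurable borel" "G \<in> borel_measurable borel" using u G by (auto intro: loc_powD)
  note [measurable] = test_function_props(4,5)[OF psi]
  obtain S M where S: "compact S" "S \<subseteq> UNIV" "\<And>x. x \<notin> S \<Longrightarrow> \<psi> x = 0" "\<And>x. x \<notin> S \<Longrightarrow> grad \<psi> x = 0"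
    "M \<ge> 0" "\<And>x. \<bar>\<psi> x\<bar> \<le> M" "\<And>x. norm (grad \<psi> x) \<le> M"
    by (rule test_functionsE[OF psi]) blast
  have psi': "(\<lambda>x. \<psi> (x + (- c))) \<in> test_functions UNIV"
    by (rule test_functions_translate[OF psi _ S(1)]) (use S in auto)
  have gr: "grad (\<lambda>x. \<psi> (x - c)) x = grad \<psi> (x - c)" for x
    using grad_translate[of \<psi> "- c" x] test_function_props(6)[OF psi] by (auto simp: differentiable_def)
  have "(\<integral>x. u (x + c) *\<^sub>R grad \<psi> x \<partial>lborel) = (\<integral>x. u x *\<^sub>R grad \<psi> (x - c) \<partial>lborel)"
    using lborel_integral_translate[of "\<lambda>x. u x *\<^sub>R grad \<psi> (x - c)" c] by simp
  also have "\<dots> = - (\<integral>x. \<psi> (x - c) *\<^sub>R G x \<partial>lborel)"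
    using bspec[OF W[unfolded wgrad_def] psi'] by (simp add: gr)
  also have "(\<integral>x. \<psi> (x - c) *\<^sub>R G x \<partial>lborel) = (\<integral>x. \<psi> x *\<^sub>R G (x + c) \<partial>lborel)"
    using lborel_integral_translate[of "\<lambda>x. \<psi> (x - c) *\<^sub>R G x" c] by simp
  finally show "(\<integral>x. u (x + c) *\<^sub>R grad \<psi> x \<partial>lborel) = - (\<integral>x. \<psi> x *\<^sub>R G (x + c) \<partial>lborel)" .
qed

lemma wgrad_diff:
  fixes u v :: "'a::euclidean_space \<Rightarrow> real"
  assumes W: "wgrad V u G" "wgrad V v H" and "loc_pow 1 V u" "loc_pow 1 V v" "loc_pow 1 V G" "loc_pow 1 V H"
  shows "wgrad V (\<lambda>x. u x - v x) (\<lambda>x. G x - H x)"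
  unfolding wgrad_def
proof
  fix \<psi> :: "'a \<Rightarrow> real" assume psi: "\<psi> \<in> test_functions V"
  have i: "integrable lborel (\<lambda>x. u x *\<^sub>R grad \<psi> x)" "integrable lborel (\<lambda>x. v x *\<^sub>R grad \<psi> x)"
    "integrable lborel (\<lambda>x. \<psi> x *\<^sub>R G x)" "integrable lborel (\<lambda>x. \<psi> x *\<^sub>R H x)"
    using integrable_test(2)[OF psi, of 0 V u] integrable_test(2)[OF psi, of 0 V v]
      integrable_test(1)[OF psi, of 0 V G] integrable_test(1)[OF psi, of 0 V H] assms by auto
  have "(\<integral>x. (u x - v x) *\<^sub>R grad \<psi> x \<partial>lborel) = (\<integral>x. u x *\<^sub>R grad \<psi> x \<partial>lborel) - (\<integral>x. v x *\<^sub>R grad \<psi> x \<partial>lborel)"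
    unfolding scaleR_left_diff_distrib by (rule Bochner_Integration.integral_diff[OF i(1,2)])
  also have "\<dots> = - ((\<integral>x. \<psi> x *\<^sub>R G x \<partial>lborel) - (\<integral>x. \<psi> x *\<^sub>R H x \<partial>lborel))"
    using W psi by (simp add: wgrad_def)
  also have "(\<integral>x. \<psi> x *\<^sub>R G x \<partial>lborel) - (\<integral>x. \<psi> x *\<^sub>R H x \<partial>lborel) = (\<integral>x. \<psi> x *\<^sub>R (G x - H x) \<partial>lborel)"
    unfolding scaleR_right_diff_distrib by (rule Bochner_Integration.integral_diff[OF i(3,4), symmetric])
  finally show "(\<integral>x. (u x - v x) *\<^sub>R grad \<psi> x \<partial>lborel) = - (\<integral>x. \<psi> x *\<^sub>R (G x - H x) \<partial>lborel)" .
qed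

lemma cutoff_translate_loc_pow:
  fixes u :: "'a::euclidean_space \<Rightarrow> real" and G :: "'a \<Rightarrow> 'a"
  assumes z: "\<zeta> \<in> test_functions U" and c: "\<And>x. x \<in> U \<Longrightarrow> x + c \<in> \<Omega>" and m: "m \<ge> 0"
    and u: "loc_pow m \<Omega> u" and G: "loc_pow m \<Omega> G"
  shows "loc_pow m V (\<lambda>x. \<zeta> x * u (x + c))"
    "loc_pow m V (\<lambda>x. \<zeta> x *\<^sub>R G (x + c) + u (x + c) *\<^sub>R grad \<zeta> x)"
proof -
  have [measurable]: "u \<in> borel_measurable borel" "G \<in> borel_measurable borel" using u G by (auto intro: loc_powD)
  note [measurable] = test_function_props(4,5)[OF z]
  obtain S M where S: "compact S" "S \<subseteq> U" "\<And>x. x \<notin> S \<Longrightarrow> \<zeta> x = 0" "\<And>x. x \<notin> S \<Longrightarrow> grad \<zeta> x = 0"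
    "M \<ge> 0" "\<And>x. \<bar>\<zeta> x\<bar> \<le> M" "\<And>x. norm (grad \<zeta> x) \<le> M"
    by (rule test_functionsE[OF z]) blast
  show "loc_pow m V (\<lambda>x. \<zeta> x * u (x + c))"
  proof (rule loc_pow_dominated[OF _ u m S(1), where M=M and c=c])
    show "(\<lambda>x. \<zeta> x * u (x + c)) \<in> borel_measurable borel" by measurable
  qed (use S c in \<open>auto simp: abs_mult intro!: mult_right_mono\<close>)
  have 1: "loc_pow m V (\<lambda>x. \<zeta> x *\<^sub>R G (x + c))"
  proof (rule loc_pow_dominated[OF _ G m S(1), where M=M and c=c])
    show "(\<lambda>x. \<zeta> x *\<^sub>R G (x + c)) \<in> borel_measurable borel" by measurable
  qed (use S c in \<open>auto simp: abs_mult intro!: mult_right_mono\<close>)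
  have 2: "loc_pow m V (\<lambda>x. u (x + c) *\<^sub>R grad \<zeta> x)"
  proof (rule loc_pow_dominated[OF _ u m S(1), where M=M and c=c])
    show "(\<lambda>x. u (x + c) *\<^sub>R grad \<zeta> x) \<in> borel_measurable borel" by measurable
    show "norm (u (x + c) *\<^sub>R grad \<zeta> x) \<le> M * norm (u (x + c))" for x
      using mult_left_mono[OF S(7)[of x], of "\<bar>u (x + c)\<bar>"] by (simp add: mult.commute)
  qed (use S c in auto)
  show "loc_pow m V (\<lambda>x. \<zeta> x *\<^sub>R G (x + c) + u (x + c) *\<^sub>R grad \<zeta> x)"
    by (rule loc_pow_add[OF 1 2 m])
qed

text \<open>Product rule and translation in one: the test function for \<open>u\<close> is the translate by \<open>- c\<close> of
  \<open>\<psi> * \<zeta>\<close>. Because \<open>\<zeta>\<close> has compact support, the resulting function may be tested on any \<open>V\<close>, which is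
  what later allows it to be translated freely.\<close>

lemma wgrad_cutoff_translate:
  fixes u :: "'a::euclidean_space \<Rightarrow> real"
  assumes W: "wgrad \<Omega> u G" and u: "loc_pow 1 \<Omega> u" and G: "loc_pow 1 \<Omega> G"
    and z: "\<zeta> \<in> test_functions U" and c: "\<And>x. x \<in> U \<Longrightarrow> x + c \<in> \<Omega>"
  shows "wgrad V (\<lambda>x. \<zeta> x * u (x + c)) (\<lambda>x. \<zeta> x *\<^sub>R G (x + c) + u (x + c) *\<^sub>R grad \<zeta> x)"
  unfolding wgrad_def
proof
  fix \<psi> :: "'a \<Rightarrow> real" assume psi: "\<psi> \<in> test_functions V"
  have [measurable]: "u \<in> borel_measurable borel" "G \<in> borel_measurable borel" using u G by (auto intro: loc_powD)
  note [measurable] = test_function_props(4,5)[OF psi] test_function_props(4,5)[OF z]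
  define \<chi>' where "\<chi>' x = \<psi> x * \<zeta> x" for x
  have chi: "\<chi>' \<in> test_functions U" and gr: "grad \<chi>' x = \<psi> x *\<^sub>R grad \<zeta> x + \<zeta> x *\<^sub>R grad \<psi> x" for x
    unfolding \<chi>'_def using test_functions_mult[OF z psi] by auto
  note [measurable] = test_function_props(4,5)[OF chi]
  obtain S M where S: "compact S" "S \<subseteq> U" "\<And>x. x \<notin> S \<Longrightarrow> \<chi>' x = 0"
    by (rule test_functionsE[OF chi]) blast
  have chi': "(\<lambda>x. \<chi>' (x + (- c))) \<in> test_functions \<Omega>"
    by (rule test_functions_translate[OF chi _ S(1)]) (use S c in auto)
  have gr': "grad (\<lambda>x. \<chi>' (x - c)) x = grad \<chi>' (x - c)" for x
    using grad_translate[of \<chi>' "- c" x] test_function_props(6)[OF chi] by (auto simp: differentiable_def)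
  have "(\<integral>x. u (x + c) *\<^sub>R grad \<chi>' x \<partial>lborel) = (\<integral>x. u x *\<^sub>R grad \<chi>' (x - c) \<partial>lborel)"
    using lborel_integral_translate[of "\<lambda>x. u x *\<^sub>R grad \<chi>' (x - c)" c] by simp
  also have "\<dots> = - (\<integral>x. \<chi>' (x - c) *\<^sub>R G x \<partial>lborel)"
    using bspec[OF W[unfolded wgrad_def] chi'] by (simp add: gr')
  also have "(\<integral>x. \<chi>' (x - c) *\<^sub>R G x \<partial>lborel) = (\<integral>x. \<chi>' x *\<^sub>R G (x + c) \<partial>lborel)"
    using lborel_integral_translate[of "\<lambda>x. \<chi>' (x - c) *\<^sub>R G x" c] by simp
  finally have A: "(\<integral>x. u (x + c) *\<^sub>R grad \<chi>' x \<partial>lborel) = - (\<integral>x. \<chi>' x *\<^sub>R G (x + c) \<partial>lborel)" .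
  have i1: "integrable lborel (\<lambda>x. u (x + c) *\<^sub>R grad \<chi>' x)"
    by (rule integrable_test(2)[OF chi c u])
  have i2: "integrable lborel (\<lambda>x. \<chi>' x *\<^sub>R G (x + c))"
    by (rule integrable_test(1)[OF chi c G])
  have i3: "integrable lborel (\<lambda>x. (\<zeta> x * u (x + c)) *\<^sub>R grad \<psi> x)"
    using integrable_test(2)[OF psi, of 0 V] cutoff_translate_loc_pow(1)[OF z c _ u G, of V] by simp
  have split: "u (x + c) *\<^sub>R grad \<chi>' x = (\<zeta> x * u (x + c)) *\<^sub>R grad \<psi> x + (\<psi> x * u (x + c)) *\<^sub>R grad \<zeta> x" for x
    by (simp add: gr algebra_simps)
  have i4: "integrable lborel (\<lambda>x. (\<psi> x * u (x + c)) *\<^sub>R grad \<zeta> x)"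
    using Bochner_Integration.integrable_diff[OF i1 i3] by (simp add: split)
  have "(\<integral>x. \<psi> x *\<^sub>R (\<zeta> x *\<^sub>R G (x + c) + u (x + c) *\<^sub>R grad \<zeta> x) \<partial>lborel)
      = (\<integral>x. \<chi>' x *\<^sub>R G (x + c) + (\<psi> x * u (x + c)) *\<^sub>R grad \<zeta> x \<partial>lborel)"
    by (simp add: \<chi>'_def scaleR_right_distrib)
  also have "\<dots> = (\<integral>x. \<chi>' x *\<^sub>R G (x + c) \<partial>lborel) + (\<integral>x. (\<psi> x * u (x + c)) *\<^sub>R grad \<zeta> x \<partial>lborel)"
    by (rule Bochner_Integration.integral_add[OF i2 i4])
  also have "(\<integral>x. \<chi>' x *\<^sub>R G (x + c) \<partial>lborel) = - ((\<integral>x. (\<zeta> x * u (x + c)) *\<^sub>R grad \<psi> x \<partial>lborel) + (\<integral>x. (\<psi> x * u (x + c)) *\<^sub>R grad \<zeta> x \<partial>lborel))"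
    using A Bochner_Integration.integral_add[OF i3 i4] by (simp add: split)
  finally show "(\<integral>x. (\<zeta> x * u (x + c)) *\<^sub>R grad \<psi> x \<partial>lborel)
      = - (\<integral>x. \<psi> x *\<^sub>R (\<zeta> x *\<^sub>R G (x + c) + u (x + c) *\<^sub>R grad \<zeta> x) \<partial>lborel)"
    by simp
qed

text \<open>Makes the truncated difference of the energy argument an admissible test function.\<close>

lemma wgrad_cutoff_difference:
  fixes u :: "'a::euclidean_space \<Rightarrow> real"
  assumes W: "wgrad \<Omega> u G" and u: "loc_pow m \<Omega> u" and G: "loc_pow m \<Omega> G" and m: "m \<ge> 1"
    and z: "\<zeta> \<in> test_functions U" and U: "U \<subseteq> \<Omega>" and c: "\<And>x. x \<in> U \<Longrightarrow> x + h \<in> \<Omega>"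
  defines "\<phi> \<equiv> \<lambda>x. \<zeta> x * (u (x + h) - u x)"
    and "D\<phi> \<equiv> \<lambda>x. \<zeta> x *\<^sub>R (G (x + h) - G x) + (u (x + h) - u x) *\<^sub>R grad \<zeta> x"
  shows "wgrad V \<phi> D\<phi>" "loc_pow m V \<phi>" "loc_pow m V D\<phi>"
proof -
  have u1: "loc_pow 1 \<Omega> u" and G1: "loc_pow 1 \<Omega> G"
    using m by (auto intro: loc_pow_mono[OF u] loc_pow_mono[OF G])
  have 0: "x + 0 \<in> \<Omega>" if "x \<in> U" for x using that U by auto
  have phi: "\<phi> = (\<lambda>x. \<zeta> x * u (x + h) - \<zeta> x * u (x + 0))"
    by (auto simp: \<phi>_def algebra_simps)
  have Dphi: "D\<phi> = (\<lambda>x. (\<zeta> x *\<^sub>R G (x + h) + u (x + h) *\<^sub>R grad \<zeta> x) - (\<zeta> x *\<^sub>R G (x + 0) + u (x + 0) *\<^sub>R grad \<zeta> x))"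
    by (auto simp: D\<phi>_def algebra_simps)
  have m0: "0 \<le> m" using m by simp
  show "loc_pow m V \<phi>" "loc_pow m V D\<phi>"
    unfolding phi Dphi
    by (rule loc_pow_diff[OF cutoff_translate_loc_pow(1)[OF z c m0 u G] cutoff_translate_loc_pow(1)[OF z 0 m0 u G] m0]
       loc_pow_diff[OF cutoff_translate_loc_pow(2)[OF z c m0 u G] cutoff_translate_loc_pow(2)[OF z 0 m0 u G] m0]; assumption)+
  have z1: "0 \<le> (1::real)" by simp
  show "wgrad V \<phi> D\<phi>"
    unfolding phi Dphi
    by (rule wgrad_diff[OF wgrad_cutoff_translate[OF W u1 G1 z c] wgrad_cutoff_translate[OF W u1 G1 z 0]
      cutoff_translate_loc_pow(1)[OF z c z1 u1 G1] cutoff_translate_loc_pow(1)[OF z 0 z1 u1 G1]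
      cutoff_translate_loc_pow(2)[OF z c z1 u1 G1] cutoff_translate_loc_pow(2)[OF z 0 z1 u1 G1]]; assumption)
qed

section \<open>The energy estimate\<close>

lemma borel_measurable_H_field [measurable]: "H_field a \<in> borel_measurable borel"
  unfolding H_field_def by measurable

lemma borel_measurable_excess [measurable]: "excess \<in> borel_measurable borel"
  unfolding excess_def by measurable

lemma conjugate_exponent:
  fixes p q :: real
  assumes "q \<ge> 2" and p: "p = q / (q - 1)"
  shows "1 < p" "1 < q" "1 / p + 1 / q = 1"
  using assms(1) unfolding p by (auto simp: field_simps)

text \<open>Young's inequality without its constants. It replaces Hoelder's inequality throughout: applied to
  quantities divided by the appropriate power of \<open>norm h\<close>, it loses only constants.\<close>

lemma young_conjugate: "1 < p \<Longrightarrow> 1 < q \<Longrightarrow> 1 / p + 1 / q = 1 \<Longrightarrow> 0 \<le> a \<Longrightarrow> 0 \<le> b \<Longrightarrow> a * b \<le> a powr p + b powr q"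
  for a b p q :: real
proof -
  assume *: "1 < p" "1 < q" "1 / p + 1 / q = 1" "0 \<le> a" "0 \<le> b"
  then have "a * b \<le> a powr p / p + b powr q / q" by (rule Youngs_inequality)
  also have "a powr p / p \<le> a powr p / 1" using * by (intro divide_left_mono) auto
  also have "b powr q / q \<le> b powr q / 1" using * by (intro divide_left_mono) auto
  finally show ?thesis by simp
qed

lemma young_powr:
  fixes x y q :: real
  assumes "0 \<le> x" "0 \<le> y" "q \<ge> 2"
  shows "x\<^sup>2 * y powr (q - 2) \<le> x powr q + y powr q"
proof -
  have sq: "t\<^sup>2 * t powr (q - 2) = t powr q" if "t \<ge> 0" for t :: real
    using that assms(3) powr_realpow'[of t 2] by (cases "t = 0") (auto simp: powr_add[symmetric] powr_numeral[symmetric] simp del: powr_numeral)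
  show ?thesis
  proof (cases "y \<le> x")
    case True
    then have "x\<^sup>2 * y powr (q - 2) \<le> x\<^sup>2 * x powr (q - 2)"
      using assms by (intro mult_left_mono powr_mono2) auto
    then show ?thesis using sq[OF assms(1)] by (simp add: add_increasing2)
  next
    case False
    then have "x\<^sup>2 * y powr (q - 2) \<le> y\<^sup>2 * y powr (q - 2)"
      using assms by (intro mult_right_mono power_mono) auto
    then show ?thesis using sq[OF assms(2)] by (simp add: add_increasing)
  qed
qed

lemma integrable_conjugate:
  fixes F :: "'a::euclidean_space \<Rightarrow> real" and a :: "'a \<Rightarrow> 'b::euclidean_space" and b :: "'a \<Rightarrow> 'c::euclidean_space"
  assumes [measurable]: "F \<in> borel_measurable borel" and pq: "1 < p" "1 < q" "1 / p + 1 / q = 1"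
    and a: "loc_pow p U a" and b: "loc_pow q U b"
    and S: "compact S" "S \<subseteq> U" "\<And>x. x \<notin> S \<Longrightarrow> F x = 0" and F: "\<And>x. x \<in> S \<Longrightarrow> \<bar>F x\<bar> \<le> norm (a x) * norm (b x)"
  shows "integrable lborel F"
proof (rule integrableI_bounded)
  have [measurable]: "a \<in> borel_measurable borel" "b \<in> borel_measurable borel" "S \<in> sets borel"
    using a b S by (auto intro: loc_powD borel_compact)
  have "(\<integral>\<^sup>+x. ennreal (norm (F x)) \<partial>lborel) \<le> (\<integral>\<^sup>+x. ennreal (norm (a x) powr p) * indicator S x
      + ennreal (norm (b x) powr q) * indicator S x \<partial>lborel)"
  proof (rule nn_integral_mono)
    fix x
    show "ennreal (norm (F x)) \<le> ennreal (norm (a x) powr p) * indicator S x + ennreal (norm (b x) powr q) * indicator S x"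
    proof (cases "x \<in> S")
      case True
      have "\<bar>F x\<bar> \<le> norm (a x) powr p + norm (b x) powr q"
        using F[OF True] young_conjugate[OF pq norm_ge_zero norm_ge_zero, of "a x" "b x"] by linarith
      then have "ennreal (norm (F x)) \<le> ennreal (norm (a x) powr p + norm (b x) powr q)"
        unfolding real_norm_def by (rule ennreal_leI)
      also have "\<dots> = ennreal (norm (a x) powr p) + ennreal (norm (b x) powr q)" by (rule ennreal_plus) auto
      finally show ?thesis using True by simp
    qed (use S in auto)
  qed
  also have "\<dots> = (\<integral>\<^sup>+x\<in>S. ennreal (norm (a x) powr p) \<partial>lborel) + (\<integral>\<^sup>+x\<in>S. ennreal (norm (b x) powr q) \<partial>lborel)"
    by (rule nn_integral_add) measurable
  also have "\<dots> < \<infinity>" using loc_powD(2)[OF a S(1,2)] loc_powD(2)[OF b S(1,2)] by (simp add: less_top)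
  finally show "(\<integral>\<^sup>+x. ennreal (norm (F x)) \<partial>lborel) < \<infinity>" .
qed measurable

lemma excess_le_norm: "excess \<xi> \<le> norm \<xi>"
  by (simp add: excess_def)

text \<open>With conjugate exponents the \<open>p\<close>-th power of the flux is \<open>excess powr q\<close>.\<close>

lemma loc_pow_flux:
  assumes G: "loc_pow q \<Omega> G" and q: "q \<ge> 2" "p = q / (q - 1)"
  shows "loc_pow p \<Omega> (\<lambda>x. H_field (q - 1) (G x))"
  unfolding loc_pow_def
proof safe
  have [measurable]: "G \<in> borel_measurable borel" using G by (rule loc_powD)
  show "(\<lambda>x. H_field (q - 1) (G x)) \<in> borel_measurable borel" by measurable
  fix K assume K: "compact K" "K \<subseteq> \<Omega>"
  have "(\<integral>\<^sup>+x\<in>K. ennreal (norm (H_field (q - 1) (G x)) powr p) \<partial>lborel) \<le> (\<integral>\<^sup>+x\<in>K. ennreal (norm (G x) powr q) \<partial>lborel)"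
    using q excess_le_norm
    by (intro nn_integral_mono mult_right_mono ennreal_leI) (auto simp: norm_H_field powr_powr intro!: powr_mono2)
  also have "\<dots> < \<infinity>" by (rule loc_powD(2)[OF G K])
  finally show "(\<integral>\<^sup>+x\<in>K. ennreal (norm (H_field (q - 1) (G x)) powr p) \<partial>lborel) < \<infinity>" .
qed

text \<open>The integrand of the energy argument, with \<open>e\<close> the value of the cutoff, \<open>g\<close> its gradient and \<open>w\<close> the
  difference of \<open>u\<close>; the vector tested against is the gradient of \<open>\<eta>\<^sup>2 (u (x + h) - u x)\<close>. Half of the
  monotonicity gain \<open>c\<close> absorbs the cross term by the weighted inequality
  \<open>2 x y \<le> (c / 2) x\<^sup>2 + (2 / c) y\<^sup>2\<close>.\<close>

lemma pointwise_energy: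
  fixes \<xi> \<zeta> g :: "'a::euclidean_space" and e w M q :: real
  assumes q: "q \<ge> 2" and g: "norm g \<le> M"
  defines "c \<equiv> 4 / q\<^sup>2"
  shows "c / 2 * (e\<^sup>2 * (norm (H_field (q/2) \<xi> - H_field (q/2) \<zeta>))\<^sup>2)
    \<le> (H_field (q - 1) \<xi> - H_field (q - 1) \<zeta>) \<bullet> (e\<^sup>2 *\<^sub>R (\<xi> - \<zeta>) + w *\<^sub>R ((2 * e) *\<^sub>R g))
      + 2 / c * M\<^sup>2 * (w\<^sup>2 * (excess \<xi> powr (q/2 - 1) + excess \<zeta> powr (q/2 - 1))\<^sup>2)"
proof -
  define A where "A = H_field (q - 1) \<xi> - H_field (q - 1) \<zeta>"
  define v where "v = norm (H_field (q/2) \<xi> - H_field (q/2) \<zeta>)"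
  define b where "b = excess \<xi> powr (q/2 - 1) + excess \<zeta> powr (q/2 - 1)"
  have c: "c > 0" using q by (simp add: c_def)
  have b: "b \<ge> 0" by (simp add: b_def)
  have 1: "c * (e\<^sup>2 * v\<^sup>2) \<le> e\<^sup>2 * (A \<bullet> (\<xi> - \<zeta>))"
    using mult_left_mono[OF H_field_monotone[OF q, of \<xi> \<zeta>], of "e\<^sup>2"] by (simp add: A_def v_def c_def mult_ac)
  have "\<bar>w * (2 * e) * (A \<bullet> g)\<bar> \<le> \<bar>w * (2 * e)\<bar> * (b * v * M)"
  proof -
    have "\<bar>A \<bullet> g\<bar> \<le> norm A * norm g" by (rule Cauchy_Schwarz_ineq2)
    also have "\<dots> \<le> (b * v) * M"
      using H_field_diff_le[OF q, of \<xi> \<zeta>] g b by (intro mult_mono) (auto simp: A_def b_def v_def)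
    finally have "\<bar>A \<bullet> g\<bar> \<le> b * v * M" .
    then show ?thesis unfolding abs_mult[of "w * (2 * e)"] by (rule mult_left_mono) simp
  qed
  also have "\<dots> = 2 * ((\<bar>e\<bar> * v) * (M * \<bar>w\<bar> * b))" by (simp add: abs_mult)
  also have "\<dots> \<le> c / 2 * (\<bar>e\<bar> * v)\<^sup>2 + 2 / c * (M * \<bar>w\<bar> * b)\<^sup>2"
  proof -
    have "2 * (x * y) \<le> c / 2 * x\<^sup>2 + 2 / c * y\<^sup>2" for x y :: real
    proof -
      have "0 \<le> (c * x - 2 * y)\<^sup>2 / (2 * c)" using c by simp
      also have "\<dots> = c / 2 * x\<^sup>2 + 2 / c * y\<^sup>2 - 2 * (x * y)"
        using c by (simp add: power2_eq_square field_simps)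
      finally show ?thesis by simp
    qed
    then show ?thesis .
  qed
  finally have 2: "\<bar>w * (2 * e) * (A \<bullet> g)\<bar> \<le> c / 2 * (e\<^sup>2 * v\<^sup>2) + 2 / c * M\<^sup>2 * (w\<^sup>2 * b\<^sup>2)"
    by (simp add: power_mult_distrib mult_ac)
  have "A \<bullet> (e\<^sup>2 *\<^sub>R (\<xi> - \<zeta>) + w *\<^sub>R ((2 * e) *\<^sub>R g)) = e\<^sup>2 * (A \<bullet> (\<xi> - \<zeta>)) + w * (2 * e) * (A \<bullet> g)"
    by (simp add: inner_add_right)
  then show ?thesis using 1 2 unfolding A_def[symmetric] v_def[symmetric] b_def[symmetric] by linarith
qed

text \<open>Used with \<open>t = norm h\<close>: the error term is \<open>t\<^sup>2\<close> times an expression whose integral is bounded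
  independently of \<open>h\<close>, since \<open>\<bar>w\<bar> / t\<close> is a difference quotient of \<open>u\<close>.\<close>

lemma pointwise_error:
  fixes \<xi> \<zeta> :: "'a::euclidean_space" and w t q :: real
  assumes q: "q \<ge> 2" and t: "0 < t"
  shows "w\<^sup>2 * (excess \<xi> powr (q/2 - 1) + excess \<zeta> powr (q/2 - 1))\<^sup>2
    \<le> 2 * t\<^sup>2 * (2 * (\<bar>w\<bar> powr q * t powr (- q)) + norm \<xi> powr q + norm \<zeta> powr q)"
proof -
  define y where "y = \<bar>w\<bar> / t"
  have y: "y \<ge> 0" "\<bar>w\<bar> = t * y" using t by (auto simp: y_def)
  have yq: "y powr q = \<bar>w\<bar> powr q * t powr (- q)"
    by (simp add: y_def powr_divide powr_minus_divide)
  have sq: "(excess \<xi> powr (q/2 - 1))\<^sup>2 = excess \<xi> powr (q - 2)" for \<xi> :: 'a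
    by (simp add: power2_eq_square powr_add[symmetric])
  have ex: "y\<^sup>2 * excess \<xi> powr (q - 2) \<le> y powr q + norm \<xi> powr q" for \<xi> :: 'a
  proof -
    have "excess \<xi> powr q \<le> norm \<xi> powr q" using q excess_le_norm by (intro powr_mono2) auto
    then show ?thesis using young_powr[OF y(1) excess_nonneg q, of \<xi>] by linarith
  qed
  have sum_squares: "(a + b)\<^sup>2 \<le> 2 * (a\<^sup>2 + b\<^sup>2)" for a b :: real
    unfolding power2_sum using sum_squares_bound[of a b] by simp
  have "(excess \<xi> powr (q/2 - 1) + excess \<zeta> powr (q/2 - 1))\<^sup>2 \<le> 2 * (excess \<xi> powr (q - 2) + excess \<zeta> powr (q - 2))"
    unfolding sq[symmetric] by (rule sum_squares)
  then have "w\<^sup>2 * (excess \<xi> powr (q/2 - 1) + excess \<zeta> powr (q/2 - 1))\<^sup>2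
     \<le> (t\<^sup>2 * y\<^sup>2) * (2 * (excess \<xi> powr (q - 2) + excess \<zeta> powr (q - 2)))"
    using y(2) by (metis mult_left_mono power2_abs power_mult_distrib zero_le_power2)
  also have "\<dots> = 2 * t\<^sup>2 * (y\<^sup>2 * excess \<xi> powr (q - 2) + y\<^sup>2 * excess \<zeta> powr (q - 2))"
    by (simp add: algebra_simps)
  also have "\<dots> \<le> 2 * t\<^sup>2 * ((y powr q + norm \<xi> powr q) + (y powr q + norm \<zeta> powr q))"
    by (intro mult_left_mono add_mono ex) auto
  finally show ?thesis by (simp add: yq algebra_simps)
qed

lemma loc_pow_subset: "loc_pow m V v \<Longrightarrow> U \<subseteq> V \<Longrightarrow> loc_pow m U v"
  unfolding loc_pow_def by blast

text \<open>The weak equation in the form in which the energy argument uses it, for test functions given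
  together with a Borel weak gradient and a compact support.\<close>

definition borel_solution ::
    "'a::euclidean_space set \<Rightarrow> real \<Rightarrow> ('a \<Rightarrow> real) \<Rightarrow> ('a \<Rightarrow> 'a) \<Rightarrow> bool" where
  "borel_solution \<Omega> q f G \<longleftrightarrow> (\<forall>\<phi> D S. wgrad \<Omega> \<phi> D \<and> loc_pow q UNIV \<phi> \<and> loc_pow q UNIV D \<and>
     compact S \<and> S \<subseteq> \<Omega> \<and> (\<forall>x. x \<notin> S \<longrightarrow> \<phi> x = 0 \<and> D x = 0) \<longrightarrow>
     (\<integral>x. H_field (q - 1) (G x) \<bullet> D x \<partial>lborel) = (\<integral>x. f x * \<phi> x \<partial>lborel))"

lemma borel_solutionD:
  assumes "borel_solution \<Omega> q f G" "wgrad \<Omega> \<phi> D" "loc_pow q UNIV \<phi>" "loc_pow q UNIV D" "compact S" "S \<subseteq> \<Omega>"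
    and "\<And>x. x \<notin> S \<Longrightarrow> \<phi> x = 0" "\<And>x. x \<notin> S \<Longrightarrow> D x = 0"
  shows "(\<integral>x. H_field (q - 1) (G x) \<bullet> D x \<partial>lborel) = (\<integral>x. f x * \<phi> x \<partial>lborel)"
  using assms unfolding borel_solution_def by blast

text \<open>The equation is tested with the truncated difference and with its translate by \<open>h\<close>. Translating the
  second identity back moves the shift onto the flux and onto \<open>f\<close>; then the first is subtracted.\<close>

lemma energy_identity:
  fixes f u :: "'a::euclidean_space \<Rightarrow> real" and G :: "'a \<Rightarrow> 'a"
  assumes q: "q \<ge> 2" and p: "p = q / (q - 1)"
    and u: "loc_pow q \<Omega> u" and G: "loc_pow q \<Omega> G" and f: "loc_pow p \<Omega> f" and W: "wgrad \<Omega> u G"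
    and EQ: "borel_solution \<Omega> q f G"
    and S: "compact S" "S \<subseteq> \<Omega>" and h: "\<And>x. x \<in> S \<Longrightarrow> x + h \<in> \<Omega>" and z: "\<zeta> \<in> test_functions S"
  defines "\<phi> \<equiv> \<lambda>x. \<zeta> x * (u (x + h) - u x)"
    and "D \<equiv> \<lambda>x. \<zeta> x *\<^sub>R (G (x + h) - G x) + (u (x + h) - u x) *\<^sub>R grad \<zeta> x"
  shows "integrable lborel (\<lambda>x. (H_field (q - 1) (G (x + h)) - H_field (q - 1) (G x)) \<bullet> D x)"
    and "integrable lborel (\<lambda>x. (f (x + h) - f x) * \<phi> x)"
    and "(\<integral>x. (H_field (q - 1) (G (x + h)) - H_field (q - 1) (G x)) \<bullet> D x \<partial>lborel)
       = (\<integral>x. (f (x + h) - f x) * \<phi> x \<partial>lborel)"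
proof -
  have q1: "1 \<le> q" "1 < q" "0 \<le> q" using q by auto
  note pq = conjugate_exponent[OF q p]
  have sh: "x + h \<in> \<Omega>" if "x \<in> S" for x using h that .
  have w: "wgrad V \<phi> D" and p': "loc_pow q V \<phi>" and d': "loc_pow q V D" for V
    unfolding \<phi>_def D_def by (rule wgrad_cutoff_difference[OF W u G q1(1) z S(2) sh]; assumption)+
  obtain S' where S': "S' \<subseteq> S" "\<And>x. x \<notin> S' \<Longrightarrow> \<zeta> x = 0" "\<And>x. x \<notin> S' \<Longrightarrow> grad \<zeta> x = 0"
    by (rule test_functionsE[OF z]) blast
  have off: "\<phi> x = 0" "D x = 0" if "x \<notin> S" for x
  proof -
    have "x \<notin> S'" using S'(1) that by auto
    then have "\<zeta> x = 0" "grad \<zeta> x = 0" by (rule S'(2), rule S'(3))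
    then show "\<phi> x = 0" "D x = 0" by (simp_all add: \<phi>_def D_def)
  qed
  define A where "A x = H_field (q - 1) (G x)" for x
  have A: "loc_pow p \<Omega> A" unfolding A_def by (rule loc_pow_flux[OF G q p])
  have [measurable]: "A \<in> borel_measurable borel" "f \<in> borel_measurable borel"
    "\<phi> \<in> borel_measurable borel" "D \<in> borel_measurable borel"
    using A f p'[of UNIV] d'[of UNIV] by (auto intro: loc_powD)
  have E1: "(\<integral>x. A x \<bullet> D x \<partial>lborel) = (\<integral>x. f x * \<phi> x \<partial>lborel)"
    unfolding A_def by (rule borel_solutionD[OF EQ w p' d' S off])
  have p1: "loc_pow 1 UNIV \<phi>" and d1: "loc_pow 1 UNIV D"
    using q1 by (auto intro: loc_pow_mono[OF p'] loc_pow_mono[OF d'])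
  have E2: "(\<integral>x. A x \<bullet> D (x + (- h)) \<partial>lborel) = (\<integral>x. f x * \<phi> (x + (- h)) \<partial>lborel)"
    unfolding A_def
  proof (rule borel_solutionD[OF EQ, where S="(\<lambda>x. x + h) ` S"])
    show "wgrad \<Omega> (\<lambda>x. \<phi> (x + (- h))) (\<lambda>x. D (x + (- h)))"
      by (rule wgrad_mono[OF wgrad_translate[OF w p1 d1]]) simp
    show "loc_pow q UNIV (\<lambda>x. \<phi> (x + (- h)))" "loc_pow q UNIV (\<lambda>x. D (x + (- h)))"
      by (rule loc_pow_translate[OF p'[of UNIV]] loc_pow_translate[OF d'[of UNIV]]; simp)+
    show "compact ((\<lambda>x. x + h) ` S)" using S by (intro compact_continuous_image continuous_intros)
    show "(\<lambda>x. x + h) ` S \<subseteq> \<Omega>" using h by auto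
    fix x assume "x \<notin> (\<lambda>x. x + h) ` S"
    moreover have "x \<in> (\<lambda>x. x + h) ` S" if "x + (- h) \<in> S"
      using that by (intro rev_image_eqI[of "x + (- h)"]) auto
    ultimately have "x + (- h) \<notin> S" by blast
    then show "\<phi> (x + (- h)) = 0" "D (x + (- h)) = 0" using off by auto
  qed
  have E2': "(\<integral>x. A (x + h) \<bullet> D x \<partial>lborel) = (\<integral>x. f (x + h) * \<phi> x \<partial>lborel)"
    using lborel_integral_translate[of "\<lambda>x. A x \<bullet> D (x + (- h))" h]
      lborel_integral_translate[of "\<lambda>x. f x * \<phi> (x + (- h))" h] E2 by simp
  have Ah: "loc_pow p S (\<lambda>x. A (x + h))" and fh: "loc_pow p S (\<lambda>x. f (x + h))"
    by (rule loc_pow_translate[OF A h] loc_pow_translate[OF f h]; assumption)+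
  have A0: "loc_pow p S A" and f0: "loc_pow p S f"
    using A f S by (auto intro: loc_pow_subset)
  have i: "integrable lborel (\<lambda>x. a x \<bullet> D x)" if a: "loc_pow p S a" for a :: "'a \<Rightarrow> 'a"
  proof -
    have [measurable]: "a \<in> borel_measurable borel" using a by (rule loc_powD)
    show ?thesis
      by (rule integrable_conjugate[OF _ pq a d' S(1)]) (use off in \<open>auto intro: Cauchy_Schwarz_ineq2\<close>)
  qed
  have j: "integrable lborel (\<lambda>x. a x * \<phi> x)" if a: "loc_pow p S a" for a :: "'a \<Rightarrow> real"
  proof -
    have [measurable]: "a \<in> borel_measurable borel" using a by (rule loc_powD)
    show ?thesis
      by (rule integrable_conjugate[OF _ pq a p' S(1)]) (use off in \<open>auto simp: abs_mult\<close>)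
  qed
  note ii = Bochner_Integration.integrable_diff[OF i[OF Ah] i[OF A0]]
    and jj = Bochner_Integration.integrable_diff[OF j[OF fh] j[OF f0]]
  show "integrable lborel (\<lambda>x. (H_field (q - 1) (G (x + h)) - H_field (q - 1) (G x)) \<bullet> D x)"
    using ii by (simp add: A_def inner_diff_left)
  show "integrable lborel (\<lambda>x. (f (x + h) - f x) * \<phi> x)"
    using jj by (simp add: left_diff_distrib)
  have "(\<integral>x. (A (x + h) - A x) \<bullet> D x \<partial>lborel) = (\<integral>x. A (x + h) \<bullet> D x \<partial>lborel) - (\<integral>x. A x \<bullet> D x \<partial>lborel)"
    unfolding inner_diff_left by (rule Bochner_Integration.integral_diff[OF i[OF Ah] i[OF A0]])
  also have "\<dots> = (\<integral>x. (f (x + h) - f x) * \<phi> x \<partial>lborel)"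
    unfolding left_diff_distrib E1 E2' by (rule Bochner_Integration.integral_diff[OF j[OF fh] j[OF f0], symmetric])
  finally show "(\<integral>x. (H_field (q - 1) (G (x + h)) - H_field (q - 1) (G x)) \<bullet> D x \<partial>lborel)
       = (\<integral>x. (f (x + h) - f x) * \<phi> x \<partial>lborel)"
    by (simp add: A_def)
qed

text \<open>With \<open>P\<close> the integrand of the energy identity on the flux side, \<open>R\<close> its counterpart with \<open>f\<close>, and \<open>Q\<close> the absorbed
  error, \<open>pointwise_energy\<close> bounds the quantity to be estimated, up to a constant, by \<open>P + Q\<close>, which has the same
  integral as \<open>R + Q\<close>. Young's inequality for differences divided by \<open>t powr \<alpha>\<close> and \<open>t\<close> bounds \<open>R + Q\<close> by
  \<open>t powr (1 + \<alpha>)\<close> times a function \<open>E\<close> whose integral is bounded independently of \<open>h\<close>.\<close>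

theorem energy_estimate:
  fixes f u :: "'a::euclidean_space \<Rightarrow> real" and G :: "'a \<Rightarrow> 'a"
  assumes Om: "open \<Omega>" and q: "q \<ge> 2" and p: "p = q / (q - 1)" and al: "0 < \<alpha>" "\<alpha> < 1"
    and u: "loc_pow q \<Omega> u" and G: "loc_pow q \<Omega> G" and f: "loc_pow p \<Omega> f" and W: "wgrad \<Omega> u G"
    and EQ: "borel_solution \<Omega> q f G"
    and BES: "\<And>K. compact K \<Longrightarrow> K \<subseteq> \<Omega> \<Longrightarrow> difference_bound (\<alpha> * p) K (\<lambda>h x. \<bar>f (x + h) - f x\<bar> powr p)"
    and K: "compact K" "K \<subseteq> \<Omega>"
  shows "difference_bound (1 + \<alpha>) K (\<lambda>h x. (norm (H_field (q/2) (G (x + h)) - H_field (q/2) (G x)))\<^sup>2)"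
proof -
  have [measurable]: "u \<in> borel_measurable borel" "G \<in> borel_measurable borel" "f \<in> borel_measurable borel"
    using u G f by (auto intro: loc_powD)
  note pq = conjugate_exponent[OF q p]
  obtain \<eta> where eta: "\<eta> \<in> test_functions \<Omega>" "\<And>x. 0 \<le> \<eta> x" "\<And>x. \<eta> x \<le> 1" "\<And>x. x \<in> K \<Longrightarrow> \<eta> x = 1"
    by (rule exists_cutoff[OF K(1) Om K(2)]) blast
  obtain S M where S: "compact S" "S \<subseteq> \<Omega>" "\<And>x. x \<notin> S \<Longrightarrow> \<eta> x = 0" "\<And>x. x \<notin> S \<Longrightarrow> grad \<eta> x = 0"
    "M \<ge> 0" "\<And>x. \<bar>\<eta> x\<bar> \<le> M" "\<And>x. norm (grad \<eta> x) \<le> M"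
    by (rule test_functionsE[OF eta(1)]) blast
  note [measurable] = test_function_props(4,5)[OF eta(1)]
  define \<zeta> where "\<zeta> x = \<eta> x * \<eta> x" for x
  have etaS: "\<eta> \<in> test_functions S"
    by (rule test_functionsI[OF test_function_props(1)[OF eta(1)] S(1) order_refl S(3)])
  have z: "\<zeta> \<in> test_functions S" and gz: "grad \<zeta> x = (2 * \<eta> x) *\<^sub>R grad \<eta> x" for x
  proof -
    show "\<zeta> \<in> test_functions S" unfolding \<zeta>_def by (rule test_functions_mult(1)[OF etaS etaS])
    have "grad \<zeta> x = \<eta> x *\<^sub>R grad \<eta> x + \<eta> x *\<^sub>R grad \<eta> x"
      unfolding \<zeta>_def by (rule test_functions_mult(2)[OF etaS etaS])
    then show "grad \<zeta> x = (2 * \<eta> x) *\<^sub>R grad \<eta> x" by (simp add: scaleR_2[symmetric])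
  qed
  obtain \<epsilon> where e: "\<epsilon> > 0" "thicken S \<epsilon> \<subseteq> \<Omega>"
    using compact_subset_open_imp_cball_epsilon_subset[OF S(1) Om S(2)] unfolding thicken_def by blast
  define T where "T = thicken S \<epsilon>"
  have "x \<in> T" if "x \<in> S" for x
    using that e(1) unfolding T_def thicken_iff by (intro bexI[of _ x]) auto
  then have T: "compact T" "T \<subseteq> \<Omega>" "S \<subseteq> T" using compact_thicken[OF S(1)] e
    by (auto simp: T_def)
  have [measurable]: "S \<in> sets borel" "T \<in> sets borel" "K \<in> sets borel" using S T K by (auto intro: borel_compact)
  obtain Cf \<delta>f where Cf: "Cf \<ge> 0" "\<delta>f > 0" "\<And>h. norm h < \<delta>f \<Longrightarrow>
        (\<integral>\<^sup>+x\<in>S. ennreal (\<bar>f (x + h) - f x\<bar> powr p) \<partial>lborel) \<le> ennreal (Cf * norm h powr (\<alpha> * p))"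
    using BES[OF S(1,2)] unfolding difference_bound_def by blast
  obtain IG where IG: "IG \<ge> 0" "(\<integral>\<^sup>+x\<in>T. ennreal (norm (G x) powr q) \<partial>lborel) = ennreal IG"
    using ennreal_finite_ex[OF loc_powD(2)[OF G T(1,2)]] by blast
  define c where "c = 4 / q\<^sup>2"
  have c: "c > 0" using q by (simp add: c_def)
  define C1 where "C1 = 2 / c * M\<^sup>2"
  have C1: "C1 \<ge> 0" using c by (simp add: C1_def)
  \<comment> \<open>The sum of the bounds for the integrals of the four terms of \<open>E\<close>.\<close>
  define DD where "DD = Cf + (1 + 4 * C1) * IG + 4 * C1 * IG"
  have DD: "DD \<ge> 0" using Cf C1 IG by (simp add: DD_def)
  define \<delta> where "\<delta> = min 1 (min \<epsilon> \<delta>f)"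
  have d: "\<delta> > 0" using e Cf by (simp add: \<delta>_def)
  show ?thesis unfolding difference_bound_def
  proof (rule exI[of _ "2 / c * DD"], intro conjI exI[of _ \<delta>] allI impI d)
    show "0 \<le> 2 / c * DD" using c DD by simp
    fix h :: 'a assume hd: "norm h < \<delta>"
    show "(\<integral>\<^sup>+x\<in>K. ennreal ((norm (H_field (q/2) (G (x + h)) - H_field (q/2) (G x)))\<^sup>2) \<partial>lborel)
        \<le> ennreal (2 / c * DD * norm h powr (1 + \<alpha>))"
    proof (cases "h = 0")
      case True
      then show ?thesis by simp
    next
      case False
      define t where "t = norm h"
      have t: "t > 0" "t < 1" "t < \<epsilon>" "t < \<delta>f" using False hd by (auto simp: t_def \<delta>_def)
      have sh: "x + h \<in> T" if "x \<in> S" for x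
        using that t by (auto simp: T_def thicken_iff dist_norm t_def intro!: bexI[of _ x])
      have shO: "x + h \<in> \<Omega>" if "x \<in> S" for x using sh[OF that] T by auto
      define \<phi> where "\<phi> x = \<zeta> x * (u (x + h) - u x)" for x
      define D where "D x = \<zeta> x *\<^sub>R (G (x + h) - G x) + (u (x + h) - u x) *\<^sub>R grad \<zeta> x" for x
      define P where "P x = (H_field (q - 1) (G (x + h)) - H_field (q - 1) (G x)) \<bullet> D x" for x
      define R where "R x = (f (x + h) - f x) * \<phi> x" for x
      have PR: "integrable lborel P" "integrable lborel R" "(\<integral>x. P x \<partial>lborel) = (\<integral>x. R x \<partial>lborel)"
        unfolding P_def R_def D_def \<phi>_def
        by (rule energy_identity[OF q p u G f W EQ S(1,2) shO z]; assumption)+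
      define X where "X x = \<bar>u (x + h) - u x\<bar> powr q" for x
      define Y where "Y x = \<bar>f (x + h) - f x\<bar> powr p" for x
      define Q where "Q x = indicator S x * (C1 * ((u (x + h) - u x)\<^sup>2 *
          (excess (G (x + h)) powr (q/2 - 1) + excess (G x) powr (q/2 - 1))\<^sup>2))" for x
      define N where "N x = norm (H_field (q/2) (G (x + h)) - H_field (q/2) (G x))" for x
      define E where "E x = indicator S x * (t powr (- (\<alpha> * p)) * Y x + (1 + 4 * C1) * t powr (- q) * X x
          + 2 * C1 * norm (G (x + h)) powr q + 2 * C1 * norm (G x) powr q)" for x
      have [measurable]: "X \<in> borel_measurable borel" "Y \<in> borel_measurable borel" "Q \<in> borel_measurable borel"
        "N \<in> borel_measurable borel" "E \<in> borel_measurable borel"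
        unfolding X_def[abs_def] Y_def[abs_def] Q_def[abs_def] N_def[abs_def] E_def[abs_def] by measurable
      have XY: "X x \<ge> 0" "Y x \<ge> 0" for x by (auto simp: X_def Y_def)
      have E0: "E x \<ge> 0" for x using C1 XY by (auto simp: E_def)
      have Q0: "Q x \<ge> 0" for x using C1 by (auto simp: Q_def)
      have i: "c / 2 * ((\<eta> x)\<^sup>2 * (N x)\<^sup>2) \<le> P x + Q x" for x
      proof (cases "x \<in> S")
        case True
        have "D x = (\<eta> x)\<^sup>2 *\<^sub>R (G (x + h) - G x) + (u (x + h) - u x) *\<^sub>R ((2 * \<eta> x) *\<^sub>R grad \<eta> x)"
          by (simp add: D_def gz \<zeta>_def power2_eq_square)
        then show ?thesis
          using pointwise_energy[OF q S(7)[of x], of "\<eta> x" "G (x + h)" "G x" "u (x + h) - u x"] True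
          by (simp add: P_def Q_def N_def C1_def c_def)
      next
        case False
        then show ?thesis using S(3)[of x] S(4)[of x] by (simp add: P_def Q_def D_def \<zeta>_def gz)
      qed
      have ii: "R x + Q x \<le> t powr (1 + \<alpha>) * E x" for x
      proof (cases "x \<in> S")
        case True
        have "\<bar>\<phi> x\<bar> \<le> 1 * \<bar>u (x + h) - u x\<bar>"
          unfolding \<phi>_def abs_mult
          using eta(2,3)[of x] by (intro mult_right_mono) (auto simp: \<zeta>_def mult_le_one)
        then have phi_le: "\<bar>\<phi> x\<bar> \<le> \<bar>u (x + h) - u x\<bar>" by simp
        have "R x \<le> \<bar>f (x + h) - f x\<bar> * \<bar>\<phi> x\<bar>"
          unfolding R_def abs_mult[symmetric] by (rule abs_ge_self)
        also have "\<dots> \<le> \<bar>f (x + h) - f x\<bar> * \<bar>u (x + h) - u x\<bar>"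
          by (rule mult_left_mono[OF phi_le abs_ge_zero])
        also have "\<dots> = t powr (1 + \<alpha>) * ((\<bar>f (x + h) - f x\<bar> / t powr \<alpha>) * (\<bar>u (x + h) - u x\<bar> / t))"
          using t by (simp add: powr_add)
        also have "\<dots> \<le> t powr (1 + \<alpha>) * ((\<bar>f (x + h) - f x\<bar> / t powr \<alpha>) powr p + (\<bar>u (x + h) - u x\<bar> / t) powr q)"
          using t by (intro mult_left_mono young_conjugate[OF pq]) auto
        also have "(\<bar>f (x + h) - f x\<bar> / t powr \<alpha>) powr p = t powr (- (\<alpha> * p)) * Y x"
          by (simp add: Y_def powr_divide powr_powr powr_minus_divide)
        also have "(\<bar>u (x + h) - u x\<bar> / t) powr q = t powr (- q) * X x"
          by (simp add: X_def powr_divide powr_minus_divide)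
        finally have R: "R x \<le> t powr (1 + \<alpha>) * (t powr (- (\<alpha> * p)) * Y x + t powr (- q) * X x)" .
        \<comment> \<open>Since \<open>t < 1\<close>, errors of second order are below the order of the Besov term.\<close>
        have t2: "t\<^sup>2 \<le> t powr (1 + \<alpha>)"
          using t al powr_mono'[of "1 + \<alpha>" 2 t] by (simp add: powr_numeral)
        define Z where "Z = 2 * (X x * t powr (- q)) + norm (G (x + h)) powr q + norm (G x) powr q"
        have Z: "Z \<ge> 0" using XY by (simp add: Z_def)
        have "Q x \<le> C1 * (2 * t\<^sup>2 * Z)"
          using True C1 pointwise_error[OF q t(1), of "u (x + h) - u x" "G (x + h)" "G x"]
          by (simp add: Q_def Z_def X_def mult_left_mono)
        also have "\<dots> \<le> C1 * (2 * t powr (1 + \<alpha>) * Z)"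
          using C1 Z t2 by (intro mult_left_mono mult_right_mono) auto
        finally have "Q x \<le> C1 * (2 * t powr (1 + \<alpha>) * Z)" .
        then have "R x + Q x \<le> t powr (1 + \<alpha>) * (t powr (- (\<alpha> * p)) * Y x + t powr (- q) * X x)
            + C1 * (2 * t powr (1 + \<alpha>) * Z)" using R by linarith
        also have "\<dots> = t powr (1 + \<alpha>) * E x"
          using True by (simp add: E_def Z_def algebra_simps)
        finally show ?thesis .
      next
        case False
        then show ?thesis using S(3)[of x] by (simp add: R_def \<phi>_def \<zeta>_def Q_def E_def)
      qed
      have Q_le: "Q x \<le> \<bar>R x\<bar> + t powr (1 + \<alpha>) * E x" for x using ii[of x] by linarith
      have iii: "(\<integral>\<^sup>+x. ennreal (E x) \<partial>lborel) \<le> ennreal DD"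
      proof -
        have "(\<integral>\<^sup>+x. ennreal (E x) \<partial>lborel) = (\<integral>\<^sup>+x.
            ennreal (t powr (- (\<alpha> * p))) * (ennreal (Y x) * indicator S x)
            + (ennreal ((1 + 4 * C1) * t powr (- q)) * (ennreal (X x) * indicator S x)
            + (ennreal (2 * C1) * (ennreal (norm (G (x + h)) powr q) * indicator S x)
            + ennreal (2 * C1) * (ennreal (norm (G x) powr q) * indicator S x))) \<partial>lborel)"
        proof (rule nn_integral_cong)
          fix x
          show "ennreal (E x) = ennreal (t powr (- (\<alpha> * p))) * (ennreal (Y x) * indicator S x)
            + (ennreal ((1 + 4 * C1) * t powr (- q)) * (ennreal (X x) * indicator S x)
            + (ennreal (2 * C1) * (ennreal (norm (G (x + h)) powr q) * indicator S x)
            + ennreal (2 * C1) * (ennreal (norm (G x) powr q) * indicator S x)))"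
            using C1 XY[of x]
            by (cases "x \<in> S") (auto simp: E_def ennreal_mult[symmetric] ennreal_plus[symmetric] add.assoc simp del: ennreal_plus)
        qed
        also have "\<dots> = ennreal (t powr (- (\<alpha> * p))) * (\<integral>\<^sup>+x\<in>S. ennreal (Y x) \<partial>lborel)
            + (ennreal ((1 + 4 * C1) * t powr (- q)) * (\<integral>\<^sup>+x\<in>S. ennreal (X x) \<partial>lborel)
            + (ennreal (2 * C1) * (\<integral>\<^sup>+x\<in>S. ennreal (norm (G (x + h)) powr q) \<partial>lborel)
            + ennreal (2 * C1) * (\<integral>\<^sup>+x\<in>S. ennreal (norm (G x) powr q) \<partial>lborel)))"
          by (simp add: nn_integral_add nn_integral_cmult)
        also have "\<dots> \<le> ennreal (t powr (- (\<alpha> * p))) * ennreal (Cf * t powr (\<alpha> * p))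
            + (ennreal ((1 + 4 * C1) * t powr (- q)) * (ennreal (t powr q) * ennreal IG)
            + (ennreal (2 * C1) * ennreal IG + ennreal (2 * C1) * ennreal IG))"
        proof (intro add_mono mult_left_mono)
          show "(\<integral>\<^sup>+x\<in>S. ennreal (Y x) \<partial>lborel) \<le> ennreal (Cf * t powr (\<alpha> * p))"
            unfolding Y_def t_def by (rule Cf(3)) (use t in \<open>simp add: t_def\<close>)
          show "(\<integral>\<^sup>+x\<in>S. ennreal (X x) \<partial>lborel) \<le> ennreal (t powr q) * ennreal IG"
            unfolding X_def t_def IG(2)[symmetric] T_def
            by (rule difference_quotient_bound[OF u G pq(2) W S(1) e(2)]) (use t in \<open>simp add: t_def\<close>)
          show "(\<integral>\<^sup>+x\<in>S. ennreal (norm (G (x + h)) powr q) \<partial>lborel) \<le> ennreal IG"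
            unfolding IG(2)[symmetric] by (rule nn_integral_translate_set) (use sh in auto)
          show "(\<integral>\<^sup>+x\<in>S. ennreal (norm (G x) powr q) \<partial>lborel) \<le> ennreal IG"
            unfolding IG(2)[symmetric] using T(3) by (intro nn_integral_mono) (auto split: split_indicator)
        qed auto
        also have "\<dots> = ennreal (t powr (- (\<alpha> * p)) * (Cf * t powr (\<alpha> * p))
            + ((1 + 4 * C1) * t powr (- q) * (t powr q * IG) + (2 * C1 * IG + 2 * C1 * IG)))"
          using C1 IG Cf by (simp add: ennreal_mult[symmetric] ennreal_plus[symmetric] del: ennreal_plus)
        also have "t powr (- (\<alpha> * p)) * (Cf * t powr (\<alpha> * p))
            + ((1 + 4 * C1) * t powr (- q) * (t powr q * IG) + (2 * C1 * IG + 2 * C1 * IG)) = DD"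
          using t by (simp add: DD_def powr_minus field_simps)
        finally show ?thesis .
      qed
      have Eint: "integrable lborel E"
        using iii E0 by (intro integrableI_nonneg) (auto simp: order_le_less_trans[OF _ ennreal_less_top])
      have Edd: "(\<integral>x. E x \<partial>lborel) \<le> DD"
        using iii nn_integral_eq_integral[OF Eint] E0 DD by simp
      have Qint: "integrable lborel Q"
      proof (rule Bochner_Integration.integrable_bound)
        show "integrable lborel (\<lambda>x. \<bar>R x\<bar> + t powr (1 + \<alpha>) * E x)"
          using PR(2) Eint by auto
        show "AE x in lborel. norm (Q x) \<le> norm (\<bar>R x\<bar> + t powr (1 + \<alpha>) * E x)"
          using Q_le Q0 by (intro AE_I2) (auto intro: order.trans[OF _ abs_ge_self])
      qed measurable
      have "(\<integral>x. P x + Q x \<partial>lborel) = (\<integral>x. R x + Q x \<partial>lborel)"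
        using PR Qint by simp
      also have "\<dots> \<le> (\<integral>x. t powr (1 + \<alpha>) * E x \<partial>lborel)"
        using PR(2) Qint Eint ii by (intro integral_mono) auto
      also have "\<dots> = t powr (1 + \<alpha>) * (\<integral>x. E x \<partial>lborel)" by simp
      also have "\<dots> \<le> t powr (1 + \<alpha>) * DD" using Edd by (intro mult_left_mono) auto
      finally have PQ: "(\<integral>x. P x + Q x \<partial>lborel) \<le> t powr (1 + \<alpha>) * DD" .
      have PQ0: "0 \<le> P x + Q x" for x
      proof -
        have "0 \<le> c / 2 * ((\<eta> x)\<^sup>2 * (N x)\<^sup>2)" using c by simp
        then show ?thesis using i[of x] by linarith
      qed
      have "(\<integral>\<^sup>+x\<in>K. ennreal ((N x)\<^sup>2) \<partial>lborel) \<le> (\<integral>\<^sup>+x. ennreal (2 / c) * ennreal (P x + Q x) \<partial>lborel)"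
      proof (rule nn_integral_mono)
        fix x
        show "ennreal ((N x)\<^sup>2) * indicator K x \<le> ennreal (2 / c) * ennreal (P x + Q x)"
        proof (cases "x \<in> K")
          case True
          have "(N x)\<^sup>2 = 2 / c * (c / 2 * ((\<eta> x)\<^sup>2 * (N x)\<^sup>2))" using c eta(4)[OF True] by simp
          also have "\<dots> \<le> 2 / c * (P x + Q x)" using c i[of x] by (intro mult_left_mono) auto
          finally show ?thesis using True c PQ0[of x] by (simp add: ennreal_mult[symmetric] ennreal_leI)
        qed simp
      qed
      also have "\<dots> = ennreal (2 / c) * (\<integral>\<^sup>+x. ennreal (P x + Q x) \<partial>lborel)"
        using PR Qint by (intro nn_integral_cmult) auto
      also have "(\<integral>\<^sup>+x. ennreal (P x + Q x) \<partial>lborel) = ennreal (\<integral>x. P x + Q x \<partial>lborel)"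
        using PR Qint PQ0 by (intro nn_integral_eq_integral) auto
      also have "ennreal (2 / c) * \<dots> \<le> ennreal (2 / c) * ennreal (t powr (1 + \<alpha>) * DD)"
        using PQ by (intro mult_left_mono ennreal_leI) auto
      also have "\<dots> = ennreal (2 / c * DD * norm h powr (1 + \<alpha>))"
        using c DD by (simp add: ennreal_mult[symmetric] t_def mult_ac)
      finally show ?thesis by (simp add: N_def)
    qed
  qed
qed

section \<open>Passage to Borel representatives\<close>

text \<open>Completeness of Lebesgue measure: altering a function on a null set preserves measurability.\<close>

lemma borel_measurable_lebesgue_AE:
  fixes f g :: "'a::euclidean_space \<Rightarrow> 'b::euclidean_space"
  assumes g: "g \<in> borel_measurable lebesgue" and ae: "AE x in lborel. f x = g x"
  shows "f \<in> borel_measurable lebesgue"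
proof (rule measurableI)
  fix A :: "'b set" assume A: "A \<in> sets borel"
  have ae': "AE x in lebesgue. f x = g x" using ae by (rule AE_completion)
  have "AE x in lebesgue. x \<in> g -` A \<inter> space lebesgue \<longleftrightarrow> x \<in> f -` A \<inter> space lebesgue"
    using ae' by eventually_elim auto
  then show "f -` A \<inter> space lebesgue \<in> sets lebesgue"
    by (rule completion.in_sets_AE) (use measurable_sets[OF g A] in auto)
qed simp

lemma borel_measurable_lebesgue_on_AE:
  fixes v v0 :: "'a::euclidean_space \<Rightarrow> 'b::euclidean_space"
  assumes [measurable]: "v0 \<in> borel_measurable borel" "S \<in> sets borel"
    and ae: "AE x in lborel. x \<in> S \<longrightarrow> v x = v0 x"
  shows "v \<in> borel_measurable (lebesgue_on S)"
proof (rule borel_measurable_if_D, rule borel_measurable_lebesgue_AE)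
  have "(\<lambda>x. if x \<in> S then v0 x else 0) \<in> borel_measurable borel" by measurable
  then show "(\<lambda>x. if x \<in> S then v0 x else 0) \<in> borel_measurable lebesgue"
    by (simp add: measurable_completion)
  show "AE x in lborel. (if x \<in> S then v x else 0) = (if x \<in> S then v0 x else 0)"
    using ae by eventually_elim auto
qed

lemma AE_lebesgue_onI:
  assumes "S \<in> sets borel" "AE x in lborel. x \<in> S \<longrightarrow> P x"
  shows "AE x in lebesgue_on S. P x"
  using AE_completion[OF assms(2)] assms(1) by (subst AE_restrict_space_iff) auto

lemma integrable_lebesgue_on_iff:
  fixes F F0 :: "'a::euclidean_space \<Rightarrow> 'b::euclidean_space"
  assumes [measurable]: "F0 \<in> borel_measurable borel" "S \<in> sets borel"
    and ae: "AE x in lborel. x \<in> S \<longrightarrow> F x = F0 x"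
  shows "integrable (lebesgue_on S) F \<longleftrightarrow> integrable lborel (\<lambda>x. indicator S x *\<^sub>R F0 x)"
    and "integral\<^sup>L (lebesgue_on S) F = (\<integral>x. indicator S x *\<^sub>R F0 x \<partial>lborel)"
proof -
  have m: "F \<in> borel_measurable (lebesgue_on S)" "F0 \<in> borel_measurable (lebesgue_on S)"
    using ae by (auto intro!: borel_measurable_lebesgue_on_AE[of F0])
  have ae': "AE x in lebesgue_on S. F x = F0 x" by (rule AE_lebesgue_onI[OF _ ae]) simp
  have b: "(\<lambda>x. indicator S x *\<^sub>R F0 x) \<in> borel_measurable lborel" by measurable
  show "integrable (lebesgue_on S) F \<longleftrightarrow> integrable lborel (\<lambda>x. indicator S x *\<^sub>R F0 x)"
    using integrable_cong_AE[OF m ae'] integrable_completion[OF b]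
    by (simp add: integrable_restrict_space)
  show "integral\<^sup>L (lebesgue_on S) F = (\<integral>x. indicator S x *\<^sub>R F0 x \<partial>lborel)"
    using integral_cong_AE[OF m ae'] integral_completion[OF b]
    by (simp add: integral_restrict_space)
qed

lemma integral_lebesgue_on_eq:
  fixes F F0 :: "'a::euclidean_space \<Rightarrow> 'b::euclidean_space"
  assumes "F0 \<in> borel_measurable borel" "S \<in> sets borel"
    and "AE x in lborel. x \<in> S \<longrightarrow> F x = F0 x" and "\<And>x. x \<notin> S \<Longrightarrow> F0 x = 0"
  shows "integral\<^sup>L (lebesgue_on S) F = (\<integral>x. F0 x \<partial>lborel)"
proof -
  have "(\<lambda>x. indicator S x *\<^sub>R F0 x) = F0" using assms(4) by (auto split: split_indicator)
  then show ?thesis using integrable_lebesgue_on_iff(2)[OF assms(1-3)] by simp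
qed

lemma Lp_on_iff:
  fixes v v0 :: "'a::euclidean_space \<Rightarrow> 'b::euclidean_space"
  assumes [measurable]: "v0 \<in> borel_measurable borel" "S \<in> sets borel"
    and ae: "AE x in lborel. x \<in> S \<longrightarrow> v x = v0 x"
  shows "v \<in> Lp_on m S \<longleftrightarrow> (\<integral>\<^sup>+x\<in>S. ennreal (norm (v0 x) powr m) \<partial>lborel) < \<infinity>"
proof -
  have m: "v \<in> borel_measurable (lebesgue_on S)"
    by (rule borel_measurable_lebesgue_on_AE[OF _ _ ae]) auto
  have ae': "AE x in lborel. x \<in> S \<longrightarrow> norm (v x) powr m = norm (v0 x) powr m"
    using ae by eventually_elim auto
  have "(\<lambda>x. norm (v0 x) powr m) \<in> borel_measurable borel" by measurable
  from integrable_lebesgue_on_iff(1)[OF this _ ae']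
  have "integrable (lebesgue_on S) (\<lambda>x. norm (v x) powr m) \<longleftrightarrow> integrable lborel (\<lambda>x. indicator S x *\<^sub>R norm (v0 x) powr m)"
    by simp
  also have "\<dots> \<longleftrightarrow> (\<integral>\<^sup>+x. ennreal (norm (indicator S x *\<^sub>R norm (v0 x) powr m)) \<partial>lborel) < \<infinity>"
    unfolding integrable_iff_bounded by simp
  also have "(\<integral>\<^sup>+x. ennreal (norm (indicator S x *\<^sub>R norm (v0 x) powr m)) \<partial>lborel)
      = (\<integral>\<^sup>+x\<in>S. ennreal (norm (v0 x) powr m) \<partial>lborel)"
    by (intro nn_integral_cong) (auto split: split_indicator)
  finally show ?thesis using m by (simp add: Lp_on_def)
qed

lemma borel_representative:
  fixes v :: "'a::euclidean_space \<Rightarrow> 'b::euclidean_space"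
  assumes v: "v \<in> borel_measurable lebesgue"
  shows "\<exists>v0\<in>borel_measurable borel. AE x in lborel. v x = v0 x"
proof -
  have "\<exists>g\<in>borel_measurable lborel. AE x in lborel. v x \<bullet> i = g x" for i
    using v by (intro completion_ex_borel_measurable_real borel_measurable_inner) auto
  then obtain g where g: "\<And>i. g i \<in> borel_measurable lborel" "\<And>i. AE x in lborel. v x \<bullet> i = g i x"
    by metis
  note [measurable] = g(1)
  show ?thesis
  proof (intro bexI[of _ "\<lambda>x. \<Sum>i\<in>Basis. g i x *\<^sub>R i"])
    have "AE x in lborel. \<forall>i\<in>Basis. v x \<bullet> i = g i x"
      using g(2) by (subst AE_finite_all) auto
    then show "AE x in lborel. v x = (\<Sum>i\<in>Basis. g i x *\<^sub>R i)"
      by eventually_elim (metis (no_types, lifting) euclidean_representation sum.cong)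
    show "(\<lambda>x. \<Sum>i\<in>Basis. g i x *\<^sub>R i) \<in> borel_measurable borel"
      using g(1) by (intro borel_measurable_sum borel_measurable_scaleR) auto
  qed
qed

text \<open>Local integrability controls the function on compact subsets only; measurability on all of
  \<open>\<Omega>\<close> comes from a compact exhaustion.\<close>

lemma Lp_loc_representative:
  fixes v :: "'a::euclidean_space \<Rightarrow> 'b::euclidean_space"
  assumes v: "v \<in> Lp_loc m \<Omega>" and Om: "open \<Omega>"
  shows "\<exists>v0. loc_pow m \<Omega> v0 \<and> (AE x in lborel. x \<in> \<Omega> \<longrightarrow> v x = v0 x)"
proof -
  obtain C where C: "\<And>n. compact (C n)" "\<And>n. C n \<subseteq> \<Omega>" "\<And>n. C n \<subseteq> interior (C (Suc n))"
      "(\<Union>n::nat. C n) = \<Omega>" "\<And>K. compact K \<Longrightarrow> K \<subseteq> \<Omega> \<Longrightarrow> \<exists>N. \<forall>n\<ge>N. K \<subseteq> C n"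
    using open_Union_compact_subsets[OF Om] by metis
  have "(\<lambda>x. if x \<in> C n then v x else 0) \<in> borel_measurable lebesgue" for n
    using v C(1,2)[of n] by (intro borel_measurable_if_I) (auto simp: Lp_loc_def Lp_on_def borel_compact)
  then have "(\<lambda>x. if x \<in> \<Omega> then v x else 0) \<in> borel_measurable lebesgue"
  proof (rule borel_measurable_LIMSEQ_metric)
    fix x
    show "(\<lambda>n. if x \<in> C n then v x else 0) \<longlonglongrightarrow> (if x \<in> \<Omega> then v x else 0)"
    proof (cases "x \<in> \<Omega>")
      case True
      then obtain N where "\<And>n. n \<ge> N \<Longrightarrow> x \<in> C n" using C(5)[of "{x}"] by auto
      then show ?thesis using True
        by (intro tendsto_eventually) (auto simp: eventually_sequentially)
    next
      case False
      then have "x \<notin> C n" for n using C(2) by auto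
      then show ?thesis using False by simp
    qed
  qed
  from borel_representative[OF this] obtain v0 where v0: "v0 \<in> borel_measurable borel"
      "AE x in lborel. (if x \<in> \<Omega> then v x else 0) = v0 x" by blast
  from v0(2) have ae: "AE x in lborel. x \<in> \<Omega> \<longrightarrow> v x = v0 x" by eventually_elim auto
  have "(\<integral>\<^sup>+x\<in>K. ennreal (norm (v0 x) powr m) \<partial>lborel) < \<infinity>" if K: "compact K" "K \<subseteq> \<Omega>" for K
  proof -
    from ae have ae': "AE x in lborel. x \<in> K \<longrightarrow> v x = v0 x" by eventually_elim (use K in auto)
    have "v \<in> Lp_on m K" using v K by (auto simp: Lp_loc_def)
    then show ?thesis using Lp_on_iff[OF v0(1) borel_compact[OF K(1)] ae'] by simp
  qed
  then show ?thesis using v0(1) ae by (auto simp: loc_pow_def)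
qed

lemma Lp_locI:
  fixes v v0 :: "'a::euclidean_space \<Rightarrow> 'b::euclidean_space"
  assumes "loc_pow m \<Omega> v0" and ae: "AE x in lborel. x \<in> \<Omega> \<longrightarrow> v x = v0 x"
  shows "v \<in> Lp_loc m \<Omega>"
  unfolding Lp_loc_def
proof safe
  fix K assume K: "compact K" "K \<subseteq> \<Omega>"
  from ae have ae': "AE x in lborel. x \<in> K \<longrightarrow> v x = v0 x" by eventually_elim (use K in auto)
  show "v \<in> Lp_on m K"
    using Lp_on_iff[OF loc_powD(1)[OF assms(1)] borel_compact[OF K(1)] ae'] loc_powD(2)[OF assms(1) K] by simp
qed

lemma weak_gradient_iff:
  fixes u u0 :: "'a::euclidean_space \<Rightarrow> real" and G G0 :: "'a \<Rightarrow> 'a"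
  assumes u0: "loc_pow 1 \<Omega> u0" and G0: "loc_pow 1 \<Omega> G0" and Om: "open \<Omega>"
    and ae: "AE x in lborel. x \<in> \<Omega> \<longrightarrow> u x = u0 x" "AE x in lborel. x \<in> \<Omega> \<longrightarrow> G x = G0 x"
  shows "weak_gradient \<Omega> u G \<longleftrightarrow> wgrad \<Omega> u0 G0"
proof -
  have [measurable]: "u0 \<in> borel_measurable borel" "G0 \<in> borel_measurable borel" "\<Omega> \<in> sets borel"
    using u0 G0 Om by (auto intro: loc_powD)
  have tr: "integral\<^sup>L (lebesgue_on \<Omega>) (\<lambda>x. u x * frechet_derivative \<psi> (at x) i) = (\<integral>x. u0 x *\<^sub>R grad \<psi> x \<partial>lborel) \<bullet> i"
    "integral\<^sup>L (lebesgue_on \<Omega>) (\<lambda>x. (G x \<bullet> i) * \<psi> x) = (\<integral>x. \<psi> x *\<^sub>R G0 x \<partial>lborel) \<bullet> i"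
    if psi: "\<psi> \<in> test_functions \<Omega>" and i: "i \<in> Basis" for \<psi> i
  proof -
    obtain S where S: "S \<subseteq> \<Omega>" "\<And>x. x \<notin> S \<Longrightarrow> \<psi> x = 0" "\<And>x. x \<notin> S \<Longrightarrow> grad \<psi> x = 0"
      by (rule test_functionsE[OF psi]) blast
    have off: "\<psi> x = 0" "grad \<psi> x = 0" if "x \<notin> \<Omega>" for x using S that by auto
    note [measurable] = test_function_props(4,5)[OF psi]
    have int: "integrable lborel (\<lambda>x. u0 x *\<^sub>R grad \<psi> x)" "integrable lborel (\<lambda>x. \<psi> x *\<^sub>R G0 x)"
      using integrable_test(2)[OF psi, of 0 \<Omega> u0] integrable_test(1)[OF psi, of 0 \<Omega> G0] u0 G0 by auto
    have "integral\<^sup>L (lebesgue_on \<Omega>) (\<lambda>x. u x * frechet_derivative \<psi> (at x) i) = (\<integral>x. (u0 x *\<^sub>R grad \<psi> x) \<bullet> i \<partial>lborel)"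
    proof (rule integral_lebesgue_on_eq)
      show "AE x in lborel. x \<in> \<Omega> \<longrightarrow> u x * frechet_derivative \<psi> (at x) i = (u0 x *\<^sub>R grad \<psi> x) \<bullet> i"
        using ae(1) by eventually_elim (simp add: grad_inner_Basis[OF i])
    qed (use off in auto)
    then show "integral\<^sup>L (lebesgue_on \<Omega>) (\<lambda>x. u x * frechet_derivative \<psi> (at x) i) = (\<integral>x. u0 x *\<^sub>R grad \<psi> x \<partial>lborel) \<bullet> i"
      using integral_inner_left[OF int(1), of i] by simp
    have "integral\<^sup>L (lebesgue_on \<Omega>) (\<lambda>x. (G x \<bullet> i) * \<psi> x) = (\<integral>x. (\<psi> x *\<^sub>R G0 x) \<bullet> i \<partial>lborel)"
    proof (rule integral_lebesgue_on_eq)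
      show "AE x in lborel. x \<in> \<Omega> \<longrightarrow> (G x \<bullet> i) * \<psi> x = (\<psi> x *\<^sub>R G0 x) \<bullet> i"
        using ae(2) by eventually_elim simp
    qed (use off in auto)
    then show "integral\<^sup>L (lebesgue_on \<Omega>) (\<lambda>x. (G x \<bullet> i) * \<psi> x) = (\<integral>x. \<psi> x *\<^sub>R G0 x \<partial>lborel) \<bullet> i"
      using integral_inner_left[OF int(2), of i] by simp
  qed
  have "u \<in> Lp_loc 1 \<Omega>" "G \<in> Lp_loc 1 \<Omega>"
    using Lp_locI[OF u0 ae(1)] Lp_locI[OF G0 ae(2)] by auto
  then have "weak_gradient \<Omega> u G \<longleftrightarrow> (\<forall>\<psi>\<in>test_functions \<Omega>. \<forall>i\<in>Basis.
      (\<integral>x. u0 x *\<^sub>R grad \<psi> x \<partial>lborel) \<bullet> i = - ((\<integral>x. \<psi> x *\<^sub>R G0 x \<partial>lborel) \<bullet> i))"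
    unfolding weak_gradient_def by (simp add: tr cong: ball_cong)
  also have "\<dots> \<longleftrightarrow> wgrad \<Omega> u0 G0"
    unfolding wgrad_def by (subst euclidean_eq_iff) simp
  finally show ?thesis .
qed

lemma wgrad_unique:
  fixes u :: "'a::euclidean_space \<Rightarrow> real"
  assumes W: "wgrad \<Omega> u G" "wgrad \<Omega> u H" and Om: "open \<Omega>"
    and u: "loc_pow 1 \<Omega> u" and G: "loc_pow 1 \<Omega> G" and H: "loc_pow 1 \<Omega> H"
  shows "AE x in lborel. x \<in> \<Omega> \<longrightarrow> G x = H x"
proof -
  have GH: "loc_pow 1 \<Omega> (\<lambda>x. G x - H x)" by (rule loc_pow_diff[OF G H]) simp
  then have [measurable]: "(\<lambda>x. G x - H x) \<in> borel_measurable borel" by (rule loc_powD)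
  have "AE x in lborel. x \<in> \<Omega> \<longrightarrow> (G x - H x) \<bullet> i = 0" if i: "i \<in> Basis" for i
  proof (rule fundamental_lemma[OF _ Om])
    show "loc_pow 1 \<Omega> (\<lambda>x. (G x - H x) \<bullet> i)"
      unfolding loc_pow_def
    proof safe
      fix K assume K: "compact K" "K \<subseteq> \<Omega>"
      have "(\<integral>\<^sup>+x\<in>K. ennreal (norm ((G x - H x) \<bullet> i) powr 1) \<partial>lborel) \<le> (\<integral>\<^sup>+x\<in>K. ennreal (norm (G x - H x) powr 1) \<partial>lborel)"
        using Basis_le_norm[OF i] by (intro nn_integral_mono mult_right_mono ennreal_leI) auto
      also have "\<dots> < \<infinity>" by (rule loc_powD(2)[OF GH K])
      finally show "(\<integral>\<^sup>+x\<in>K. ennreal (norm ((G x - H x) \<bullet> i) powr 1) \<partial>lborel) < \<infinity>" .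
    qed measurable
    fix \<psi> assume psi: "\<psi> \<in> test_functions \<Omega>"
    have int: "integrable lborel (\<lambda>x. \<psi> x *\<^sub>R G x)" "integrable lborel (\<lambda>x. \<psi> x *\<^sub>R H x)"
      using integrable_test(1)[OF psi, of 0 \<Omega> G] integrable_test(1)[OF psi, of 0 \<Omega> H] G H by auto
    have "(\<integral>x. ((G x - H x) \<bullet> i) * \<psi> x \<partial>lborel) = (\<integral>x. (\<psi> x *\<^sub>R G x - \<psi> x *\<^sub>R H x) \<bullet> i \<partial>lborel)"
      by (simp add: inner_diff_left algebra_simps)
    also have "\<dots> = ((\<integral>x. \<psi> x *\<^sub>R G x \<partial>lborel) - (\<integral>x. \<psi> x *\<^sub>R H x \<partial>lborel)) \<bullet> i"
      using int by simp
    also have "\<dots> = 0" using W psi unfolding wgrad_def by (metis diff_self inner_zero_left neg_equal_iff_equal)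
    finally show "(\<integral>x. ((G x - H x) \<bullet> i) * \<psi> x \<partial>lborel) = 0" .
  qed
  then have "AE x in lborel. \<forall>i\<in>Basis. x \<in> \<Omega> \<longrightarrow> (G x - H x) \<bullet> i = 0"
    by (subst AE_finite_all) auto
  then show ?thesis
    by eventually_elim (auto simp: euclidean_eq_iff[of "G _"] inner_diff_left)
qed

section \<open>Besov functions\<close>

lemma AE_lborel_translate:
  fixes P :: "'a::euclidean_space \<Rightarrow> bool"
  assumes "AE x in lborel. P x"
  shows "AE x in lborel. P (x + h)"
proof -
  obtain N where N: "{x. \<not> P x} \<subseteq> N" "N \<in> sets borel" "emeasure lborel N = 0"
    by (rule AE_E[OF assms]) simp
  note [measurable] = N(2)
  have "emeasure lborel {x. x + h \<in> N} = (\<integral>\<^sup>+x. indicator N (h + x) \<partial>lborel)"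
  proof -
    have "emeasure lborel {x. x + h \<in> N} = (\<integral>\<^sup>+x. indicator {x. x + h \<in> N} x \<partial>lborel)"
      by (subst nn_integral_indicator) auto
    also have "\<dots> = (\<integral>\<^sup>+x. indicator N (h + x) \<partial>lborel)"
      by (intro nn_integral_cong) (auto simp: add.commute split: split_indicator)
    finally show ?thesis .
  qed
  also have "\<dots> = emeasure lborel N" by (subst nn_integral_translate) auto
  finally have "emeasure lborel {x. x + h \<in> N} = 0" using N by simp
  then show ?thesis
    by (intro AE_I[of _ _ "{x. x + h \<in> N}"]) (use N in auto)
qed

lemma Lp_on_subset:
  fixes v :: "'a::euclidean_space \<Rightarrow> 'b::euclidean_space"
  assumes v: "v \<in> Lp_on m UNIV" and K: "K \<in> sets borel" and eq: "\<And>x. x \<in> K \<Longrightarrow> v x = w x"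
  shows "w \<in> Lp_on m K"
proof -
  have "v \<in> borel_measurable lebesgue" using v by (auto simp: Lp_on_def lebesgue_on_UNIV_eq)
  from borel_representative[OF this] obtain v0 where v0: "v0 \<in> borel_measurable borel" "AE x in lborel. v x = v0 x" by blast
  have "(\<integral>\<^sup>+x. ennreal (norm (v0 x) powr m) \<partial>lborel) < \<infinity>"
    using Lp_on_iff[OF v0(1), of UNIV v m] v0(2) v by simp
  then have "(\<integral>\<^sup>+x\<in>K. ennreal (norm (v0 x) powr m) \<partial>lborel) < \<infinity>"
    by (rule order_le_less_trans[rotated]) (auto intro!: nn_integral_mono split: split_indicator)
  moreover have "AE x in lborel. x \<in> K \<longrightarrow> w x = v0 x"
    using v0(2) by eventually_elim (use eq in auto)
  ultimately show ?thesis using Lp_on_iff[OF v0(1) K] by blast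
qed

lemma Besov_loc_imp_Lp_loc:
  assumes f: "f \<in> Besov_loc \<beta> m \<Omega>" and Om: "open \<Omega>"
  shows "f \<in> Lp_loc m \<Omega>"
  unfolding Lp_loc_def
proof safe
  fix K assume K: "compact K" "K \<subseteq> \<Omega>"
  obtain \<eta> where eta: "\<eta> \<in> test_functions \<Omega>" "\<And>x. x \<in> K \<Longrightarrow> \<eta> x = 1"
    by (rule exists_cutoff[OF K(1) Om K(2)]) blast
  have "(\<lambda>x. \<eta> x * f x) \<in> Lp_on m UNIV" using f eta by (auto simp: Besov_loc_def Besov_def)
  then show "f \<in> Lp_on m K" by (rule Lp_on_subset) (use K eta in \<open>auto intro: borel_compact\<close>)
qed

text \<open>The bound in the Besov condition is on a Bochner integral, which would be zero for a
  divergent integrand. Membership in \<open>Lp_on\<close> rules this out, so the bound passes to the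
  nonnegative integral.\<close>

lemma Besov_difference_bound:
  fixes v v0 :: "'a::euclidean_space \<Rightarrow> real"
  assumes v: "v \<in> Besov \<beta> m" and [measurable]: "v0 \<in> borel_measurable borel" and ae: "AE x in lborel. v x = v0 x"
    and m: "m \<ge> 1"
  shows "\<exists>C\<ge>0. \<forall>h. (\<integral>\<^sup>+x. ennreal (\<bar>v0 (x + h) - v0 x\<bar> powr m) \<partial>lborel) \<le> ennreal (C * norm h powr (\<beta> * m))"
proof -
  obtain B where B: "\<And>h. h \<noteq> 0 \<Longrightarrow> (integral\<^sup>L lebesgue
        (\<lambda>x. \<bar>v (x + h) - v x\<bar> powr m / norm h powr (\<beta> * m))) powr (1 / m) \<le> B"
    using v unfolding Besov_def bdd_above_def by fastforce
  have fin: "(\<integral>\<^sup>+x. ennreal (norm (v0 x) powr m) \<partial>lborel) < \<infinity>"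
    using v Lp_on_iff[of v0 UNIV v m] ae by (simp add: Besov_def)
  then have L: "loc_pow m UNIV v0"
    unfolding loc_pow_def by (auto intro: order_le_less_trans[rotated] intro!: nn_integral_mono split: split_indicator)
  define C where "C = max 0 B powr m"
  have "(\<integral>\<^sup>+x. ennreal (\<bar>v0 (x + h) - v0 x\<bar> powr m) \<partial>lborel) \<le> ennreal (C * norm h powr (\<beta> * m))" for h
  proof (cases "h = 0")
    case True
    then show ?thesis by simp
  next
    case False
    have fin': "(\<integral>\<^sup>+x. ennreal (\<bar>v0 (x + h) - v0 x\<bar> powr m) \<partial>lborel) < \<infinity>"
    proof -
      have pt: "\<bar>v0 (x + h) - v0 x\<bar> powr m \<le> 2 powr m * \<bar>v0 (h + x)\<bar> powr m + 2 powr m * \<bar>v0 x\<bar> powr m" for x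
        using powr_norm_add_le[of m "v0 (h + x)" "- v0 x"] m by (simp add: add.commute)
      have "(\<integral>\<^sup>+x. ennreal (\<bar>v0 (x + h) - v0 x\<bar> powr m) \<partial>lborel)
        \<le> (\<integral>\<^sup>+x. ennreal (2 powr m) * ennreal (\<bar>v0 (h + x)\<bar> powr m) + ennreal (2 powr m) * ennreal (\<bar>v0 x\<bar> powr m) \<partial>lborel)"
        using ennreal_leI[OF pt] by (intro nn_integral_mono) (simp add: ennreal_plus ennreal_mult)
      also have "\<dots> = ennreal (2 powr m) * (\<integral>\<^sup>+x. ennreal (\<bar>v0 (h + x)\<bar> powr m) \<partial>lborel)
          + ennreal (2 powr m) * (\<integral>\<^sup>+x. ennreal (\<bar>v0 x\<bar> powr m) \<partial>lborel)"
        by (simp add: nn_integral_add nn_integral_cmult)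
      also have "(\<integral>\<^sup>+x. ennreal (\<bar>v0 (h + x)\<bar> powr m) \<partial>lborel) = (\<integral>\<^sup>+x. ennreal (\<bar>v0 x\<bar> powr m) \<partial>lborel)"
        by (rule nn_integral_translate) measurable
      also have "ennreal (2 powr m) * (\<integral>\<^sup>+x. ennreal (\<bar>v0 x\<bar> powr m) \<partial>lborel)
          + ennreal (2 powr m) * (\<integral>\<^sup>+x. ennreal (\<bar>v0 x\<bar> powr m) \<partial>lborel) < \<infinity>"
        using fin by (simp add: ennreal_mult_less_top less_top)
      finally show ?thesis .
    qed
    have int: "integrable lborel (\<lambda>x. \<bar>v0 (x + h) - v0 x\<bar> powr m)"
      using fin' by (intro integrableI_nonneg) auto
    define I where "I = (\<integral>x. \<bar>v0 (x + h) - v0 x\<bar> powr m \<partial>lborel)"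
    have I0: "I \<ge> 0" by (simp add: I_def)
    have hp: "norm h powr (\<beta> * m) > 0" using False by simp
    have "integral\<^sup>L lebesgue (\<lambda>x. \<bar>v (x + h) - v x\<bar> powr m / norm h powr (\<beta> * m))
        = (\<integral>x. \<bar>v0 (x + h) - v0 x\<bar> powr m / norm h powr (\<beta> * m) \<partial>lborel)"
    proof -
      have "AE x in lborel. x \<in> UNIV \<longrightarrow> \<bar>v (x + h) - v x\<bar> powr m / norm h powr (\<beta> * m)
          = \<bar>v0 (x + h) - v0 x\<bar> powr m / norm h powr (\<beta> * m)"
        using ae AE_lborel_translate[OF ae, of h] by eventually_elim simp
      from integral_lebesgue_on_eq[OF _ _ this] show ?thesis by (simp add: lebesgue_on_UNIV_eq)
    qed
    also have "\<dots> = I / norm h powr (\<beta> * m)" by (simp add: I_def)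
    finally have "(I / norm h powr (\<beta> * m)) powr (1 / m) \<le> B" using B[OF False] by (simp only:)
    then have le: "(I / norm h powr (\<beta> * m)) powr (1 / m) \<le> max 0 B" by simp
    have "I / norm h powr (\<beta> * m) = ((I / norm h powr (\<beta> * m)) powr (1 / m)) powr m"
      using m I0 by (simp add: powr_powr)
    also have "\<dots> \<le> C" unfolding C_def using m le by (intro powr_mono2) auto
    finally have "I \<le> C * norm h powr (\<beta> * m)" using hp by (simp add: divide_le_eq)
    then show ?thesis
      using nn_integral_eq_integral[OF int] by (simp add: I_def ennreal_leI)
  qed
  then show ?thesis by (intro exI[of _ C]) (auto simp: C_def)
qed

text \<open>A cutoff equal to one on a neighbourhood of \<open>K\<close> does not affect differences by small \<open>h\<close> on \<open>K\<close>.\<close>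

lemma Besov_loc_difference_bound:
  fixes f f0 :: "'a::euclidean_space \<Rightarrow> real"
  assumes f: "f \<in> Besov_loc \<beta> m \<Omega>" and Om: "open \<Omega>" and f0: "loc_pow m \<Omega> f0"
    and ae: "AE x in lborel. x \<in> \<Omega> \<longrightarrow> f x = f0 x" and m: "m \<ge> 1" and K: "compact K" "K \<subseteq> \<Omega>"
  shows "difference_bound (\<beta> * m) K (\<lambda>h x. \<bar>f0 (x + h) - f0 x\<bar> powr m)"
proof -
  have [measurable]: "f0 \<in> borel_measurable borel" using f0 by (rule loc_powD)
  obtain \<epsilon> where e: "\<epsilon> > 0" "thicken K \<epsilon> \<subseteq> \<Omega>"
    using compact_subset_open_imp_cball_epsilon_subset[OF K(1) Om K(2)] unfolding thicken_def by blast
  obtain \<eta> where eta: "\<eta> \<in> test_functions \<Omega>" "\<And>x. x \<in> thicken K \<epsilon> \<Longrightarrow> \<eta> x = 1"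
    by (rule exists_cutoff[OF compact_thicken[OF K(1)] Om e(2)]) blast
  note [measurable] = test_function_props(4)[OF eta(1)]
  have off: "\<eta> x = 0" if "x \<notin> \<Omega>" for x
    using that test_functionsE[OF eta(1)] by (metis subsetD)
  have "(\<lambda>x. \<eta> x * f x) \<in> Besov \<beta> m" using f eta by (auto simp: Besov_loc_def)
  moreover have "AE x in lborel. \<eta> x * f x = \<eta> x * f0 x"
    using ae by eventually_elim (use off in auto)
  ultimately obtain C where C: "C \<ge> 0" "\<And>h. (\<integral>\<^sup>+x. ennreal (\<bar>\<eta> (x + h) * f0 (x + h) - \<eta> x * f0 x\<bar> powr m) \<partial>lborel)
      \<le> ennreal (C * norm h powr (\<beta> * m))"
    using Besov_difference_bound[of "\<lambda>x. \<eta> x * f x" \<beta> m "\<lambda>x. \<eta> x * f0 x"] m by auto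
  have "(\<integral>\<^sup>+x\<in>K. ennreal (\<bar>f0 (x + h) - f0 x\<bar> powr m) \<partial>lborel) \<le> ennreal (C * norm h powr (\<beta> * m))"
    if h: "norm h < \<epsilon>" for h
  proof -
    have "x \<in> thicken K \<epsilon>" "x + h \<in> thicken K \<epsilon>" if "x \<in> K" for x
      using that h e by (auto simp: thicken_iff dist_norm intro!: bexI[of _ x])
    then have "(\<integral>\<^sup>+x\<in>K. ennreal (\<bar>f0 (x + h) - f0 x\<bar> powr m) \<partial>lborel)
      \<le> (\<integral>\<^sup>+x. ennreal (\<bar>\<eta> (x + h) * f0 (x + h) - \<eta> x * f0 x\<bar> powr m) \<partial>lborel)"
      using eta(2) by (intro nn_integral_mono) (auto split: split_indicator)
    then show ?thesis using C(2)[of h] by simp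
  qed
  then show ?thesis unfolding difference_bound_def using C(1) e(1) by blast
qed

section \<open>Higher integrability\<close>

theorem corollary4p2:
  fixes \<Omega> :: "(real ^ 'n) set"
    and f u :: "real ^ 'n \<Rightarrow> real"
    and Du :: "real ^ 'n \<Rightarrow> real ^ 'n"
    and q p \<alpha> :: real
  assumes "CARD('n) \<ge> 2"
    and "open \<Omega>" and "connected \<Omega>" and "bounded \<Omega>" and "\<Omega> \<noteq> {}"
    and "q \<ge> 2" and "p = q / (q - 1)"
    and "0 < \<alpha>" and "\<alpha> < 1"
    and "f \<in> Besov_loc \<alpha> p \<Omega>"
    and "local_weak_solution \<Omega> q f u"
    and "weak_gradient \<Omega> u Du"
  shows "(\<forall>r. 1 \<le> r \<and> r < 2 * real CARD('n) / (real CARD('n) - \<alpha> - 1) \<longrightarrow>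
             (\<lambda>x. H_field (q / 2) (Du x)) \<in> Lp_loc r \<Omega>) \<and>
         (\<forall>s. 1 \<le> s \<and> s < real CARD('n) * q / (real CARD('n) - \<alpha> - 1) \<longrightarrow>
             Du \<in> Lp_loc s \<Omega>)"
proof -
  note Om = \<open>open \<Omega>\<close> and q = \<open>q \<ge> 2\<close> and p = \<open>p = q / (q - 1)\<close> and al = \<open>0 < \<alpha>\<close> \<open>\<alpha> < 1\<close>
  note pq = conjugate_exponent[OF q p]
  have q1: "1 \<le> q" "0 \<le> q" using q by auto
  have sol: "u \<in> W1_loc q \<Omega>" "\<And>\<phi> D\<phi>. \<phi> \<in> W1 q \<Omega> \<Longrightarrow> compact_support_in \<Omega> \<phi> \<Longrightarrow> weak_gradient \<Omega> \<phi> D\<phi> \<Longrightarrow>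
        integral\<^sup>L (lebesgue_on \<Omega>) (\<lambda>x. H_field (q - 1) (Du x) \<bullet> D\<phi> x) =
        integral\<^sup>L (lebesgue_on \<Omega>) (\<lambda>x. f x * \<phi> x)"
    using assms(11,12) by (auto simp: local_weak_solution_def)
  obtain Gq where Gq: "weak_gradient \<Omega> u Gq" "Gq \<in> Lp_loc q \<Omega>" and uq: "u \<in> Lp_loc q \<Omega>"
    using sol(1) by (auto simp: W1_loc_def)
  obtain u0 where u0: "loc_pow q \<Omega> u0" "AE x in lborel. x \<in> \<Omega> \<longrightarrow> u x = u0 x"
    using Lp_loc_representative[OF uq Om] by blast
  obtain G where G: "loc_pow q \<Omega> G" "AE x in lborel. x \<in> \<Omega> \<longrightarrow> Gq x = G x"
    using Lp_loc_representative[OF Gq(2) Om] by blast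
  obtain f0 where f0: "loc_pow p \<Omega> f0" "AE x in lborel. x \<in> \<Omega> \<longrightarrow> f x = f0 x"
    using Lp_loc_representative[OF Besov_loc_imp_Lp_loc[OF assms(10) Om] Om] by blast
  have "Du \<in> Lp_loc 1 \<Omega>" using assms(12) by (simp add: weak_gradient_def)
  then obtain G1 where G1: "loc_pow 1 \<Omega> G1" "AE x in lborel. x \<in> \<Omega> \<longrightarrow> Du x = G1 x"
    using Lp_loc_representative[OF _ Om] by blast
  have u1: "loc_pow 1 \<Omega> u0" and Gl: "loc_pow 1 \<Omega> G"
    using q1 by (auto intro: loc_pow_mono[OF u0(1)] loc_pow_mono[OF G(1)])
  have W: "wgrad \<Omega> u0 G" using weak_gradient_iff[OF u1 Gl Om u0(2) G(2)] Gq(1) by simp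
  have W1: "wgrad \<Omega> u0 G1" using weak_gradient_iff[OF u1 G1(1) Om u0(2) G1(2)] assms(12) by simp
  \<comment> \<open>The given gradient is only locally integrable a priori; uniqueness identifies it with the
    one in \<open>Lp_loc q \<Omega>\<close> that membership in the Sobolev space provides.\<close>
  have DuG: "AE x in lborel. x \<in> \<Omega> \<longrightarrow> Du x = G x"
    using G1(2) wgrad_unique[OF W1 W Om u1 G1(1) Gl] by eventually_elim auto
  have [measurable]: "G \<in> borel_measurable borel" "f0 \<in> borel_measurable borel" "\<Omega> \<in> sets borel"
    using G f0 Om by (auto intro: loc_powD)
  have eq: "(\<integral>x. H_field (q - 1) (G x) \<bullet> D x \<partial>lborel) = (\<integral>x. f0 x * \<phi> x \<partial>lborel)"
    if w: "wgrad \<Omega> \<phi> D" and phi: "loc_pow q UNIV \<phi>" and D: "loc_pow q UNIV D"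
      and S: "compact S" "S \<subseteq> \<Omega>" and off: "\<And>x. x \<notin> S \<Longrightarrow> \<phi> x = 0" "\<And>x. x \<notin> S \<Longrightarrow> D x = 0" for \<phi> D S
  proof -
    have [measurable]: "\<phi> \<in> borel_measurable borel" "D \<in> borel_measurable borel"
      using phi D by (auto intro: loc_powD)
    have off': "\<phi> x = 0" "D x = 0" if "x \<notin> \<Omega>" for x using off S that by auto
    have Lq: "v \<in> Lp_on q \<Omega>" if v: "loc_pow q UNIV v" and o: "\<And>x. x \<notin> S \<Longrightarrow> v x = 0" for v :: "real ^ 'n \<Rightarrow> 'c::euclidean_space"
    proof -
      have "(\<integral>\<^sup>+x\<in>\<Omega>. ennreal (norm (v x) powr q) \<partial>lborel) \<le> (\<integral>\<^sup>+x\<in>S. ennreal (norm (v x) powr q) \<partial>lborel)"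
        using o by (intro nn_integral_mono) (auto split: split_indicator)
      also have "\<dots> < \<infinity>" using loc_powD(2)[OF v S(1)] by simp
      finally show ?thesis using Lp_on_iff[OF loc_powD(1)[OF v], of \<Omega> v q] by simp
    qed
    have "loc_pow 1 \<Omega> \<phi>" "loc_pow 1 \<Omega> D"
      using loc_pow_subset[OF loc_pow_mono[OF phi, of 1], of \<Omega>] loc_pow_subset[OF loc_pow_mono[OF D, of 1], of \<Omega>] q1 by auto
    then have wg: "weak_gradient \<Omega> \<phi> D" using weak_gradient_iff[OF _ _ Om, of \<phi> D \<phi> D] w by simp
    have W1: "\<phi> \<in> W1 q \<Omega>" using Lq[OF phi off(1)] Lq[OF D off(2)] wg by (auto simp: W1_def)
    have cs: "compact_support_in \<Omega> \<phi>" unfolding compact_support_in_def using S off by (intro exI[of _ S]) auto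
    have "integral\<^sup>L (lebesgue_on \<Omega>) (\<lambda>x. H_field (q - 1) (Du x) \<bullet> D x) = (\<integral>x. H_field (q - 1) (G x) \<bullet> D x \<partial>lborel)"
    proof (rule integral_lebesgue_on_eq)
      show "AE x in lborel. x \<in> \<Omega> \<longrightarrow> H_field (q - 1) (Du x) \<bullet> D x = H_field (q - 1) (G x) \<bullet> D x"
        using DuG by eventually_elim auto
    qed (use off' in auto)
    moreover have "integral\<^sup>L (lebesgue_on \<Omega>) (\<lambda>x. f x * \<phi> x) = (\<integral>x. f0 x * \<phi> x \<partial>lborel)"
    proof (rule integral_lebesgue_on_eq)
      show "AE x in lborel. x \<in> \<Omega> \<longrightarrow> f x * \<phi> x = f0 x * \<phi> x"
        using f0(2) by eventually_elim auto
    qed (use off' in auto)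
    ultimately show ?thesis using sol(2)[OF W1 cs wg] by simp
  qed
  have EQ: "borel_solution \<Omega> q f0 G" unfolding borel_solution_def using eq by blast
  have BES: "difference_bound (\<alpha> * p) K (\<lambda>h x. \<bar>f0 (x + h) - f0 x\<bar> powr p)"
    if "compact K" "K \<subseteq> \<Omega>" for K
    using pq by (intro Besov_loc_difference_bound[OF assms(10) Om f0 _ that]) auto
  define n where "n = real CARD('n)"
  have n2: "n \<ge> 2" using assms(1) by (simp add: n_def)
  define g where "g x = norm (H_field (q/2) (G x))" for x
  have gm [measurable]: "g \<in> borel_measurable borel" unfolding g_def[abs_def] by measurable
  have main: "(\<integral>\<^sup>+x\<in>K. ennreal (g x powr s) \<partial>lborel) < \<infinity>"
    if s: "0 \<le> s" "s < 2 * n / (n - \<alpha> - 1)" and K: "compact K" "K \<subseteq> \<Omega>" for s K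
  proof (rule difference_bound_embedding[OF gm _ Om, where \<beta>="(1 + \<alpha>) / 2"])
    fix K :: "(real ^ 'n) set" assume K: "compact K" "K \<subseteq> \<Omega>"
    have "difference_bound (1 + \<alpha>) K (\<lambda>h x. (norm (H_field (q/2) (G (x + h)) - H_field (q/2) (G x)))\<^sup>2)"
      by (rule energy_estimate[OF Om q p al u0(1) G(1) f0(1) W EQ BES K])
    then obtain C \<delta> where C: "C \<ge> 0" "\<delta> > 0" "\<And>h. norm h < \<delta> \<Longrightarrow>
        (\<integral>\<^sup>+x\<in>K. ennreal ((norm (H_field (q/2) (G (x + h)) - H_field (q/2) (G x)))\<^sup>2) \<partial>lborel)
        \<le> ennreal (C * norm h powr (1 + \<alpha>))"
      unfolding difference_bound_def by blast
    show "difference_bound (2 * ((1 + \<alpha>) / 2)) K (\<lambda>h x. (g (x + h) - g x)\<^sup>2)"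
      unfolding difference_bound_def
    proof (rule exI[of _ C], intro conjI exI[of _ \<delta>] allI impI C(1,2))
      fix h :: "real ^ 'n" assume h: "norm h < \<delta>"
      have "(\<integral>\<^sup>+x\<in>K. ennreal ((g (x + h) - g x)\<^sup>2) \<partial>lborel)
        \<le> (\<integral>\<^sup>+x\<in>K. ennreal ((norm (H_field (q/2) (G (x + h)) - H_field (q/2) (G x)))\<^sup>2) \<partial>lborel)"
      proof (intro nn_integral_mono mult_right_mono ennreal_leI)
        fix x
        have "\<bar>g (x + h) - g x\<bar> \<le> norm (H_field (q/2) (G (x + h)) - H_field (q/2) (G x))"
          unfolding g_def by (rule norm_triangle_ineq3)
        then show "(g (x + h) - g x)\<^sup>2 \<le> (norm (H_field (q/2) (G (x + h)) - H_field (q/2) (G x)))\<^sup>2"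
          by (metis abs_ge_zero power2_abs power_mono)
      qed auto
      also have "\<dots> \<le> ennreal (C * norm h powr (1 + \<alpha>))" by (rule C(3)[OF h])
      also have "1 + \<alpha> = 2 * ((1 + \<alpha>) / 2)" by simp
      finally show "(\<integral>\<^sup>+x\<in>K. ennreal ((g (x + h) - g x)\<^sup>2) \<partial>lborel) \<le> ennreal (C * norm h powr (2 * ((1 + \<alpha>) / 2)))" .
    qed
  next
    fix K :: "(real ^ 'n) set" assume K: "compact K" "K \<subseteq> \<Omega>"
    have "(\<integral>\<^sup>+x\<in>K. ennreal (g x powr 2) \<partial>lborel) \<le> (\<integral>\<^sup>+x\<in>K. ennreal (norm (G x) powr q) \<partial>lborel)"
    proof (intro nn_integral_mono mult_right_mono ennreal_leI)
      fix x
      have "g x powr 2 = excess (G x) powr q" unfolding g_def norm_H_field powr_powr by simp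
      also have "\<dots> \<le> norm (G x) powr q" using q1 excess_le_norm by (intro powr_mono2) auto
      finally show "g x powr 2 \<le> norm (G x) powr q" .
    qed auto
    also have "\<dots> < \<infinity>" by (rule loc_powD(2)[OF G(1) K])
    finally show "(\<integral>\<^sup>+x\<in>K. ennreal (g x powr 2) \<partial>lborel) < \<infinity>" .
  next
    have dim: "real DIM(real ^ 'n) = n" by (simp add: n_def)
    have "n - 2 * ((1 + \<alpha>) / 2) = n - \<alpha> - 1" by (simp add: field_simps)
    then show "s < 2 * real DIM(real ^ 'n) / (real DIM(real ^ 'n) - 2 * ((1 + \<alpha>) / 2))"
      using s(2) unfolding dim by (simp only:)
    show "2 * ((1 + \<alpha>) / 2) < real DIM(real ^ 'n)" using al n2 unfolding dim by simp
  qed (use al s K in \<open>auto simp: g_def\<close>)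
  have V: "(\<lambda>x. H_field (q / 2) (Du x)) \<in> Lp_loc r \<Omega>" if "1 \<le> r" "r < 2 * n / (n - \<alpha> - 1)" for r
  proof (rule Lp_locI)
    show "loc_pow r \<Omega> (\<lambda>x. H_field (q / 2) (G x))"
      unfolding loc_pow_def using main[of r] that by (auto simp: g_def)
    show "AE x in lborel. x \<in> \<Omega> \<longrightarrow> H_field (q / 2) (Du x) = H_field (q / 2) (G x)"
      using DuG by eventually_elim auto
  qed
  have "Du \<in> Lp_loc s \<Omega>" if s: "1 \<le> s" "s < n * q / (n - \<alpha> - 1)" for s
  proof (rule Lp_locI[OF _ DuG])
    have "2 * s / q < 2 * n / (n - \<alpha> - 1)"
      using s q al n2 by (simp add: field_simps)
    then have fin: "(\<integral>\<^sup>+x\<in>K. ennreal (g x powr (2 * s / q)) \<partial>lborel) < \<infinity>" if "compact K" "K \<subseteq> \<Omega>" for K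
      using main[OF _ _ that] s q by simp
    have pt: "norm (G x) powr s \<le> 2 powr s + 2 powr s * g x powr (2 * s / q)" for x
    proof -
      have "norm (G x) \<le> 2 * max 1 (excess (G x))" by (simp add: excess_def max_def)
      then have "norm (G x) powr s \<le> (2 * max 1 (excess (G x))) powr s" using s by (intro powr_mono2) auto
      also have "\<dots> = 2 powr s * max 1 (excess (G x)) powr s" by (simp add: powr_mult)
      also have "\<dots> \<le> 2 powr s + 2 powr s * excess (G x) powr s" by (auto simp: max_def)
      also have "excess (G x) powr s = g x powr (2 * s / q)"
        using q by (simp add: g_def norm_H_field powr_powr)
      finally show ?thesis .
    qed
    show "loc_pow s \<Omega> G"
      unfolding loc_pow_def
    proof safe
      fix K :: "(real ^ 'n) set" assume K: "compact K" "K \<subseteq> \<Omega>"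
      have [measurable]: "K \<in> sets borel" using K by (simp add: borel_compact)
      have "(\<integral>\<^sup>+x\<in>K. ennreal (norm (G x) powr s) \<partial>lborel)
        \<le> (\<integral>\<^sup>+x. ennreal (2 powr s) * indicator K x + ennreal (2 powr s) * (ennreal (g x powr (2 * s / q)) * indicator K x) \<partial>lborel)"
      proof (rule nn_integral_mono)
        fix x
        show "ennreal (norm (G x) powr s) * indicator K x
          \<le> ennreal (2 powr s) * indicator K x + ennreal (2 powr s) * (ennreal (g x powr (2 * s / q)) * indicator K x)"
          using ennreal_leI[OF pt[of x]] by (cases "x \<in> K") (auto simp: ennreal_plus ennreal_mult)
      qed
      also have "\<dots> = ennreal (2 powr s) * emeasure lborel K + ennreal (2 powr s) * (\<integral>\<^sup>+x\<in>K. ennreal (g x powr (2 * s / q)) \<partial>lborel)"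
        by (simp add: nn_integral_add nn_integral_cmult)
      also have "\<dots> < \<infinity>"
        using emeasure_compact_finite[OF K(1)] fin[OF K] by (simp add: ennreal_mult_less_top less_top)
      finally show "(\<integral>\<^sup>+x\<in>K. ennreal (norm (G x) powr s) \<partial>lborel) < \<infinity>" .
    qed measurable
  qed
  with V show ?thesis by (auto simp: n_def)
qed

end
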